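(* For $\delta\ge3$ let $$H_{3,\delta}(n)=\sum_{\sigma\in\Sigma_\delta}\ \sum_{(T,x_T,F):\,|F|=3}c_{L+t}(n),\qquad c_{m}(n)=\begin{cases}\binom{n-m-1}{2}, & n\ge m+3,\\ 0,& n<m+3,\end{cases}$$ be the contribution of the canonical rank-three cells to $|\mathcal{R}_{\delta,n}|$, which for all large $n$ is a quadratic polynomial in $n$. Then the onset (the least $N$ such that $H_{3,\delta}(n)$ equals its eventual quadratic polynomial for all $n\ge N$) is $N=10$ for $\delta=3$, $N=12$ for $\delta=4$, and $N=\delta+9$ for every $\delta\ge5$.
   Context: Permutations are in one-line notation; $\operatorname{inv}(\pi)$ is the number of pairs $i<j$ with $\pi_i>\pi_j$. A permutation avoids $1324$ if there are no indices $i_1<i_2<i_3<i_4$ with $\pi_{i_1}<\pi_{i_3}<\pi_{i_2}<\pi_{i_4}$. A permutation of length $n$ is decomposable if for some $1\le j<n$ its first $j$ entries are exactly $\{1,\dots,j\}$; otherwise indecomposable. $\pi\setminus x$: delete the entry $x$ and standardize. An indecomposable $\pi$ of length $n$ is almost decomposable if at least one of $\pi\setminus 1$, $\pi\setminus n$, $\pi\setminus\pi_1$, $\pi\setminus\pi_n$ (deleting the smallest, largest, first, last entry) is decomposable. $\mathcal{R}_{\delta,n}$ is the set of $1324$-avoiding permutations of length $n$ with $2n-7+\delta$ inversions that are indecomposable and not almost decomposable. $\sigma$ is reduced if $\sigma_{i+1}\ne\sigma_i+1$ for all $i$. For $b\in\mathbb{Z}_{\ge1}^s$, $\sigma[b]$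 is the inflation replacing the $i$th entry of $\sigma$ by an increasing run of $b_i$ entries (consecutive positions and values). $\Sigma_\delta$ is the (finite) set of reduced $\sigma$ such that $\sigma[b]\in\mathcal{R}_{\delta,n}$ for some $b$ and some $n\ge3$; its members are indecomposable, $1324$-avoiding and of length $\ge2$. $\mathrm{Inv}(\sigma)=\{(i,j):i<j,\sigma_i>\sigma_j\}$ is the edge set of the inversion graph on positions, and $N(i)$ is the neighbourhood of $i$ in it. For such $\sigma$ of length $s$ let $I(\sigma)=\{1,s,\sigma^{-1}(1),\sigma^{-1}(s)\}$ and $D(\sigma)=\{i\in I(\sigma):\sigma\setminus i\text{ (delete position }i\text{, standardize) is decomposable, or }s=2\}$. Put $\ell_i=2$ if $i\in D(\sigma)$, $\ell_i=1$ otherwise, $L=\sum_i\ell_i$, $\delta_0=\operatorname{inv}(\sigma[\ell])-2L+7$, $h=\delta-\delta_0$, $a_i=\sum_{j\in N(i)}\ell_j-2\ge0$, $Q(x)=\sum_ia_ix_i+\sum_{(i,j)\in\mathrm{Inv}(\sigma)}x_ix_j$. A canonical cell at defect $\delta$ is a $\sigma\in\Sigma_\delta$ with a triple $(T,x_T,F)$: a set $T\subseteq\{1,\dots,s\}$; a vector $x_T\in\mathbb{Z}_{\ge1}^T$ whose extension by $0$ has $Q=h$, with $t=\sum_{i\in T}x_i$; and a set $F$ of positions $i\notin T$ with $a_i=0$ and $N(i)\cap(T\cup F)=\varnothing$; such that every $i\in T$ has $a_i\ge1$ or a neighbour in $T\cup F$. Its rank is $|F|$. It parametrizes the residuals $\sigma[\ell+x]$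 with $x=x_T$ on $T$, arbitrary positive integers on $F$ and $0$ elsewhere, so a rank-three cell contributes $c_{L+t}(n)$ residuals of length $n$. *)

theory Defs
  imports
    "HOL-Combinatorics.Multiset_Permutations"
    "HOL-Computational_Algebra.Polynomial"
begin

text \<open>
  A permutation of length \<open>n\<close> in one-line notation is an element of
  \<^term>\<open>permutations_of_set {1..n}\<close>, i.e. a list that contains each of the values \<open>1, \<dots>, n\<close> exactly
  once. Values are counted from \<open>1\<close>, but positions are list indices and hence counted from \<open>0\<close>: the
  \<open>i\<close>-th entry is \<open>\<pi> ! (i - 1)\<close>, and the positions of a permutation of length \<open>s\<close> are
  \<open>{..<s}\<close>.
\<close>

definition Inv :: "nat list \<Rightarrow> (nat \<times> nat) set" where
  "Inv \<pi> = {(i, j). i < j \<and> j < length \<pi> \<and> \<pi> ! i > \<pi> ! j}"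

definition inv_count :: "nat list \<Rightarrow> nat" where
  "inv_count \<pi> = card (Inv \<pi>)"

definition avoids_1324 :: "nat list \<Rightarrow> bool" where
  "avoids_1324 \<pi> \<longleftrightarrow>
     \<not> (\<exists>i1 i2 i3 i4. i1 < i2 \<and> i2 < i3 \<and> i3 < i4 \<and> i4 < length \<pi> \<and>
          \<pi> ! i1 < \<pi> ! i3 \<and> \<pi> ! i3 < \<pi> ! i2 \<and> \<pi> ! i2 < \<pi> ! i4)"

definition decomposable :: "nat list \<Rightarrow> bool" where
  "decomposable \<pi> \<longleftrightarrow> (\<exists>j. 1 \<le> j \<and> j < length \<pi> \<and> set (take j \<pi>) = {1..j})"

definition standardize :: "nat list \<Rightarrow> nat list" where
  "standardize xs = map (\<lambda>x. card {y \<in> set xs. y \<le> x}) xs"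

definition delete_entry :: "nat \<Rightarrow> nat list \<Rightarrow> nat list" where
  "delete_entry x \<pi> = standardize (removeAll x \<pi>)"

definition delete_position :: "nat \<Rightarrow> nat list \<Rightarrow> nat list" where
  "delete_position i \<pi> = standardize (take i \<pi> @ drop (Suc i) \<pi>)"

definition almost_decomposable :: "nat list \<Rightarrow> bool" where
  "almost_decomposable \<pi> \<longleftrightarrow> \<not> decomposable \<pi> \<and>
     (decomposable (delete_entry 1 \<pi>) \<or> decomposable (delete_entry (length \<pi>) \<pi>) \<or>
      decomposable (delete_entry (hd \<pi>) \<pi>) \<or> decomposable (delete_entry (last \<pi>) \<pi>))"

definition \<R> :: "nat \<Rightarrow> nat \<Rightarrow> nat list set" where
  "\<R> \<delta> n = {\<pi> \<in> permutations_of_set {1..n}.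
     avoids_1324 \<pi> \<and> int (inv_count \<pi>) = 2 * int n - 7 + int \<delta> \<and>
     \<not> decomposable \<pi> \<and> \<not> almost_decomposable \<pi>}"

definition reduced :: "nat list \<Rightarrow> bool" where
  "reduced \<sigma> \<longleftrightarrow> (\<forall>i. Suc i < length \<sigma> \<longrightarrow> \<sigma> ! Suc i \<noteq> \<sigma> ! i + 1)"

text \<open>
  The inflation \<open>\<sigma>[b]\<close>: the entry at position \<open>i\<close> becomes an increasing run of \<open>b i\<close> consecutive
  values, which lies above all values used for the smaller entries of \<open>\<sigma>\<close>. Only the values of \<open>b\<close>
  on \<open>{..<length \<sigma>}\<close> matter.
\<close>
definition inflate :: "nat list \<Rightarrow> (nat \<Rightarrow> nat) \<Rightarrow> nat list" where
  "inflate \<sigma> b = concat (map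
     (\<lambda>i. map (\<lambda>k. (\<Sum>j | j < length \<sigma> \<and> \<sigma> ! j < \<sigma> ! i. b j) + k) [1..<Suc (b i)])
     [0..<length \<sigma>])"

definition \<Sigma> :: "nat \<Rightarrow> nat list set" where
  "\<Sigma> \<delta> = {\<sigma>. (\<exists>s. \<sigma> \<in> permutations_of_set {1..s}) \<and> reduced \<sigma> \<and>
     (\<exists>b n. (\<forall>i<length \<sigma>. b i \<ge> 1) \<and> n \<ge> 3 \<and> inflate \<sigma> b \<in> \<R> \<delta> n)}"

definition nbrs :: "nat list \<Rightarrow> nat \<Rightarrow> nat set" where
  "nbrs \<sigma> i = {j. (i, j) \<in> Inv \<sigma> \<or> (j, i) \<in> Inv \<sigma>}"

definition extremal_positions :: "nat list \<Rightarrow> nat set" where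
  "extremal_positions \<sigma> =
     {i. i < length \<sigma> \<and>
         (i = 0 \<or> i = length \<sigma> - 1 \<or> \<sigma> ! i = 1 \<or> \<sigma> ! i = length \<sigma>)}"

text \<open>
  \<open>dbl_positions\<close>, \<open>ell\<close> and \<open>ell_total\<close> are the set \<open>D(\<sigma>)\<close>, the vector \<open>\<ell>\<close> and its sum \<open>L\<close>; below,
  \<open>acoef\<close> is \<open>a\<^sub>i\<close>, \<open>Qform\<close> is the quadratic form \<open>Q\<close> and \<open>cell_count\<close> is \<open>c\<^sub>m(n)\<close>.
\<close>
definition dbl_positions :: "nat list \<Rightarrow> nat set" where
  "dbl_positions \<sigma> = {i \<in> extremal_positions \<sigma>. decomposable (delete_position i \<sigma>) \<or> length \<sigma> = 2}"

definition ell :: "nat list \<Rightarrow> nat \<Rightarrow> nat" where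
  "ell \<sigma> i = (if i \<in> dbl_positions \<sigma> then 2 else 1)"

definition ell_total :: "nat list \<Rightarrow> nat" where
  "ell_total \<sigma> = (\<Sum>i<length \<sigma>. ell \<sigma> i)"

definition \<delta>0 :: "nat list \<Rightarrow> int" where
  "\<delta>0 \<sigma> = int (inv_count (inflate \<sigma> (ell \<sigma>))) - 2 * int (ell_total \<sigma>) + 7"

definition acoef :: "nat list \<Rightarrow> nat \<Rightarrow> int" where
  "acoef \<sigma> i = (\<Sum>j\<in>nbrs \<sigma> i. int (ell \<sigma> j)) - 2"

definition Qform :: "nat list \<Rightarrow> (nat \<Rightarrow> nat) \<Rightarrow> int" where
  "Qform \<sigma> x = (\<Sum>i<length \<sigma>. acoef \<sigma> i * int (x i)) + (\<Sum>(i, j)\<in>Inv \<sigma>. int (x i) * int (x j))"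

text \<open>
  The triples \<open>(T, x\<^sub>T, F)\<close> that form a canonical cell together with \<open>\<sigma>\<close>. The vector \<open>x\<^sub>T\<close> is
  represented by its extension by \<open>0\<close> to all of \<^typ>\<open>nat\<close>, so that equal vectors are equal functions.
\<close>
definition canonical_cells :: "nat \<Rightarrow> nat list \<Rightarrow> (nat set \<times> (nat \<Rightarrow> nat) \<times> nat set) set" where
  "canonical_cells \<delta> \<sigma> = {(T, x, F).
     T \<subseteq> {..<length \<sigma>} \<and>
     (\<forall>i\<in>T. x i \<ge> 1) \<and> (\<forall>i. i \<notin> T \<longrightarrow> x i = 0) \<and>
     Qform \<sigma> x = int \<delta> - \<delta>0 \<sigma> \<and>
     F \<subseteq> {..<length \<sigma>} - T \<and>
     (\<forall>i\<in>F. acoef \<sigma> i = 0 \<and> nbrs \<sigma> i \<inter> (T \<union> F) = {}) \<and>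
     (\<forall>i\<in>T. acoef \<sigma> i \<ge> 1 \<or> nbrs \<sigma> i \<inter> (T \<union> F) \<noteq> {})}"

text \<open>
  The number of ways to write \<open>n - m\<close> as a sum of three positive integers, one for each position in a
  set \<open>F\<close> of size three.
\<close>
definition cell_count :: "nat \<Rightarrow> nat \<Rightarrow> nat" where
  "cell_count m n = (if n \<ge> m + 3 then (n - m - 1) choose 2 else 0)"

definition H3 :: "nat \<Rightarrow> nat \<Rightarrow> nat" where
  "H3 \<delta> n = (\<Sum>\<sigma>\<in>\<Sigma> \<delta>. \<Sum>(T, x, F) | (T, x, F) \<in> canonical_cells \<delta> \<sigma> \<and> card F = 3.
     cell_count (ell_total \<sigma> + (\<Sum>i\<in>T. x i)) n)"

text \<open>
  The onset with respect to \<open>p\<close> is only meaningful when \<open>f\<close> eventually agrees with \<open>p\<close>; in that case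
  \<open>p\<close> is determined by \<open>f\<close>.
\<close>
definition onset :: "(nat \<Rightarrow> nat) \<Rightarrow> real poly \<Rightarrow> nat" where
  "onset f p = (LEAST N. \<forall>n\<ge>N. real (f n) = poly p (real n))"

end

theory Submission
  imports Defs
begin

text \<open>
  A cell with \<open>m = L + t\<close> contributes \<open>c\<^sub>m(n)\<close>. The polynomial \<open>(n - m - 1)(n - m - 2) / 2\<close> agrees
  with \<open>c\<^sub>m\<close> for \<open>n > m\<close> and exceeds it by \<open>1\<close> at \<open>n = m\<close>. The sum over all rank-three cells
  therefore agrees with its polynomial beyond the largest \<open>m\<close>, call it \<open>M\<close>. At \<open>n = M\<close> the cells
  with \<open>m < M\<close> agree and each cell with \<open>m = M\<close> errs by \<open>1\<close> in the same direction, so nothing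
  cancels: the onset is \<open>M + 1\<close> (\<open>onset_sum_cell_count\<close>). It remains to see that there are only
  finitely many cells and that \<open>M\<close> is \<open>9\<close>, \<open>11\<close> or \<open>\<delta> + 8\<close> for \<open>\<delta> = 3\<close>, \<open>\<delta> = 4\<close>, \<open>\<delta> \<ge> 5\<close>.

  \<^bold>\<open>The upper bound.\<close> Put \<open>y = \<ell> + x\<close>, \<open>n = \<Sum>y\<^sub>i = L + t\<close> and let \<open>E\<close> be the sum of
  \<open>y\<^sub>i y\<^sub>j\<close> over the inversions of \<open>\<sigma>\<close>. The equation \<open>Q(x) = h\<close> says \<open>E = 2n - 7 + \<delta>\<close>, so
  \<open>n \<le> \<delta> + 8\<close> is the inequality \<open>E \<ge> 3n - 15\<close>. Order the positions of \<open>\<sigma>\<close> by comparing both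
  position and value. The inversion graph is the incomparability graph of this order, avoidance of
  \<open>1324\<close> says that every interval is a chain, and reducedness implies that distinct elements have
  distinct neighbourhoods. The set \<open>F\<close> is a chain \<open>f1 \<prec> f2 \<prec> f3\<close> of elements with weighted degree
  \<open>2\<close>; every neighbour of \<open>f2\<close> is one of \<open>f1\<close> or \<open>f3\<close>, and every common neighbour of \<open>f1\<close> and \<open>f3\<close>
  is one of \<open>f2\<close>. As the three neighbourhoods are distinct, they are
  \<open>{al, be}\<close>, \<open>{be, ep}\<close>, \<open>{ep, ze}\<close> with all four weights equal to \<open>1\<close> (\<open>chain_nbrs\<close>). The other
  elements lie below \<open>f1\<close>, above \<open>f3\<close>, or between consecutive \<open>f\<close>'s:
  those below \<open>f1\<close> form a connected graph and are adjacent to both \<open>al\<close> and \<open>be\<close>; those between have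
  three neighbours among the four; and \<open>al\<close>-\<open>be\<close>, \<open>ep\<close>-\<open>ze\<close> are edges. Counting edges gives
  \<open>E \<ge> 3n - 15\<close>. Equality, or equality up to \<open>1\<close>, leaves so little room that \<open>n\<close> must be at least
  \<open>13\<close>, respectively \<open>11\<close> (\<open>weight_bound\<close>), because \<open>be\<close> and \<open>ep\<close>, whose \<open>\<ell>\<close> is \<open>1\<close>, are not cut
  vertices. This excludes \<open>\<delta> + 8\<close> for \<open>\<delta> \<le> 4\<close> and \<open>\<delta> + 7\<close> for \<open>\<delta> = 3\<close>
  (\<open>rank_three_size\<close>).

  \<^bold>\<open>Sharpness.\<close> Three explicit permutations of lengths \<open>9\<close>, \<open>11\<close>, \<open>13\<close> attain the bound; the last
  one, inflated at one entry, serves all \<open>\<delta> \<ge> 5\<close> (\<open>rank_three_size_attained\<close>).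

  \<^bold>\<open>Finiteness.\<close> If two entries of a reduced \<open>1324\<close>-avoider are not inverted, their distance is
  at most three times the sum of their degrees (\<open>position_gap\<close>). Summing over all pairs, the number
  of inversions grows quadratically with the length, whereas membership in \<open>\<Sigma>\<close> allows only linear
  growth (\<open>finite_\<Sigma>\<close>).
\<close>

section \<open>Connected graphs and edge weights\<close>

text \<open>
  Connectedness is phrased with neighbourhood functions because the same set of positions is viewed
  through different descriptions of its graph: the inversions of a list, and incomparability in an
  order.
\<close>
definition connected_on :: "('a \<Rightarrow> 'a set) \<Rightarrow> 'a set \<Rightarrow> bool" where
  "connected_on N P \<longleftrightarrow> (\<forall>S. S \<subset> P \<longrightarrow> S \<noteq> {} \<longrightarrow> (\<exists>u\<in>S. \<exists>v\<in>P - S. v \<in> N u))"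

lemma connected_onD:
  assumes "connected_on N P" "S \<subset> P" "S \<noteq> {}"
  obtains u v where "u \<in> S" "v \<in> P - S" "v \<in> N u"
  using assms unfolding connected_on_def by blast

text \<open>
  A vertex whose neighbours are pairwise adjacent is no cut vertex: a path through it can take the
  edge between its two neighbours instead.
\<close>
lemma connected_on_remove:
  assumes conn: "connected_on N P"
    and sym: "\<And>u v. u \<in> P \<Longrightarrow> v \<in> P \<Longrightarrow> v \<in> N u \<Longrightarrow> u \<in> N v"
    and f: "f \<in> P"
    and clique: "\<And>u v. u \<in> N f \<Longrightarrow> v \<in> N f \<Longrightarrow> u \<noteq> v \<Longrightarrow> v \<in> N u"
  shows "connected_on N (P - {f})"
  unfolding connected_on_def
proof (intro allI impI)
  fix S assume S: "S \<subset> P - {f}" "S \<noteq> {}"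
  show "\<exists>u\<in>S. \<exists>v\<in>P - {f} - S. v \<in> N u"
  proof (rule ccontr)
    assume none: "\<not> ?thesis"
    have "S \<subset> P" using S f by blast
    then obtain u v where uv: "u \<in> S" "v \<in> P - S" "v \<in> N u"
      using connected_onD[OF conn _ S(2)] by blast
    then have u: "u \<in> N f" using none sym S f by blast
    define T where "T = P - {f} - S"
    have "T \<subset> P" "T \<noteq> {}" using S f unfolding T_def by blast+
    then obtain u' v' where uv': "u' \<in> T" "v' \<in> P - T" "v' \<in> N u'"
      using connected_onD[OF conn] by blast
    then have "v' = f \<or> v' \<in> S" "u' \<in> P" unfolding T_def by auto
    then have "u' \<in> N f" using none sym S f uv' unfolding T_def by blast
    then have "u' \<in> N u" using clique u uv(1) uv'(1) unfolding T_def by blast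
    then show False using none uv(1) uv'(1) unfolding T_def by blast
  qed
qed

text \<open>
  Both orientations of each edge are present, so \<open>edge_weight\<close> below counts every edge twice. This
  avoids choosing an orientation, which reversal of the order would not respect.
\<close>
definition adj_pairs :: "('a \<Rightarrow> 'a set) \<Rightarrow> 'a set \<Rightarrow> ('a \<times> 'a) set" where
  "adj_pairs N S = {(u, v). u \<in> S \<and> v \<in> S \<and> v \<in> N u}"

definition edge_weight :: "('a \<Rightarrow> 'a set) \<Rightarrow> ('a \<Rightarrow> nat) \<Rightarrow> 'a set \<Rightarrow> nat" where
  "edge_weight N y S = (\<Sum>(u, v)\<in>adj_pairs N S. y u * y v)"

lemma finite_adj_pairs: "finite S \<Longrightarrow> finite (adj_pairs N S)"
  by (rule finite_subset[of _ "S \<times> S"]) (auto simp: adj_pairs_def)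

lemma edge_weight_mono:
  assumes "finite T" "S \<subseteq> T"
  shows "edge_weight N y S \<le> edge_weight N y T"
  unfolding edge_weight_def
  by (rule sum_mono2) (use assms finite_adj_pairs in \<open>auto simp: adj_pairs_def\<close>)

lemma edge_weight_Un:
  assumes fin: "finite S" "finite T" and disj: "S \<inter> T = {}"
    and sym: "\<And>u v. u \<in> S \<union> T \<Longrightarrow> v \<in> S \<union> T \<Longrightarrow> v \<in> N u \<Longrightarrow> u \<in> N v"
  shows "edge_weight N y (S \<union> T) =
    edge_weight N y S + edge_weight N y T + 2 * (\<Sum>u\<in>S. y u * sum y (N u \<inter> T))"
proof -
  let ?X = "Sigma S (\<lambda>u. N u \<inter> T)"
  have split: "adj_pairs N (S \<union> T) = (adj_pairs N S \<union> adj_pairs N T) \<union> (?X \<union> ?X\<inverse>)"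
    using sym unfolding adj_pairs_def by auto
  have finX: "finite ?X" using fin by auto
  have c: "(\<Sum>(u, v)\<in>?X\<inverse>. y u * y v) = (\<Sum>(u, v)\<in>?X. y u * y v)"
    by (rule sum.reindex_bij_witness[of _ prod.swap prod.swap]) (auto simp: mult.commute)
  have x: "(\<Sum>(u, v)\<in>?X. y u * y v) = (\<Sum>u\<in>S. y u * sum y (N u \<inter> T))"
    using fin by (subst sum.Sigma[symmetric]) (auto simp: sum_distrib_left)
  have "edge_weight N y (S \<union> T) =
     (\<Sum>(u, v)\<in>adj_pairs N S \<union> adj_pairs N T. y u * y v) + (\<Sum>(u, v)\<in>?X \<union> ?X\<inverse>. y u * y v)"
    unfolding edge_weight_def split
    by (rule sum.union_disjoint) (use fin finX disj finite_adj_pairs in \<open>auto simp: adj_pairs_def\<close>)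
  also have "(\<Sum>(u, v)\<in>adj_pairs N S \<union> adj_pairs N T. y u * y v) = edge_weight N y S + edge_weight N y T"
    unfolding edge_weight_def
    by (rule sum.union_disjoint) (use fin disj finite_adj_pairs in \<open>auto simp: adj_pairs_def\<close>)
  also have "(\<Sum>(u, v)\<in>?X \<union> ?X\<inverse>. y u * y v) = (\<Sum>(u, v)\<in>?X. y u * y v) + (\<Sum>(u, v)\<in>?X\<inverse>. y u * y v)"
    by (rule sum.union_disjoint) (use finX disj in auto)
  finally show ?thesis unfolding c x by simp
qed

text \<open>
  A weighted form of the fact that a connected graph has at least as many edges as a spanning tree.
  Grow a vertex set from a single edge; a new vertex \<open>v\<close> joined to \<open>u\<close> adds an edge of weight
  \<open>y u * y v \<ge> y v\<close>. A single vertex of weight above \<open>1\<close> would be a counterexample, hence the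
  start from an edge and the two vertices in the hypothesis.
\<close>
lemma connected_edge_weight:
  assumes fin: "finite P" and card: "card P \<ge> 2" and conn: "connected_on N P"
    and sym: "\<And>u v. u \<in> P \<Longrightarrow> v \<in> P \<Longrightarrow> v \<in> N u \<Longrightarrow> u \<in> N v"
    and y: "\<And>u. u \<in> P \<Longrightarrow> y u \<ge> 1"
  shows "2 * sum y P \<le> edge_weight N y P + 2"
proof -
  have prod: "a + b \<le> a * b + 1" if "a \<ge> 1" "b \<ge> 1" for a b :: nat
    using that by (cases a; cases b) auto
  have "\<exists>S\<subseteq>P. card S = k \<and> 2 * sum y S \<le> edge_weight N y S + 2" if "2 \<le> k" "k \<le> card P" for k
    using that
  proof (induction k rule: dec_induct)
    case base
    have "P \<noteq> {}" using card by auto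
    then obtain u where u: "u \<in> P" by blast
    have "P \<noteq> {u}" using card by auto
    then have "{u} \<subset> P" using u by blast
    then obtain a v where "a \<in> {u}" "v \<in> P - {u}" "v \<in> N a"
      by (rule connected_onD[OF conn]) auto
    then have v: "v \<in> P" "v \<noteq> u" "v \<in> N u" by auto
    have "(\<Sum>(a, b)\<in>{(u, v), (v, u)}. y a * y b) \<le> edge_weight N y {u, v}"
      unfolding edge_weight_def
      by (rule sum_mono2[OF finite_adj_pairs]) (use u v sym in \<open>auto simp: adj_pairs_def\<close>)
    then have "2 * (y u * y v) \<le> edge_weight N y {u, v}" using v by (simp add: mult.commute)
    then have "2 * sum y {u, v} \<le> edge_weight N y {u, v} + 2"
      using prod[OF y[OF u] y[OF v(1)]] v(2) by simp
    then show ?case using u v by (intro exI[of _ "{u, v}"]) auto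
  next
    case (step k)
    then obtain S where S: "S \<subseteq> P" "card S = k" "2 * sum y S \<le> edge_weight N y S + 2" by auto
    have "S \<subset> P" "S \<noteq> {}" using S step.hyps step.prems by auto
    then obtain u v where uv: "u \<in> S" "v \<in> P - S" "v \<in> N u" using connected_onD[OF conn] by blast
    have finS: "finite S" using S fin finite_subset by blast
    have "edge_weight N y ({v} \<union> S) =
        edge_weight N y {v} + edge_weight N y S + 2 * (\<Sum>a\<in>{v}. y a * sum y (N a \<inter> S))"
      by (rule edge_weight_Un) (use finS uv S sym in auto)
    moreover have "y u \<le> sum y (N v \<inter> S)"
      by (rule member_le_sum) (use uv S sym finS in auto)
    moreover have "1 \<le> y u" using y uv S by blast
    ultimately have "edge_weight N y S + 2 * y v \<le> edge_weight N y (insert v S)"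
      by (cases "sum y (N v \<inter> S)") auto
    then show ?case using S uv finS by (intro exI[of _ "insert v S"]) auto
  qed
  from this[OF card order.refl] obtain S where "S \<subseteq> P" "card S = card P"
    "2 * sum y S \<le> edge_weight N y S + 2" by auto
  then show ?thesis using card_subset_eq[OF fin] by metis
qed

section \<open>Orders whose intervals are chains\<close>

definition incomparable :: "'a set \<Rightarrow> ('a \<Rightarrow> 'a \<Rightarrow> bool) \<Rightarrow> 'a \<Rightarrow> 'a set" where
  "incomparable V r u = {v \<in> V. v \<noteq> u \<and> \<not> r u v \<and> \<not> r v u}"

lemma incomparable_converse: "incomparable V (\<lambda>u v. r v u) = incomparable V r"
  by (auto simp: incomparable_def fun_eq_iff)

text \<open>
  The order-theoretic content of a reduced indecomposable \<open>1324\<close>-avoider. Stated for an arbitrary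
  order, it is invariant under reversal, so that every fact about the elements below a chain has a
  counterpart about the elements above it.
\<close>
locale thin_order =
  fixes V :: "'a set" and prec :: "'a \<Rightarrow> 'a \<Rightarrow> bool"  (infix "\<prec>" 50)
  assumes finite_V: "finite V"
    and irrefl: "\<not> u \<prec> u"
    and trans: "u \<prec> v \<Longrightarrow> v \<prec> w \<Longrightarrow> u \<prec> w"
    and interval_chain: "\<lbrakk>a \<in> V; u \<in> V; v \<in> V; b \<in> V; a \<prec> u; a \<prec> v; u \<prec> b; v \<prec> b\<rbrakk>
      \<Longrightarrow> u = v \<or> u \<prec> v \<or> v \<prec> u"
    and no_twins: "inj_on (incomparable V (\<prec>)) V"
    and conn: "connected_on (incomparable V (\<prec>)) V"
begin

abbreviation N :: "'a \<Rightarrow> 'a set" where "N \<equiv> incomparable V (\<prec>)"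

lemma N_sym: "u \<in> V \<Longrightarrow> v \<in> N u \<Longrightarrow> u \<in> N v"
  by (auto simp: incomparable_def)

lemma N_iff: "v \<in> N u \<longleftrightarrow> v \<in> V \<and> v \<noteq> u \<and> \<not> u \<prec> v \<and> \<not> v \<prec> u"
  by (auto simp: incomparable_def)

lemma thin_order_converse: "thin_order V (\<lambda>u v. v \<prec> u)"
proof
  show "u = v \<or> v \<prec> u \<or> u \<prec> v"
    if "a \<in> V" "u \<in> V" "v \<in> V" "b \<in> V" "u \<prec> a" "v \<prec> a" "b \<prec> u" "b \<prec> v" for a u v b
    using interval_chain[of b u v a] that by blast
qed (use finite_V irrefl trans no_twins conn in \<open>auto simp: incomparable_converse[of V prec]\<close>)

text \<open>
  Intervals being chains forces \<open>N f2 \<subseteq> N f1 \<union> N f3\<close>, and transitivity gives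
  \<open>N f1 \<inter> N f3 \<subseteq> N f2\<close>. Two distinct neighbourhoods of weight \<open>2\<close> overlap in weight at most \<open>1\<close>,
  so the two overlaps of \<open>N f2\<close> must have weight exactly \<open>1\<close> and be disjoint.
\<close>
lemma chain_nbrs:
  fixes ell :: "'a \<Rightarrow> nat"
  assumes f: "f1 \<in> V" "f2 \<in> V" "f3 \<in> V" and chain: "f1 \<prec> f2" "f2 \<prec> f3"
    and pos: "\<And>v. v \<in> V \<Longrightarrow> ell v \<ge> 1"
    and sum2: "sum ell (N f1) = 2" "sum ell (N f2) = 2" "sum ell (N f3) = 2"
  obtains al be ep ze where "N f1 = {al, be}" "N f2 = {be, ep}" "N f3 = {ep, ze}"
    "distinct [al, be, ep, ze]" "ell al = 1" "ell be = 1" "ell ep = 1" "ell ze = 1"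
proof -
  have fin: "finite (N u)" for u using finite_V by (auto simp: incomparable_def)
  have ge1: "ell v \<ge> 1" if "v \<in> N u" for u v using that pos by (auto simp: incomparable_def)
  have sub: "N f2 \<subseteq> N f1 \<union> N f3"
  proof
    fix u assume u: "u \<in> N f2"
    show "u \<in> N f1 \<union> N f3"
      using interval_chain[of f1 f2 u f3] u f chain trans irrefl unfolding N_iff Un_iff by metis
  qed
  have inter: "N f1 \<inter> N f3 \<subseteq> N f2" using chain trans f by (auto simp: N_iff)
  have ne: "N f1 \<noteq> N f2" "N f2 \<noteq> N f3"
    using no_twins f chain irrefl by (metis inj_onD)+
  have small: "sum ell (N u \<inter> N v) \<le> 1"
    if "N u \<noteq> N v" "sum ell (N u) = 2" "sum ell (N v) = 2" for u v
  proof (rule ccontr)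
    assume *: "\<not> ?thesis"
    have zero: "N u - N v = {}" if "sum ell (N u) = 2" "\<not> sum ell (N u \<inter> N v) \<le> 1" for u v
    proof -
      have "sum ell (N u) = sum ell (N u \<inter> N v) + sum ell (N u - N v)"
        by (rule sum.Int_Diff[OF fin])
      then have "sum ell (N u - N v) = 0" using that by linarith
      then have "\<forall>w\<in>N u - N v. ell w = 0" using fin by simp
      then show ?thesis using ge1 by fastforce
    qed
    have "N u - N v = {}" "N v - N u = {}"
      using zero[of u v] zero[of v u] that * by (auto simp: Int_commute)
    then show False using that(1) by blast
  qed
  have s12: "sum ell (N f1 \<inter> N f2) \<le> 1" and s23: "sum ell (N f2 \<inter> N f3) \<le> 1"
    using small ne sum2 by auto
  have un: "N f2 = (N f1 \<inter> N f2) \<union> (N f2 \<inter> N f3)" using sub by blast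
  have "sum ell (N f2) + sum ell ((N f1 \<inter> N f2) \<inter> (N f2 \<inter> N f3))
      = sum ell (N f1 \<inter> N f2) + sum ell (N f2 \<inter> N f3)"
    by (subst (1) un, rule sum.union_inter) (use fin in auto)
  then have e12: "sum ell (N f1 \<inter> N f2) = 1" and e23: "sum ell (N f2 \<inter> N f3) = 1"
    and e0: "sum ell ((N f1 \<inter> N f2) \<inter> (N f2 \<inter> N f3)) = 0"
    using s12 s23 sum2 by linarith+
  have empty: "N f1 \<inter> N f2 \<inter> N f3 = {}"
  proof -
    have "\<forall>w\<in>(N f1 \<inter> N f2) \<inter> (N f2 \<inter> N f3). ell w = 0" using e0 fin by simp
    then show ?thesis using ge1 by fastforce
  qed
  have single: "\<exists>w. M = {w} \<and> ell w = 1" if M: "M \<subseteq> N u" "sum ell M = 1" for M u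
  proof -
    have finM: "finite M" using M fin finite_subset by blast
    have "card M \<le> sum ell M"
      using sum_mono[of M "\<lambda>_. 1" ell] ge1 M(1) by auto
    moreover have "M \<noteq> {}" using M by auto
    ultimately have "card M = 1" using M finM by (simp add: card_gt_0_iff le_antisym Suc_leI)
    then obtain w where "M = {w}" by (auto simp: card_1_singleton_iff)
    then show ?thesis using M by auto
  qed
  have d1: "sum ell (N f1 - N f2) = 1"
    using sum.Int_Diff[OF fin, of ell f1 "N f2"] e12 sum2 by simp
  have d3: "sum ell (N f3 - N f2) = 1"
    using sum.Int_Diff[OF fin, of ell f3 "N f2"] e23 sum2 by (simp add: Int_commute)
  obtain al where al: "N f1 - N f2 = {al}" "ell al = 1" using single[of _ f1, OF _ d1] by auto
  obtain ze where ze: "N f3 - N f2 = {ze}" "ell ze = 1" using single[of _ f3, OF _ d3] by auto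
  obtain be where be: "N f1 \<inter> N f2 = {be}" "ell be = 1" using single[of _ f1, OF _ e12] by auto
  obtain ep where ep: "N f2 \<inter> N f3 = {ep}" "ell ep = 1" using single[of _ f2, OF _ e23] by auto
  have "N f1 = (N f1 - N f2) \<union> (N f1 \<inter> N f2)" by blast
  then have N1: "N f1 = {al, be}" unfolding al(1) be(1) by auto
  have N2: "N f2 = {be, ep}" using un unfolding be(1) ep(1) by auto
  have "N f3 = (N f2 \<inter> N f3) \<union> (N f3 - N f2)" by blast
  then have N3: "N f3 = {ep, ze}" unfolding ep(1) ze(1) by auto
  have "al \<in> N f1 - N f2" "be \<in> N f1 \<inter> N f2" "ep \<in> N f2 \<inter> N f3" "ze \<in> N f3 - N f2"
    unfolding al(1) be(1) ep(1) ze(1) by simp_all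
  then have "al \<noteq> be" "al \<noteq> ep" "be \<noteq> ep" "be \<noteq> ze" "ep \<noteq> ze" "al \<noteq> ze"
    using empty inter by blast+
  then have "distinct [al, be, ep, ze]" by simp
  then show ?thesis using that N1 N2 N3 al(2) be(2) ep(2) ze(2) by blast
qed

end

text \<open>
  The neighbourhoods of the chain \<open>f1 \<prec> f2 \<prec> f3\<close> form the path
  \<open>al, f1, be, f2, ep, f3, ze\<close> in the incomparability graph.
\<close>
locale path_config = thin_order +
  fixes f1 f2 f3 al be ep ze :: 'a
  assumes f_in: "f1 \<in> V" "f2 \<in> V" "f3 \<in> V"
    and chain: "f1 \<prec> f2" "f2 \<prec> f3"
    and N_f1: "N f1 = {al, be}" and N_f2: "N f2 = {be, ep}" and N_f3: "N f3 = {ep, ze}"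
    and distinct_nbrs: "distinct [al, be, ep, ze]"
begin

lemma converse: "path_config V (\<lambda>u v. v \<prec> u) f3 f2 f1 ze ep be al"
proof -
  interpret conv: thin_order V "\<lambda>u v. v \<prec> u" by (rule thin_order_converse)
  show ?thesis
    by unfold_locales
      (use f_in chain N_f1 N_f2 N_f3 distinct_nbrs in \<open>auto simp: incomparable_converse[of V prec]\<close>)
qed

abbreviation A :: "'a set" where "A \<equiv> {v \<in> V. v \<prec> f1}"
abbreviation B :: "'a set" where "B \<equiv> {v \<in> V. f1 \<prec> v \<and> v \<prec> f2}"

lemma nbrs_in: "al \<in> V" "be \<in> V" "ep \<in> V" "ze \<in> V"
  using N_f1 N_f3 by (auto simp: incomparable_def)

lemma al_less: "al \<prec> f2"
proof -
  have "al \<notin> N f2" "al \<in> N f1" using N_f1 N_f2 distinct_nbrs by auto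
  then have "al = f2 \<or> f2 \<prec> al \<or> al \<prec> f2" "\<not> f1 \<prec> al" using nbrs_in by (auto simp: N_iff)
  then show ?thesis using chain trans by blast
qed

lemma be_less: "be \<prec> f3"
proof -
  have "be \<notin> N f3" "be \<in> N f2" using N_f3 N_f2 distinct_nbrs by auto
  then have "be = f3 \<or> f3 \<prec> be \<or> be \<prec> f3" "\<not> f2 \<prec> be" using nbrs_in by (auto simp: N_iff)
  then show ?thesis using chain trans by blast
qed

lemma al_be: "be \<in> N al"
proof -
  have "al \<in> N f1" "be \<in> N f1" "be \<in> N f2" using N_f1 N_f2 by auto
  then have "be \<noteq> al" "\<not> be \<prec> al" "\<not> be \<prec> f2" "\<not> f2 \<prec> be" "be \<noteq> f2"
    using distinct_nbrs al_less trans by (auto simp: N_iff)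
  moreover have "\<not> al \<prec> be"
    using interval_chain[of al f2 be f3] al_less be_less chain nbrs_in f_in calculation by blast
  ultimately show ?thesis using nbrs_in by (auto simp: N_iff)
qed

text \<open>
  If \<open>a \<prec> f1\<close> lay below \<open>al\<close> or \<open>be\<close>, the incomparable pair formed with \<open>f1\<close> would lie in the
  interval from \<open>a\<close> to \<open>f2\<close>, respectively \<open>f3\<close>.
\<close>
lemma N_A:
  assumes a: "a \<in> A"
  shows "N a - A = {al, be}"
proof (rule set_eqI)
  fix u
  have "u \<in> N a" if u: "u \<in> {al, be}"
  proof -
    have uf: "u \<in> N f1" and uV: "u \<in> V" using u N_f1 nbrs_in by auto
    obtain g where g: "u \<prec> g" "f1 \<prec> g" "g \<in> V"
      using u al_less be_less chain trans f_in by blast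
    have "\<not> a \<prec> u" using interval_chain[of a u f1 g] a uf uV g f_in by (auto simp: N_iff)
    moreover have "\<not> u \<prec> a" "u \<noteq> a" using uf a trans by (auto simp: N_iff)
    ultimately show ?thesis using uV by (simp add: N_iff)
  qed
  moreover have "u \<notin> A" if "u \<in> {al, be}" using that N_f1 by (auto simp: N_iff set_eq_iff)
  moreover have "u \<in> {al, be}" if "u \<in> N a" "u \<notin> A"
  proof -
    have "u \<in> N f1" using that a trans by (auto simp: N_iff)
    then show ?thesis using N_f1 by simp
  qed
  ultimately show "u \<in> N a - A \<longleftrightarrow> u \<in> {al, be}" by blast
qed

lemma A_up_chain:
  assumes "a \<in> A" "u \<in> A" "v \<in> A" "a \<prec> u" "a \<prec> v"
  shows "u = v \<or> u \<prec> v \<or> v \<prec> u"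
  using interval_chain[of a u v f1] assms f_in by auto

lemma A_max_above:
  assumes "a \<in> A"
  obtains m where "m \<in> A" "m = a \<or> a \<prec> m" "\<forall>v\<in>A. \<not> m \<prec> v"
proof -
  let ?S = "{v \<in> A. v = a \<or> a \<prec> v}"
  have fin: "finite ?S" using finite_V by simp
  have tr: "transp_on ?S (\<prec>)" using trans by (auto intro: transp_onI)
  have as: "asymp_on ?S (\<prec>)" by (rule asymp_onI) (use trans irrefl in blast)
  have ne: "?S \<noteq> {}" using assms by auto
  obtain m where m: "m \<in> ?S" "\<forall>v\<in>?S. v \<noteq> m \<longrightarrow> \<not> m \<prec> v"
    using Finite_Set.bex_max_element[OF fin as tr ne] by blast
  moreover have "\<not> m \<prec> v" if "v \<in> A" for v
  proof
    assume mv: "m \<prec> v"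
    then have "v \<in> ?S" using m(1) that trans[of a m v] by auto
    then show False using m(2) mv irrefl by metis
  qed
  ultimately show ?thesis using that by blast
qed

text \<open>
  A greatest element below \<open>f1\<close> would have no neighbours but \<open>al\<close> and \<open>be\<close>, exactly like \<open>f1\<close>.
\<close>
lemma A_no_maximum:
  assumes "m \<in> A" shows "\<exists>v\<in>A. v \<noteq> m \<and> \<not> v \<prec> m"
proof (rule ccontr)
  assume "\<not> ?thesis"
  then have "N m \<inter> A = {}" by (auto simp: N_iff)
  then have "N m = N f1" using N_A[OF assms] N_f1 by blast
  then show False using no_twins assms f_in irrefl by (metis (no_types, lifting) inj_onD mem_Collect_eq)
qed

text \<open>
  Above any element of \<open>A\<close> the set \<open>A\<close> is a chain, since it lies in an interval ending in \<open>f1\<close>.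
  So no element is below two different maximal ones. But there are at least two maximal elements,
  they are adjacent to each other and hence on the same side of a supposed separation, and an element
  of the other side would have to be below both.
\<close>
lemma A_connected: "connected_on N A"
  unfolding connected_on_def
proof (intro allI impI)
  fix S assume S: "S \<subset> A" "S \<noteq> {}"
  show "\<exists>u\<in>S. \<exists>v\<in>A - S. v \<in> N u"
  proof (rule ccontr)
    assume "\<not> ?thesis"
    then have none: "u \<notin> N v \<and> v \<notin> N u" if "u \<in> S" "v \<in> A - S" for u v
      using that N_sym S by blast
    obtain s t where st: "s \<in> S" "t \<in> A - S" using S by blast
    have sA: "s \<in> A" using st S by blast
    obtain m where m: "m \<in> A" "m = s \<or> s \<prec> m" "\<forall>v\<in>A. \<not> m \<prec> v"
      by (rule A_max_above[OF sA])
    obtain v where v: "v \<in> A" "v \<noteq> m" "\<not> v \<prec> m" using A_no_maximum[OF m(1)] by auto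
    obtain m' where m': "m' \<in> A" "m' = v \<or> v \<prec> m'" "\<forall>w\<in>A. \<not> m' \<prec> w"
      by (rule A_max_above[OF v(1)])
    have "m' \<noteq> m" using m'(2) v by metis
    moreover have mm'': "\<not> m \<prec> m'" "\<not> m' \<prec> m" using bspec[OF m(3) m'(1)] bspec[OF m'(3) m(1)] .
    ultimately have mm': "m' \<noteq> m" "m' \<in> N m" using m'(1) by (simp_all add: N_iff)
    have side: "m \<in> S \<longleftrightarrow> m' \<in> S" using none[of m m'] none[of m' m] mm'(2) m(1) m'(1) by auto
    have "\<exists>t\<in>A. t \<notin> N m \<and> t \<notin> N m' \<and> t \<noteq> m \<and> t \<noteq> m'"
    proof (cases "m \<in> S")
      case True
      then show ?thesis using none[of m t] none[of m' t] st side by (intro bexI[of _ t]) auto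
    next
      case False
      then show ?thesis using none[of s m] none[of s m'] st side m(1) m'(1) sA by (intro bexI[of _ s]) auto
    qed
    then obtain t where t: "t \<in> A" "t \<notin> N m" "t \<notin> N m'" "t \<noteq> m" "t \<noteq> m'" by auto
    have "t \<prec> m" "t \<prec> m'"
      using t bspec[OF m(3) t(1)] bspec[OF m'(3) t(1)] by (simp_all add: N_iff)
    from A_up_chain[OF t(1) m(1) m'(1) this] show False using mm' mm'' by simp
  qed
qed

lemma A_card: "A \<noteq> {} \<Longrightarrow> card A \<ge> 2"
proof -
  assume "A \<noteq> {}"
  then obtain m where m: "m \<in> A" by blast
  obtain v where "v \<in> A" "v \<noteq> m" using A_no_maximum[OF m] by auto
  then have "{m, v} \<subseteq> A" "card {m, v} = 2" using m by auto
  moreover have "finite A" using finite_V by simp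
  ultimately show ?thesis using card_mono[of A "{m, v}"] by linarith
qed

text \<open>
  This lemma and the next locate \<open>be\<close> at the end of the permutation: they are the hypotheses of
  \<open>extremal_position\<close>, which turns them into the statement that \<open>be\<close> is the first, last, smallest or
  largest entry.
\<close>
lemma be_minimal: "u \<in> V \<Longrightarrow> \<not> u \<prec> be"
proof
  assume u: "u \<in> V" "u \<prec> be"
  have b: "be \<in> N f1" using N_f1 by simp
  consider "u = f1" | "u \<in> A" | "f1 \<prec> u" | "u \<in> N f1" using u by (auto simp: N_iff)
  then show False
  proof cases
    case 2
    then have "be \<in> N u" using N_A by blast
    then show False using u by (simp add: N_iff)
  next
    case 4
    then have "u = al" using N_f1 u irrefl by auto
    then show False using al_be u by (auto simp: N_iff)
  qed (use u b trans in \<open>auto simp: N_iff\<close>)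
qed

lemma be_nbrs: "u \<in> N be \<Longrightarrow> (u = f2 \<or> u \<prec> f2) \<or> (u = f1 \<or> f1 \<prec> u)"
proof -
  assume u: "u \<in> N be"
  consider "u = f1" | "u \<in> A" | "f1 \<prec> u" | "u \<in> N f1" using u by (auto simp: N_iff)
  then show ?thesis
  proof cases
    case 4
    then have "u = al" using N_f1 u by (auto simp: N_iff)
    then show ?thesis using al_less by simp
  qed (use chain trans in auto)
qed

lemma f1_remove: "connected_on N (V - {f1})"
  by (rule connected_on_remove[OF conn])
    (use N_sym f_in N_f1 al_be nbrs_in in auto)

end

text \<open>
  The entries \<open>be\<close> and \<open>ep\<close> turn out to be extremal, and since \<open>\<ell>\<close> equals \<open>1\<close> there, deleting
  either leaves the permutation indecomposable.
\<close>
locale path_config_conn = path_config +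
  assumes conn_be: "connected_on N (V - {be})" and conn_ep: "connected_on N (V - {ep})"
begin

lemma converse_conn: "path_config_conn V (\<lambda>u v. v \<prec> u) f3 f2 f1 ze ep be al"
proof -
  interpret conv: path_config V "\<lambda>u v. v \<prec> u" f3 f2 f1 ze ep be al by (rule converse)
  show ?thesis
    by unfold_locales (use conn_be conn_ep in \<open>auto simp: incomparable_converse[of V prec]\<close>)
qed

text \<open>
  The neighbours of an element between \<open>f1\<close> and \<open>f2\<close> are among those of \<open>f1\<close> and \<open>f2\<close> and include
  the common neighbour \<open>be\<close>. Being different from \<open>N f1\<close> and \<open>N f2\<close>, the neighbourhood is everything or
  just \<open>{be}\<close>, and in the latter case \<open>be\<close> would be a cut vertex.
\<close>
lemma N_B:
  assumes h: "h \<in> B"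
  shows "N h = {al, be, ep}"
proof -
  have hV: "h \<in> V" "f1 \<prec> h" "h \<prec> f2" using h by auto
  have sub: "N h \<subseteq> {al, be, ep}"
  proof
    fix u assume u: "u \<in> N h"
    then have "u \<in> N f1 \<or> u \<in> N f2"
      using interval_chain[of f1 h u f2] hV f_in trans unfolding N_iff by metis
    then show "u \<in> {al, be, ep}" using N_f1 N_f2 by auto
  qed
  have bN: "be \<in> N f1" "be \<in> N f2" using N_f1 N_f2 by auto
  then have be: "be \<in> N h" using hV trans by (auto simp: N_iff)
  have "N h \<noteq> {al, be}" "N h \<noteq> {be, ep}"
    using no_twins hV f_in irrefl N_f1 N_f2 by (metis inj_onD)+
  moreover have "N h \<noteq> {be}"
  proof
    assume *: "N h = {be}"
    have "h \<noteq> be" using be by (auto simp: N_iff)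
    moreover have "f1 \<noteq> be" using bN by (auto simp: N_iff)
    moreover have "f1 \<noteq> h" using hV irrefl by auto
    ultimately have "{h} \<subset> V - {be}" using f_in hV by auto
    then obtain a v where "a \<in> {h}" "v \<in> V - {be} - {h}" "v \<in> N a"
      by (rule connected_onD[OF conn_be]) auto
    then show False using * by auto
  qed
  ultimately show ?thesis using sub be by auto
qed

text \<open>
  Without \<open>be\<close>, the part consisting of \<open>A\<close>, \<open>f1\<close> and \<open>al\<close> must still be joined to the rest, and
  only \<open>al\<close> can do this.
\<close>
lemma B_or_cross: "B \<noteq> {} \<or> ep \<in> N al \<or> ze \<in> N al"
proof -
  let ?S = "A \<union> {f1, al}"
  have alN: "al \<in> N f1" "be \<in> N f1" "be \<in> N f2" using N_f1 N_f2 by auto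
  have "be \<notin> ?S" using alN distinct_nbrs irrefl by (auto simp: N_iff)
  moreover have "f2 \<noteq> be" using alN by (auto simp: N_iff)
  moreover have "\<not> f2 \<prec> f1" "f2 \<noteq> f1" "f2 \<noteq> al"
    using chain(1) al_less trans[of f1 f2 f1] irrefl by metis+
  then have "f2 \<notin> ?S" by simp
  ultimately have "?S \<subset> V - {be}" using f_in nbrs_in by auto
  then obtain u v where uv: "u \<in> ?S" "v \<in> V - {be} - ?S" "v \<in> N u"
    by (rule connected_onD[OF conn_be]) auto
  have "v \<notin> N f1" using N_f1 uv by auto
  moreover have "v \<notin> N a" if "a \<in> A" for a using N_A[OF that] uv by blast
  ultimately have ual: "u = al" using uv by blast
  have v: "f1 \<prec> v" "v \<in> V" using \<open>v \<notin> N f1\<close> uv by (auto simp: N_iff)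
  consider "v = f2" | "v \<prec> f2" | "f2 \<prec> v" | "v \<in> N f2" using v by (auto simp: N_iff)
  then show ?thesis
  proof cases
    case 2
    then show ?thesis using v by blast
  next
    case 3
    then show ?thesis using uv(3) ual trans[OF al_less 3] by (simp add: N_iff)
  next
    case 4
    then show ?thesis using N_f2 uv ual by auto
  qed (use uv(3) ual al_less in \<open>auto simp: N_iff\<close>)
qed

abbreviation C :: "'a set" where "C \<equiv> {v \<in> V. f3 \<prec> v}"
abbreviation B' :: "'a set" where "B' \<equiv> {v \<in> V. f2 \<prec> v \<and> v \<prec> f3}"

text \<open>
  With the doubled weight \<open>edge_weight N y V = 2E\<close> and \<open>n = sum y V\<close> this reads \<open>E \<ge> 3n - 15\<close>,
  with \<open>n \<ge> 13\<close> in case of equality and \<open>n \<ge> 11\<close> in case \<open>E = 3n - 14\<close>. Each element outside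
  the seven named ones sends two or three edges to \<open>W = {al, be, ep, ze}\<close>. Those with three pay for
  themselves. Those in \<open>A\<close> or \<open>C\<close> with two obtain the third from the edges inside \<open>A\<close> or \<open>C\<close>, up to
  a deficit of \<open>1\<close> for each nonempty one of these sets. The edges inside \<open>W\<close> cover these deficits.
\<close>
lemma weight_bound:
  fixes y :: "'a \<Rightarrow> nat"
  assumes y: "\<And>v. v \<in> V \<Longrightarrow> y v \<ge> 1"
    and y1: "\<And>v. v \<in> {f1, f2, f3, al, be, ep, ze} \<Longrightarrow> y v = 1"
  shows "6 * sum y V \<le> edge_weight N y V + 30"
    and "edge_weight N y V + 30 = 6 * sum y V \<Longrightarrow> sum y V \<ge> 13"
    and "edge_weight N y V + 30 = 6 * sum y V + 2 \<Longrightarrow> sum y V \<ge> 11"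
proof -
  interpret conv: path_config_conn V "\<lambda>u v. v \<prec> u" f3 f2 f1 ze ep be al by (rule converse_conn)
  note cN = incomparable_converse[of V prec]
  let ?W = "{al, be, ep, ze}" and ?F = "{f1, f2, f3}"
  have W_N: "al \<in> N f1" "be \<in> N f1" "be \<in> N f2" "ep \<in> N f2" "ep \<in> N f3" "ze \<in> N f3"
    using N_f1 N_f2 N_f3 by auto
  have ep_ge: "f1 \<prec> ep" and ze_ge: "f2 \<prec> ze" using conv.be_less conv.al_less by auto
  have WA: "w \<notin> A \<and> w \<notin> B \<and> w \<notin> B' \<and> w \<notin> C \<and> w \<notin> ?F" if "w \<in> ?W" for w
    using that W_N al_less be_less ep_ge ze_ge chain trans irrefl unfolding N_iff by blast
  have V_eq: "V = ?W \<union> (?F \<union> A \<union> B \<union> B' \<union> C)"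
  proof
    show "V \<subseteq> ?W \<union> (?F \<union> A \<union> B \<union> B' \<union> C)"
    proof
      fix v assume v: "v \<in> V"
      show "v \<in> ?W \<union> (?F \<union> A \<union> B \<union> B' \<union> C)"
      proof (cases "v \<in> N f1 \<or> v \<in> N f2 \<or> v \<in> N f3")
        case True
        then show ?thesis using N_f1 N_f2 N_f3 by auto
      next
        case False
        then show ?thesis using v by (auto simp: N_iff)
      qed
    qed
  qed (use f_in nbrs_in in auto)
  let ?R = "?F \<union> A \<union> B \<union> B' \<union> C"
  have fin: "finite A" "finite B" "finite B'" "finite C" using finite_V by auto
  have disjW: "?R \<inter> ?W = {}" using WA by blast
  have fdist: "f1 \<noteq> f2" "f2 \<noteq> f3" "f1 \<noteq> f3" using chain trans irrefl by metis+
  have sumR: "sum g ?R = g f1 + g f2 + g f3 + sum g A + sum g B + sum g B' + sum g C"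
    for g :: "'a \<Rightarrow> nat"
  proof -
    have as: "\<not> v \<prec> u" if "u \<prec> v" for u v using that trans irrefl by blast
    have d: "?F \<inter> A = {}" "(?F \<union> A) \<inter> B = {}" "(?F \<union> A \<union> B) \<inter> B' = {}" "(?F \<union> A \<union> B \<union> B') \<inter> C = {}"
      using chain irrefl as trans by blast+
    show ?thesis
      using fin d fdist by (simp add: sum.union_disjoint del: Un_insert_left)
  qed
  have sumV: "sum y V = 7 + sum y A + sum y B + sum y B' + sum y C"
  proof -
    have "sum y V = sum y ?W + sum y ?R"
      by (subst V_eq, rule sum.union_disjoint) (use fin disjW in auto)
    then show ?thesis unfolding sumR using y1 distinct_nbrs by simp
  qed
  have NW: "sum y (N u \<inter> ?W) = (if u \<in> B \<union> B' then 3 else 2)" if uR: "u \<in> ?R" for u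
  proof -
    have ABC: "N u - A = {al, be}" if "u \<in> A" for u using N_A[OF that] .
    have CC: "N u - C = {ze, ep}" if "u \<in> C" for u using conv.N_A[of u] that unfolding cN by simp
    have BB: "N u = {al, be, ep}" if "u \<in> B" for u using N_B[OF that] .
    have BB': "N u = {ze, ep, be}" if "u \<in> B'" for u using conv.N_B[of u] that unfolding cN by auto
    have nB: "u \<notin> B \<union> B'" if "u \<in> ?F \<union> A \<union> C"
      using that chain irrefl trans by blast
    consider "u = f1" | "u = f2" | "u = f3" | "u \<in> A" | "u \<in> C" | "u \<in> B" | "u \<in> B'" using uR by blast
    then show ?thesis
    proof cases
      case 4
      have "ep \<notin> A" "ze \<notin> A" "al \<notin> A" "be \<notin> A" using WA by blast+
      then have "N u \<inter> ?W = {al, be}" using ABC[OF 4] by blast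
      then show ?thesis using nB 4 y1 distinct_nbrs by simp
    next
      case 5
      have "ep \<notin> C" "ze \<notin> C" "al \<notin> C" "be \<notin> C" using WA by blast+
      then have "N u \<inter> ?W = {ep, ze}" using CC[OF 5] by blast
      then show ?thesis using nB 5 y1 distinct_nbrs by simp
    next
      case 6
      then have "N u \<inter> ?W = {al, be, ep}" using BB by auto
      then show ?thesis using 6 y1 distinct_nbrs by simp
    next
      case 7
      then have "N u \<inter> ?W = {be, ep, ze}" using BB' by auto
      then show ?thesis using 7 y1 distinct_nbrs by simp
    qed (use nB N_f1 N_f2 N_f3 y1 distinct_nbrs in \<open>simp_all add: Int_insert_left\<close>)
  qed
  have cross: "(\<Sum>u\<in>?R. y u * sum y (N u \<inter> ?W))
      = 6 + 2 * sum y A + 3 * sum y B + 3 * sum y B' + 2 * sum y C"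
  proof -
    have as: "\<not> v \<prec> u" if "u \<prec> v" for u v using that trans irrefl by blast
    have nB: "u \<notin> B \<union> B'" if "u \<in> ?F \<union> A \<union> C" for u
      using that chain irrefl as trans by blast
    define d :: "'a \<Rightarrow> nat" where "d u = (if u \<in> B \<union> B' then 3 else 2)" for u
    have d3: "d u = 3" if "u \<in> B \<union> B'" for u using that unfolding d_def by simp
    have d2: "d u = 2" if "u \<in> ?F \<union> A \<union> C" for u using nB[OF that] unfolding d_def by simp
    have "(\<Sum>u\<in>?R. y u * sum y (N u \<inter> ?W)) = (\<Sum>u\<in>?R. y u * d u)"
      by (rule sum.cong[OF refl], subst NW) (simp_all add: d_def)
    also have "\<dots> = y f1 * d f1 + y f2 * d f2 + y f3 * d f3 + (\<Sum>u\<in>A. y u * d u) + (\<Sum>u\<in>B. y u * d u)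
        + (\<Sum>u\<in>B'. y u * d u) + (\<Sum>u\<in>C. y u * d u)"
      by (rule sumR)
    also have "(\<Sum>u\<in>A. y u * d u) = (\<Sum>u\<in>A. y u * 2)" by (rule sum.cong[OF refl], subst d2) auto
    also have "(\<Sum>u\<in>C. y u * d u) = (\<Sum>u\<in>C. y u * 2)" by (rule sum.cong[OF refl], subst d2) auto
    also have "(\<Sum>u\<in>B. y u * d u) = (\<Sum>u\<in>B. y u * 3)" by (rule sum.cong[OF refl], subst d3) auto
    also have "(\<Sum>u\<in>B'. y u * d u) = (\<Sum>u\<in>B'. y u * 3)" by (rule sum.cong[OF refl], subst d3) auto
    also have "d f1 = 2" by (rule d2) simp
    also have "d f2 = 2" by (rule d2) simp
    also have "d f3 = 2" by (rule d2) simp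
    finally show ?thesis using y1 by (simp add: sum_distrib_right[symmetric] mult.commute)
  qed
  have E_W: "edge_weight N y V = edge_weight N y ?R + edge_weight N y ?W
      + 2 * (\<Sum>u\<in>?R. y u * sum y (N u \<inter> ?W))"
  proof -
    have "V = ?R \<union> ?W" using V_eq by blast
    then show ?thesis
      by (metis (no_types, lifting) edge_weight_Un[of ?R ?W N y] disjW N_sym finite_V finite_Un)
  qed
  have E_R: "edge_weight N y A + edge_weight N y C \<le> edge_weight N y ?R"
  proof -
    have dAC: "A \<inter> C = {}" using chain trans irrefl by blast
    have "edge_weight N y (A \<union> C) = edge_weight N y A + edge_weight N y C
        + 2 * (\<Sum>u\<in>A. y u * sum y (N u \<inter> C))"
      by (rule edge_weight_Un) (use N_sym fin dAC in auto)
    then have "edge_weight N y A + edge_weight N y C \<le> edge_weight N y (A \<union> C)" by linarith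
    also have "\<dots> \<le> edge_weight N y ?R" by (rule edge_weight_mono) (use fin in auto)
    finally show ?thesis .
  qed
  \<comment> \<open>\<open>a\<close> and \<open>c\<close> are the deficits of \<open>A\<close> and \<open>C\<close>.\<close>
  define a where "a = (if A = {} then 0 else 1::nat)"
  define c where "c = (if C = {} then 0 else 1::nat)"
  have E_A: "2 * sum y A \<le> edge_weight N y A + 2 * a"
  proof (cases "A = {}")
    case True
    then show ?thesis by (simp only: sum.empty)
  next
    case False
    then have "2 * sum y A \<le> edge_weight N y A + 2"
      by (intro connected_edge_weight fin A_card A_connected) (use N_sym y in auto)
    moreover have "a = 1" using False unfolding a_def by (rule if_not_P)
    ultimately show ?thesis by simp
  qed
  have E_C: "2 * sum y C \<le> edge_weight N y C + 2 * c"
  proof (cases "C = {}")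
    case True
    then show ?thesis by (simp only: sum.empty)
  next
    case False
    then have "2 * sum y C \<le> edge_weight N y C + 2"
      by (intro connected_edge_weight fin conv.A_card conv.A_connected[unfolded cN])
        (use N_sym y in auto)
    moreover have "c = 1" using False unfolding c_def by (rule if_not_P)
    ultimately show ?thesis by simp
  qed
  have card_le: "card M \<le> sum y M" if "M \<subseteq> V" for M
    using sum_mono[of M "\<lambda>_. 1" y] y that by auto
  have size_A: "2 * a \<le> sum y A"
  proof (cases "A = {}")
    case False
    then have "2 \<le> card A" by (rule A_card)
    moreover have "card A \<le> sum y A" by (rule card_le) blast
    moreover have "a \<le> 1" unfolding a_def by simp
    ultimately show ?thesis by linarith
  qed (simp add: a_def)
  have size_C: "2 * c \<le> sum y C"
  proof (cases "C = {}")
    case False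
    then have "2 \<le> card C" by (rule conv.A_card)
    moreover have "card C \<le> sum y C" by (rule card_le) blast
    moreover have "c \<le> 1" unfolding c_def by simp
    ultimately show ?thesis by linarith
  qed (simp add: c_def)
  let ?P = "{(al, be), (be, al), (ep, ze), (ze, ep)}"
  have ze_ep: "ep \<in> N ze" using conv.al_be unfolding cN .
  have P_sub: "?P \<subseteq> adj_pairs N ?W"
    using al_be ze_ep N_sym nbrs_in by (auto simp: adj_pairs_def)
  have W_count: "card Q \<le> edge_weight N y ?W" if "Q \<subseteq> adj_pairs N ?W" for Q
  proof -
    have "(case p of (u, v) \<Rightarrow> y u * y v) = 1" if p: "p \<in> adj_pairs N ?W" for p
    proof (cases p)
      case (Pair u v)
      then have "u \<in> ?W" "v \<in> ?W" using p unfolding adj_pairs_def by blast+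
      then have "y u = 1" "y v = 1" by (intro y1; blast)+
      then show ?thesis using Pair by simp
    qed
    then have "edge_weight N y ?W = card (adj_pairs N ?W)" unfolding edge_weight_def by simp
    moreover have "finite (adj_pairs N ?W)" by (rule finite_adj_pairs) simp
    ultimately show ?thesis using card_mono[OF _ that] by metis
  qed
  have E_W4: "4 \<le> edge_weight N y ?W"
    using W_count[OF P_sub] distinct_nbrs by simp
  have E_W6: "6 \<le> edge_weight N y ?W"
    if "u \<in> ?W" "v \<in> ?W" "v \<in> N u" "(u, v) \<notin> ?P" "(v, u) \<notin> ?P" for u v
  proof -
    have "u \<noteq> v" using that by (auto simp: N_iff)
    moreover have "insert (u, v) (insert (v, u) ?P) \<subseteq> adj_pairs N ?W"
      using P_sub that N_sym nbrs_in by (auto simp: adj_pairs_def)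
    from W_count[OF this] have "card (insert (u, v) (insert (v, u) ?P)) \<le> edge_weight N y ?W" .
    moreover have "card (insert (u, v) (insert (v, u) ?P)) = 2 + card ?P"
      using that \<open>u \<noteq> v\<close> by (subst card_insert_disjoint; auto)+
    ultimately show ?thesis using distinct_nbrs by simp
  qed
  \<comment> \<open>A fifth and sixth oriented edge inside \<open>W\<close> is the price for having nothing between \<open>f1\<close> and \<open>f2\<close>.\<close>
  have size_B: "1 \<le> sum y B \<or> 6 \<le> edge_weight N y ?W"
  proof (cases "B = {}")
    case True
    then have "ep \<in> N al \<or> ze \<in> N al" using B_or_cross by blast
    then show ?thesis using E_W6[of al ep] E_W6[of al ze] distinct_nbrs by auto
  next
    case False
    then obtain h where h: "h \<in> B" by blast
    then have "y h \<le> sum y B" using fin by (intro member_le_sum) auto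
    then show ?thesis using y[of h] h by auto
  qed
  have size_B': "1 \<le> sum y B' \<or> 6 \<le> edge_weight N y ?W"
  proof (cases "B' = {}")
    case True
    then have "be \<in> N ze \<or> al \<in> N ze" using conv.B_or_cross unfolding cN by blast
    then show ?thesis using E_W6[of ze be] E_W6[of ze al] distinct_nbrs by auto
  next
    case False
    then obtain h where h: "h \<in> B'" by blast
    then have "y h \<le> sum y B'" using fin by (intro member_le_sum) auto
    then show ?thesis using y[of h] h by auto
  qed
  have ac: "a \<le> 1" "c \<le> 1" unfolding a_def c_def by auto
  note facts = sumV E_W cross E_R E_A E_C size_A size_C E_W4 size_B size_B' ac
  show "6 * sum y V \<le> edge_weight N y V + 30" using facts by linarith
  show "sum y V \<ge> 13" if eq: "edge_weight N y V + 30 = 6 * sum y V"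
  proof -
    have le: "edge_weight N y ?W \<le> 2 * a + 2 * c" using facts eq by linarith
    then have "a \<ge> 1" "c \<ge> 1" "\<not> 6 \<le> edge_weight N y ?W" using E_W4 ac by linarith+
    then show ?thesis using size_B size_B' size_A size_C sumV by linarith
  qed
  show "sum y V \<ge> 11" if eq: "edge_weight N y V + 30 = 6 * sum y V + 2"
  proof -
    have le: "edge_weight N y ?W \<le> 2 * a + 2 * c + 2" using facts eq by linarith
    show ?thesis
    proof (cases "6 \<le> edge_weight N y ?W")
      case True
      then show ?thesis using le size_A size_C sumV by linarith
    next
      case False
      then show ?thesis using le E_W4 size_B size_B' size_A size_C sumV by linarith
    qed
  qed
qed

end

section \<open>Decomposability as disconnectedness of the inversion graph\<close>

lemma connected_on_cong:
  assumes "\<And>u v. u \<in> P \<Longrightarrow> v \<in> P \<Longrightarrow> v \<in> N u \<longleftrightarrow> v \<in> M u"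
  shows "connected_on N P \<longleftrightarrow> connected_on M P"
proof -
  have "connected_on K P" if conn: "connected_on L P"
    and eq: "\<And>u v. u \<in> P \<Longrightarrow> v \<in> P \<Longrightarrow> v \<in> L u \<longleftrightarrow> v \<in> K u" for K L :: "'a \<Rightarrow> 'a set"
    unfolding connected_on_def
  proof (intro allI impI)
    fix S assume S: "S \<subset> P" "S \<noteq> {}"
    obtain u v where uv: "u \<in> S" "v \<in> P - S" "v \<in> L u" by (rule connected_onD[OF conn S])
    then have "v \<in> K u" using eq[of u v] S by blast
    then show "\<exists>u\<in>S. \<exists>v\<in>P - S. v \<in> K u" using uv by blast
  qed
  from this[of N M] this[of M N] show ?thesis using assms by blast
qed

lemma connected_on_image:
  assumes conn: "connected_on N P"
    and f: "\<And>u v. u \<in> P \<Longrightarrow> v \<in> P \<Longrightarrow> v \<in> N u \<Longrightarrow> f v \<in> M (f u)"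
  shows "connected_on M (f ` P)"
  unfolding connected_on_def
proof (intro allI impI)
  fix S assume S: "S \<subset> f ` P" "S \<noteq> {}"
  let ?S = "{p \<in> P. f p \<in> S}"
  have "?S \<subset> P" "?S \<noteq> {}" using S by blast+
  then obtain u v where uv: "u \<in> ?S" "v \<in> P - ?S" "v \<in> N u" by (rule connected_onD[OF conn])
  then have "f v \<in> M (f u)" using f[of u v] by blast
  then show "\<exists>u\<in>S. \<exists>v\<in>f ` P - S. v \<in> M u" using uv by (intro bexI[of _ "f u"] bexI[of _ "f v"]) auto
qed

definition is_perm :: "nat list \<Rightarrow> bool" where
  "is_perm \<pi> \<longleftrightarrow> distinct \<pi> \<and> set \<pi> = {1..length \<pi>}"

lemma is_perm_iff: "\<pi> \<in> permutations_of_set {1..n} \<longleftrightarrow> is_perm \<pi> \<and> length \<pi> = n"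
  unfolding is_perm_def permutations_of_set_def using distinct_card by fastforce

definition below :: "nat list \<Rightarrow> nat \<Rightarrow> nat \<Rightarrow> bool" where
  "below \<pi> p q \<longleftrightarrow> p < q \<and> \<pi> ! p < \<pi> ! q"

lemma nbrs_incomparable:
  assumes "distinct \<pi>" "i < length \<pi>"
  shows "nbrs \<pi> i = incomparable {..<length \<pi>} (below \<pi>) i"
proof (rule set_eqI)
  fix j
  have "\<pi> ! i \<noteq> \<pi> ! j" if "j < length \<pi>" "j \<noteq> i"
    using assms that nth_eq_iff_index_eq by metis
  then show "j \<in> nbrs \<pi> i \<longleftrightarrow> j \<in> incomparable {..<length \<pi>} (below \<pi>) i"
    using assms(2) unfolding nbrs_def Inv_def incomparable_def below_def
    by (cases "j < length \<pi>"; cases i j rule: linorder_cases) (auto simp: nat_neq_iff)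
qed

lemma nbrs_iff:
  assumes "distinct \<pi>" "i < length \<pi>"
  shows "j \<in> nbrs \<pi> i \<longleftrightarrow> j < length \<pi> \<and> j \<noteq> i \<and> \<not> below \<pi> i j \<and> \<not> below \<pi> j i"
  unfolding nbrs_incomparable[OF assms] by (simp add: incomparable_def)

lemma nbrs_sym: "j \<in> nbrs \<pi> i \<longleftrightarrow> i \<in> nbrs \<pi> j"
  by (auto simp: nbrs_def)

lemma nbrs_less: "j \<in> nbrs \<pi> i \<Longrightarrow> j < length \<pi> \<and> i < length \<pi> \<and> i \<noteq> j"
  by (auto simp: nbrs_def Inv_def)

lemma finite_Inv: "finite (Inv \<sigma>)"
  by (rule finite_subset[of _ "{..<length \<sigma>} \<times> {..<length \<sigma>}"]) (auto simp: Inv_def)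

lemma finite_nbrs: "finite (nbrs \<sigma> i)"
  by (rule finite_subset[of _ "{..<length \<sigma>}"]) (use nbrs_less in blast, simp)

lemma connected_nbrs_iff:
  assumes "distinct \<pi>" "P \<subseteq> {..<length \<pi>}"
  shows "connected_on (nbrs \<pi>) P \<longleftrightarrow> connected_on (incomparable {..<length \<pi>} (below \<pi>)) P"
  by (rule connected_on_cong) (use assms nbrs_incomparable in auto)

text \<open>
  For permutations this is a witness of decomposability (\<open>decomposable_iff_split\<close>), but it makes
  sense for all lists and is unaffected by standardization.
\<close>
definition splits_at :: "nat list \<Rightarrow> nat \<Rightarrow> bool" where
  "splits_at xs j \<longleftrightarrow> 1 \<le> j \<and> j < length xs \<and> (\<forall>p<j. \<forall>q. j \<le> q \<longrightarrow> q < length xs \<longrightarrow> xs ! p < xs ! q)"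

text \<open>
  If no edge leaves \<open>T\<close> and \<open>0 \<in> T\<close>, then the list splits at the first position \<open>j\<close> outside \<open>T\<close>:
  positions before \<open>j\<close> are in \<open>T\<close>, hence not inverted with any later position outside \<open>T\<close>, and later
  positions in \<open>T\<close> carry values above the value at \<open>j\<close>.
\<close>
lemma connected_iff_no_split:
  assumes dist: "distinct xs"
  shows "connected_on (nbrs xs) {..<length xs} \<longleftrightarrow> \<not> (\<exists>j. splits_at xs j)"
proof
  assume conn: "connected_on (nbrs xs) {..<length xs}"
  show "\<not> (\<exists>j. splits_at xs j)"
  proof
    assume "\<exists>j. splits_at xs j"
    then obtain j where j: "splits_at xs j" by blast
    then have "{..<j} \<subset> {..<length xs}" "{..<j} \<noteq> {}" unfolding splits_at_def
      by (auto simp: lessThan_empty_iff)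
    then obtain u v where "u \<in> {..<j}" "v \<in> {..<length xs} - {..<j}" "v \<in> nbrs xs u"
      by (rule connected_onD[OF conn])
    moreover from this have "xs ! u < xs ! v" using j by (auto simp: splits_at_def)
    ultimately show False by (auto simp: nbrs_def Inv_def)
  qed
next
  assume nosplit: "\<not> (\<exists>j. splits_at xs j)"
  let ?V = "{..<length xs}"
  show "connected_on (nbrs xs) ?V"
    unfolding connected_on_def
  proof (intro allI impI, rule ccontr)
    fix S assume S: "S \<subset> ?V" "S \<noteq> {}" and "\<not> (\<exists>u\<in>S. \<exists>v\<in>?V - S. v \<in> nbrs xs u)"
    then have none: "v \<notin> nbrs xs u" if "u \<in> S" "v \<in> ?V - S" for u v using that by blast
    define T where "T = (if 0 \<in> S then S else ?V - S)"
    have T0: "0 \<in> T" "T \<subset> ?V" using S unfolding T_def by auto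
    have Tnone: "v \<notin> nbrs xs u" if "u \<in> T" "v \<in> ?V - T" for u v
    proof (cases "0 \<in> S")
      case True
      then show ?thesis using none that unfolding T_def by simp
    next
      case False
      then have "u \<in> ?V - S" "v \<in> S" using that S(1) unfolding T_def by auto
      then show ?thesis using none[of v u] nbrs_sym by blast
    qed
    have less: "xs ! p < xs ! q" if "p < q" "p < length xs" "q < length xs" "q \<notin> nbrs xs p" for p q
    proof -
      have "xs ! p \<noteq> xs ! q" using nth_eq_iff_index_eq[OF dist, of p q] that by simp
      then show ?thesis using that by (auto simp: nbrs_def Inv_def)
    qed
    have ex: "\<exists>j. j \<in> ?V - T" using T0 by blast
    define j where "j = (LEAST j. j \<in> ?V - T)"
    have j: "j \<in> ?V - T" unfolding j_def using ex by (rule LeastI_ex)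
    have pT: "p \<in> T" if "p < j" for p
      using not_less_Least[of p "\<lambda>j. j \<in> ?V - T"] that j unfolding j_def by auto
    have "splits_at xs j"
      unfolding splits_at_def
    proof (intro conjI allI impI)
      have "j \<noteq> 0" using j T0 by (metis DiffD2)
      then show "1 \<le> j" by simp
      show "j < length xs" using j by simp
      fix p q assume p: "p < j" and q: "j \<le> q" "q < length xs"
      have pj: "xs ! p < xs ! j" using less[of p j] Tnone[of p j] pT[OF p] j p by simp
      show "xs ! p < xs ! q"
      proof (cases "q \<in> T")
        case True
        then have "q \<noteq> j" using j by blast
        moreover have "j \<notin> nbrs xs q" using Tnone[OF True j] .
        ultimately have "xs ! j < xs ! q" using less[of j q] q nbrs_sym[of q xs j] by simp
        then show ?thesis using pj by simp
      next
        case False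
        then show ?thesis using less[of p q] Tnone[of p q] pT[OF p] p q by simp
      qed
    qed
    then show False using nosplit by blast
  qed
qed

text \<open>
  If the first \<open>j\<close> values are below all others, then with \<open>x\<close> they contain all of \<open>{1..x}\<close>, so
  \<open>x \<le> j\<close>.
\<close>
lemma decomposable_iff_split:
  assumes perm: "is_perm \<pi>"
  shows "decomposable \<pi> \<longleftrightarrow> (\<exists>j. splits_at \<pi> j)"
proof
  assume "decomposable \<pi>"
  then obtain j where j: "1 \<le> j" "j < length \<pi>" "set (take j \<pi>) = {1..j}"
    by (auto simp: decomposable_def)
  have "\<pi> ! p < \<pi> ! q" if "p < j" "j \<le> q" "q < length \<pi>" for p q
  proof -
    have "\<pi> ! p \<in> set (take j \<pi>)" using that j nth_mem[of p "take j \<pi>"] by simp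
    moreover have "\<pi> ! q \<notin> set (take j \<pi>)"
      using that perm by (auto simp: in_set_conv_nth is_perm_def nth_eq_iff_index_eq)
    moreover have "\<pi> ! q \<in> {1..length \<pi>}" using that perm nth_mem[of q \<pi>] by (simp add: is_perm_def)
    ultimately show ?thesis using j by auto
  qed
  then show "\<exists>j. splits_at \<pi> j" using j unfolding splits_at_def by blast
next
  assume "\<exists>j. splits_at \<pi> j"
  then obtain j where j: "splits_at \<pi> j" by blast
  let ?S = "set (take j \<pi>)"
  have len: "1 \<le> j" "j < length \<pi>" using j by (auto simp: splits_at_def)
  have dist: "distinct \<pi>" and set: "set \<pi> = {1..length \<pi>}" using perm by (auto simp: is_perm_def)
  have card: "card ?S = j" using dist len by (simp add: distinct_card)
  have "?S \<subseteq> {1..j}"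
  proof
    fix x assume x: "x \<in> ?S"
    then obtain p where p: "p < j" "x = \<pi> ! p" using len by (auto simp: in_set_conv_nth)
    have x1: "x \<in> {1..length \<pi>}" using x set set_take_subset[of j \<pi>] by blast
    have "{1..x} \<subseteq> ?S"
    proof
      fix z assume z: "z \<in> {1..x}"
      then have "z \<in> set \<pi>" using set x1 by auto
      then obtain q where q: "q < length \<pi>" "\<pi> ! q = z" by (auto simp: in_set_conv_nth)
      have "q < j"
      proof (rule ccontr)
        assume "\<not> q < j"
        then have "\<pi> ! p < \<pi> ! q" using j p q by (auto simp: splits_at_def)
        then show False using z p q by simp
      qed
      then show "z \<in> ?S" using q by (auto simp: in_set_conv_nth intro!: exI[of _ q])
    qed
    then have "card {1..x} \<le> j" using card card_mono[of ?S "{1..x}"] by simp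
    then show "x \<in> {1..j}" using x1 by simp
  qed
  then have "?S = {1..j}" using card by (intro card_subset_eq) auto
  then show "decomposable \<pi>" using len by (auto simp: decomposable_def)
qed

lemma standardize_less:
  assumes "p < length xs" "q < length xs"
  shows "standardize xs ! p < standardize xs ! q \<longleftrightarrow> xs ! p < xs ! q"
proof -
  have mono: "card {y \<in> set xs. y \<le> a} < card {y \<in> set xs. y \<le> b}" if "a < b" "b \<in> set xs" for a b
  proof (rule psubset_card_mono)
    have "b \<in> {y \<in> set xs. y \<le> b}" "b \<notin> {y \<in> set xs. y \<le> a}" using that by auto
    moreover have "{y \<in> set xs. y \<le> a} \<subseteq> {y \<in> set xs. y \<le> b}" using that(1) by auto
    ultimately show "{y \<in> set xs. y \<le> a} \<subset> {y \<in> set xs. y \<le> b}" by blast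
  qed simp
  show ?thesis
    using mono[of "xs ! p" "xs ! q"] mono[of "xs ! q" "xs ! p"] assms
    by (cases "xs ! p" "xs ! q" rule: linorder_cases) (auto simp: standardize_def)
qed

lemma is_perm_standardize:
  assumes dist: "distinct xs"
  shows "is_perm (standardize xs)"
proof -
  let ?ys = "standardize xs"
  have len: "length ?ys = length xs" by (simp add: standardize_def)
  have "distinct ?ys"
    unfolding distinct_conv_nth
  proof (intro allI impI)
    fix p q assume pq: "p < length ?ys" "q < length ?ys" "p \<noteq> q"
    then have "xs ! p \<noteq> xs ! q" using dist len by (simp add: nth_eq_iff_index_eq)
    then show "?ys ! p \<noteq> ?ys ! q"
      using standardize_less[of p xs q] standardize_less[of q xs p] pq len by (metis nat_neq_iff)
  qed
  moreover have "set ?ys \<subseteq> {1..length xs}"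
  proof
    fix z assume "z \<in> set ?ys"
    then obtain x where x: "x \<in> set xs" "z = card {y \<in> set xs. y \<le> x}" by (auto simp: standardize_def)
    have "card {y \<in> set xs. y \<le> x} \<le> card (set xs)" by (rule card_mono) auto
    moreover have "card {y \<in> set xs. y \<le> x} > 0" using x by (auto simp: card_gt_0_iff)
    ultimately show "z \<in> {1..length xs}" using x dist by (simp add: distinct_card)
  qed
  ultimately have "set ?ys = {1..length xs}"
    using len distinct_card[of ?ys] by (intro card_subset_eq) auto
  then show ?thesis using \<open>distinct ?ys\<close> len by (simp add: is_perm_def)
qed

lemma decomposable_standardize_iff:
  assumes "distinct xs"
  shows "decomposable (standardize xs) \<longleftrightarrow> \<not> connected_on (nbrs xs) {..<length xs}"
proof -
  have len: "length (standardize xs) = length xs" by (simp add: standardize_def)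
  have "splits_at (standardize xs) j \<longleftrightarrow> splits_at xs j" for j
    unfolding splits_at_def len using standardize_less[of _ xs] by (meson less_le_trans less_trans)
  then show ?thesis
    using connected_iff_no_split[OF assms] decomposable_iff_split[OF is_perm_standardize[OF assms]]
    by simp
qed

lemma decomposable_iff_not_connected:
  assumes "is_perm \<pi>"
  shows "decomposable \<pi> \<longleftrightarrow> \<not> connected_on (nbrs \<pi>) {..<length \<pi>}"
  using decomposable_iff_split[OF assms] connected_iff_no_split[of \<pi>] assms by (simp add: is_perm_def)

text \<open>
  The index maps \<open>f\<close> and \<open>g\<close> of the proof skip position \<open>i\<close> and close the gap, respectively.
\<close>
lemma decomposable_delete_position_iff:
  assumes perm: "is_perm \<pi>" and i: "i < length \<pi>"
  shows "decomposable (delete_position i \<pi>) \<longleftrightarrow> \<not> connected_on (nbrs \<pi>) ({..<length \<pi>} - {i})"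
proof -
  define xs where "xs = take i \<pi> @ drop (Suc i) \<pi>"
  have dist: "distinct \<pi>" using perm by (simp add: is_perm_def)
  have len: "length xs = length \<pi> - 1" using i by (simp add: xs_def)
  define f where "f k = (if k < i then k else Suc k)" for k
  define g where "g k = (if k < i then k else k - 1)" for k
  have nth: "xs ! k = \<pi> ! f k" if "k < length xs" for k
    using that i len by (auto simp: xs_def f_def nth_append min_def)
  have f_mono: "f k < f l \<longleftrightarrow> k < l" for k l by (auto simp: f_def)
  have f_in: "f k < length \<pi> \<and> f k \<noteq> i" if "k < length xs" for k using that len i by (auto simp: f_def)
  have gf: "g (f k) = k" for k by (auto simp: g_def f_def)
  have fg: "f (g k) = k \<and> g k < length xs" if "k < length \<pi>" "k \<noteq> i" for k
    using that len i by (auto simp: g_def f_def)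
  have dist_xs: "distinct xs"
    using dist i by (auto simp: xs_def dest: in_set_takeD in_set_dropD)
      (metis Suc_n_not_le_n disjoint_iff set_take_disj_set_drop_if_distinct nat_le_linear)
  have f_nbrs: "l \<in> nbrs xs k \<longleftrightarrow> f l \<in> nbrs \<pi> (f k)" if "k < length xs" "l < length xs" for k l
    using that nth f_mono f_in by (auto simp: nbrs_def Inv_def)
  have img: "f ` {..<length xs} = {..<length \<pi>} - {i}"
  proof
    show "f ` {..<length xs} \<subseteq> {..<length \<pi>} - {i}" using f_in by auto
    show "{..<length \<pi>} - {i} \<subseteq> f ` {..<length xs}"
      using fg by (metis DiffE image_eqI insertCI lessThan_iff subsetI)
  qed
  have img': "g ` ({..<length \<pi>} - {i}) = {..<length xs}"
    unfolding img[symmetric] image_image gf by simp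
  have "connected_on (nbrs xs) {..<length xs} \<longleftrightarrow> connected_on (nbrs \<pi>) ({..<length \<pi>} - {i})"
  proof
    assume "connected_on (nbrs xs) {..<length xs}"
    then show "connected_on (nbrs \<pi>) ({..<length \<pi>} - {i})"
      unfolding img[symmetric] by (rule connected_on_image) (use f_nbrs in auto)
  next
    assume "connected_on (nbrs \<pi>) ({..<length \<pi>} - {i})"
    then show "connected_on (nbrs xs) {..<length xs}"
      unfolding img'[symmetric]
      by (rule connected_on_image) (use f_nbrs fg in auto)
  qed
  then show ?thesis
    using decomposable_standardize_iff[OF dist_xs] by (simp add: delete_position_def xs_def)
qed

lemma delete_entry_eq_delete_position:
  assumes "distinct \<pi>" "i < length \<pi>"
  shows "delete_entry (\<pi> ! i) \<pi> = delete_position i \<pi>"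
proof -
  have "\<pi> = take i \<pi> @ \<pi> ! i # drop (Suc i) \<pi>" using assms by (simp add: id_take_nth_drop)
  moreover have "\<pi> ! i \<notin> set (take i \<pi>)" "\<pi> ! i \<notin> set (drop (Suc i) \<pi>)"
    using assms calculation by (metis distinct_append distinct.simps(2) not_distinct_conv_prefix
        disjoint_iff list.set_intros(1))+
  ultimately have "removeAll (\<pi> ! i) \<pi> = take i \<pi> @ drop (Suc i) \<pi>"
    by (metis append_Nil2 removeAll.simps(2) removeAll_append removeAll_id)
  then show ?thesis by (simp add: delete_entry_def delete_position_def)
qed

lemma almost_decomposable_iff:
  assumes perm: "is_perm \<pi>" and n: "length \<pi> \<ge> 1"
  shows "almost_decomposable \<pi> \<longleftrightarrow> \<not> decomposable \<pi> \<and>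
    (\<exists>i\<in>extremal_positions \<pi>. decomposable (delete_position i \<pi>))"
proof -
  have dist: "distinct \<pi>" and set: "set \<pi> = {1..length \<pi>}" using perm by (auto simp: is_perm_def)
  obtain a where a: "a < length \<pi>" "\<pi> ! a = 1" using set n by (metis atLeastAtMost_iff in_set_conv_nth order_refl)
  obtain b where b: "b < length \<pi>" "\<pi> ! b = length \<pi>" using set n by (metis atLeastAtMost_iff in_set_conv_nth order_refl)
  have hd: "hd \<pi> = \<pi> ! 0" and last: "last \<pi> = \<pi> ! (length \<pi> - 1)"
    using n hd_conv_nth[of \<pi>] last_conv_nth[of \<pi>] by fastforce+
  have ext: "extremal_positions \<pi> = {a, b, 0, length \<pi> - 1}"
    using a b n dist by (auto simp: extremal_positions_def nth_eq_iff_index_eq)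
      (metis nth_eq_iff_index_eq)+
  note del = delete_entry_eq_delete_position[OF dist]
  have n0: "0 < length \<pi>" "length \<pi> - 1 < length \<pi>" using n by linarith+
  have "delete_entry 1 \<pi> = delete_position a \<pi>" "delete_entry (length \<pi>) \<pi> = delete_position b \<pi>"
    "delete_entry (\<pi> ! 0) \<pi> = delete_position 0 \<pi>"
    "delete_entry (\<pi> ! (length \<pi> - 1)) \<pi> = delete_position (length \<pi> - 1) \<pi>"
    using del[OF a(1)] del[OF b(1)] del[OF n0(1)] del[OF n0(2)] a(2) b(2) by simp_all
  then show ?thesis unfolding almost_decomposable_def ext hd last by auto
qed

lemma \<R>_iff:
  assumes "n \<ge> 1"
  shows "\<pi> \<in> \<R> \<delta> n \<longleftrightarrow> is_perm \<pi> \<and> length \<pi> = n \<and> avoids_1324 \<pi> \<and>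
     int (inv_count \<pi>) = 2 * int n - 7 + int \<delta> \<and> connected_on (nbrs \<pi>) {..<length \<pi>} \<and>
     (\<forall>i\<in>extremal_positions \<pi>. connected_on (nbrs \<pi>) ({..<length \<pi>} - {i}))"
proof (cases "is_perm \<pi> \<and> length \<pi> = n")
  case True
  then have "\<pi> \<in> permutations_of_set {1..n}" by (simp only: is_perm_iff)
  have ext: "i < length \<pi>" if "i \<in> extremal_positions \<pi>" for i using that by (simp add: extremal_positions_def)
  show ?thesis
    unfolding \<R>_def
    using True \<open>\<pi> \<in> _\<close> assms almost_decomposable_iff[of \<pi>] decomposable_iff_not_connected[of \<pi>]
      decomposable_delete_position_iff[of \<pi>] ext by auto
next
  case False
  then have "\<pi> \<notin> permutations_of_set {1..n}" by (simp only: is_perm_iff not_False_eq_True)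
  then show ?thesis unfolding \<R>_def using False by blast
qed

section \<open>Reduced permutations avoiding 1324\<close>

lemma below_trans: "below \<pi> p q \<Longrightarrow> below \<pi> q r \<Longrightarrow> below \<pi> p r"
  by (auto simp: below_def)

lemma below_irrefl: "\<not> below \<pi> p p"
  by (auto simp: below_def)

text \<open>
  The pattern \<open>1324\<close> is an incomparable pair inside an interval.
\<close>
lemma avoids_interval_chain:
  assumes dist: "distinct \<pi>" and av: "avoids_1324 \<pi>"
    and V: "u < length \<pi>" "v < length \<pi>" "b < length \<pi>"
    and rel: "below \<pi> a u" "below \<pi> a v" "below \<pi> u b" "below \<pi> v b"
  shows "u = v \<or> below \<pi> u v \<or> below \<pi> v u"
proof (rule ccontr)
  assume *: "\<not> ?thesis"
  have no: False if "u < v" "below \<pi> a u" "below \<pi> a v" "below \<pi> u b" "below \<pi> v b"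
    "\<not> below \<pi> u v" "v < length \<pi>" for u v
  proof -
    have "\<pi> ! u \<noteq> \<pi> ! v" using that dist by (simp add: nth_eq_iff_index_eq)
    then have "\<pi> ! v < \<pi> ! u" using that by (auto simp: below_def)
    then have "a < u \<and> u < v \<and> v < b \<and> b < length \<pi> \<and> \<pi> ! a < \<pi> ! v \<and> \<pi> ! v < \<pi> ! u \<and> \<pi> ! u < \<pi> ! b"
      using that V(3) by (auto simp: below_def)
    then show False using av unfolding avoids_1324_def by blast
  qed
  from * have "u < v \<or> v < u" by auto
  then show False using no[of u v] no[of v u] * V rel by blast
qed

text \<open>
  Suppose \<open>i\<close> and \<open>k\<close> have the same neighbours and \<open>i\<close> is below \<open>k\<close>. Then a position between
  them carries a value between theirs and conversely, as it would otherwise be adjacent to exactly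
  one of them. The elements between form a chain by \<open>1324\<close>-avoidance, so \<open>i\<close> and \<open>k\<close>
  delimit an increasing run of consecutive values, and its first step contradicts reducedness.
\<close>
lemma reduced_nbrs_distinct:
  assumes perm: "is_perm \<sigma>" and av: "avoids_1324 \<sigma>" and red: "reduced \<sigma>"
    and pq: "p < length \<sigma>" "q < length \<sigma>" "p \<noteq> q"
  shows "nbrs \<sigma> p \<noteq> nbrs \<sigma> q"
proof
  assume eq: "nbrs \<sigma> p = nbrs \<sigma> q"
  have dist: "distinct \<sigma>" and set: "set \<sigma> = {1..length \<sigma>}" using perm by (auto simp: is_perm_def)
  note iff = nbrs_iff[OF dist]
  have "q \<notin> nbrs \<sigma> p" using eq nbrs_less[of q \<sigma> q] by auto
  then have "below \<sigma> p q \<or> below \<sigma> q p" using iff[of p q] pq by auto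
  then obtain i k where ik: "below \<sigma> i k" "i < length \<sigma>" "k < length \<sigma>" "nbrs \<sigma> i = nbrs \<sigma> k"
    using pq eq by metis
  have ik': "i < k" "\<sigma> ! i < \<sigma> ! k" using ik(1) by (auto simp: below_def)
  have row: "\<sigma> ! i < \<sigma> ! u \<and> \<sigma> ! u < \<sigma> ! k" if u: "i < u" "u < k" for u
  proof -
    have ne: "\<sigma> ! u \<noteq> \<sigma> ! i" "\<sigma> ! u \<noteq> \<sigma> ! k"
      using u ik dist by (simp_all add: nth_eq_iff_index_eq)
    have "u \<in> nbrs \<sigma> i \<longleftrightarrow> \<sigma> ! u < \<sigma> ! i" using iff[of i u] u ik ne by (auto simp: below_def)
    moreover have "u \<in> nbrs \<sigma> k \<longleftrightarrow> \<sigma> ! u > \<sigma> ! k" using iff[of k u] u ik ne by (auto simp: below_def)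
    ultimately show ?thesis using ik(4) ik'(2) ne by (metis linorder_neqE_nat less_trans less_asym)
  qed
  have col: "i < u \<and> u < k" if u: "\<sigma> ! i < \<sigma> ! u" "\<sigma> ! u < \<sigma> ! k" "u < length \<sigma>" for u
  proof -
    have ne: "u \<noteq> i" "u \<noteq> k" using u by auto
    have "u \<in> nbrs \<sigma> i \<longleftrightarrow> u < i" using iff[of i u] u ik ne by (auto simp: below_def)
    moreover have "u \<in> nbrs \<sigma> k \<longleftrightarrow> u > k" using iff[of k u] u ik ne by (auto simp: below_def)
    ultimately show ?thesis using ik(4) ik'(1) ne by (metis linorder_neqE_nat less_trans less_asym)
  qed
  have "\<sigma> ! Suc i = \<sigma> ! i + 1"
  proof (rule ccontr)
    assume ne: "\<sigma> ! Suc i \<noteq> \<sigma> ! i + 1"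
    have above: "\<sigma> ! i < \<sigma> ! Suc i"
      using row[of "Suc i"] ik' by (cases "Suc i = k") auto
    have le: "\<sigma> ! Suc i \<le> \<sigma> ! k" using row[of "Suc i"] ik' by (cases "Suc i = k") auto
    have "\<sigma> ! i + 1 \<in> set \<sigma>"
      using set above le nth_mem[OF ik(3)] by auto
    then obtain u where u: "u < length \<sigma>" "\<sigma> ! u = \<sigma> ! i + 1" by (auto simp: in_set_conv_nth)
    have "i < u \<and> u < k" using col[of u] u above le ne by auto
    moreover have "u \<noteq> Suc i" using u ne by auto
    ultimately have ui: "Suc i < u" "u < k" by auto
    have "\<sigma> ! Suc i < \<sigma> ! k" using row[of "Suc i"] ui by simp
    moreover have "\<sigma> ! u < \<sigma> ! Suc i" using u above ne by simp
    ultimately have "i < Suc i \<and> Suc i < u \<and> u < k \<and> k < length \<sigma> \<and>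
        \<sigma> ! i < \<sigma> ! u \<and> \<sigma> ! u < \<sigma> ! Suc i \<and> \<sigma> ! Suc i < \<sigma> ! k"
      using u ui ik(3) by auto
    then show False using av unfolding avoids_1324_def by blast
  qed
  then show False using red ik ik' unfolding reduced_def by (metis Suc_leI le_less_trans)
qed

lemma reduced_thin_order:
  assumes perm: "is_perm \<sigma>" and av: "avoids_1324 \<sigma>" and red: "reduced \<sigma>"
    and conn: "connected_on (nbrs \<sigma>) {..<length \<sigma>}"
  shows "thin_order {..<length \<sigma>} (below \<sigma>)"
proof
  have dist: "distinct \<sigma>" using perm by (simp add: is_perm_def)
  show "inj_on (incomparable {..<length \<sigma>} (below \<sigma>)) {..<length \<sigma>}"
    using reduced_nbrs_distinct[OF perm av red] nbrs_incomparable[OF dist] by (auto intro!: inj_onI)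
  show "connected_on (incomparable {..<length \<sigma>} (below \<sigma>)) {..<length \<sigma>}"
    using conn connected_nbrs_iff[OF dist] by blast
  show "u = v \<or> below \<sigma> u v \<or> below \<sigma> v u"
    if "a \<in> {..<length \<sigma>}" "u \<in> {..<length \<sigma>}" "v \<in> {..<length \<sigma>}" "b \<in> {..<length \<sigma>}"
      "below \<sigma> a u" "below \<sigma> a v" "below \<sigma> u b" "below \<sigma> v b" for a u v b
    using avoids_interval_chain[OF dist av] that by auto
qed (auto simp: below_irrefl intro: below_trans)

text \<open>
  Since \<open>f\<close> is weakly below \<open>g\<close>, both lie on the same side of \<open>b\<close>, upper left or lower right. An
  entry that beats \<open>b\<close> at the corresponding end of the permutation would be adjacent to \<open>b\<close> and,
  because of its position or value, neither weakly below \<open>g\<close> nor weakly above \<open>f\<close>.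
\<close>
lemma extremal_position:
  assumes perm: "is_perm \<sigma>"
    and b: "b < length \<sigma>" and fg: "f \<in> nbrs \<sigma> b" "g \<in> nbrs \<sigma> b" "f = g \<or> below \<sigma> f g"
    and near: "\<And>u. u \<in> nbrs \<sigma> b \<Longrightarrow> (u = g \<or> below \<sigma> u g) \<or> (u = f \<or> below \<sigma> f u)"
    and end_point: "(\<forall>u<length \<sigma>. \<not> below \<sigma> u b) \<or> (\<forall>u<length \<sigma>. \<not> below \<sigma> b u)"
  shows "b \<in> extremal_positions \<sigma>"
proof -
  have dist: "distinct \<sigma>" and set: "set \<sigma> = {1..length \<sigma>}" using perm by (auto simp: is_perm_def)
  have fg_lt: "f < length \<sigma>" "g < length \<sigma>" using fg nbrs_less by blast+
  have fg_le: "f \<le> g" "\<sigma> ! f \<le> \<sigma> ! g" using fg(3) by (auto simp: below_def)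
  have nbr: "u \<in> nbrs \<sigma> b \<longleftrightarrow> (u < b \<and> \<sigma> ! u > \<sigma> ! b) \<or> (u > b \<and> \<sigma> ! u < \<sigma> ! b)"
    if "u < length \<sigma>" for u using that b by (auto simp: nbrs_def Inv_def)
  have ne: "\<sigma> ! u \<noteq> \<sigma> ! b" if "u < length \<sigma>" "u \<noteq> b" for u
    using that b dist by (simp add: nth_eq_iff_index_eq)
  have near': "u \<le> g \<and> \<sigma> ! u \<le> \<sigma> ! g \<or> f \<le> u \<and> \<sigma> ! f \<le> \<sigma> ! u"
    if "u \<in> nbrs \<sigma> b" for u using near[OF that] by (auto simp: below_def)
  have length_pos: "1 \<in> set \<sigma>" "length \<sigma> \<in> set \<sigma>" using set b by auto
  then obtain lo hi where lo: "lo < length \<sigma>" "\<sigma> ! lo = 1" and hi: "hi < length \<sigma>" "\<sigma> ! hi = length \<sigma>"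
    by (metis in_set_conv_nth)
  have range: "1 \<le> \<sigma> ! u \<and> \<sigma> ! u \<le> length \<sigma>" if "u < length \<sigma>" for u
    using set that nth_mem by fastforce
  have nb_f: "(f < b \<and> \<sigma> ! f > \<sigma> ! b) \<or> (f > b \<and> \<sigma> ! f < \<sigma> ! b)"
    and nb_g: "(g < b \<and> \<sigma> ! g > \<sigma> ! b) \<or> (g > b \<and> \<sigma> ! g < \<sigma> ! b)"
    using fg nbr fg_lt by blast+
  consider (SE) "f < b" "g < b" "\<sigma> ! f > \<sigma> ! b" "\<sigma> ! g > \<sigma> ! b"
    | (NW) "b < f" "b < g" "\<sigma> ! f < \<sigma> ! b" "\<sigma> ! g < \<sigma> ! b"
    using nb_f nb_g fg_le by linarith
  then show ?thesis
  proof cases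
    case SE
    from end_point show ?thesis
    proof
      assume min: "\<forall>u<length \<sigma>. \<not> below \<sigma> u b"
      have "lo = b"
      proof (rule ccontr)
        assume "lo \<noteq> b"
        then have "\<sigma> ! lo < \<sigma> ! b" using ne[OF lo(1)] range[OF b] lo(2) by simp
        then have "lo \<in> nbrs \<sigma> b" "lo > b" using min lo(1) nbr[OF lo(1)] \<open>lo \<noteq> b\<close> by (auto simp: below_def)
        then show False using near'[of lo] SE \<open>\<sigma> ! lo < \<sigma> ! b\<close> by linarith
      qed
      then show ?thesis using lo b by (simp add: extremal_positions_def)
    next
      assume max: "\<forall>u<length \<sigma>. \<not> below \<sigma> b u"
      let ?u = "length \<sigma> - 1"
      have "?u = b"
      proof (rule ccontr)
        assume "?u \<noteq> b"
        then have u: "?u > b" "?u < length \<sigma>" using b by linarith+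
        then have "\<sigma> ! ?u < \<sigma> ! b" using ne[OF u(2)] max by (auto simp: below_def)
        then have "?u \<in> nbrs \<sigma> b" using nbr[OF u(2)] u(1) by blast
        then show False using near'[of ?u] SE u \<open>\<sigma> ! ?u < \<sigma> ! b\<close> by linarith
      qed
      then show ?thesis using b by (auto simp: extremal_positions_def)
    qed
  next
    case NW
    from end_point show ?thesis
    proof
      assume min: "\<forall>u<length \<sigma>. \<not> below \<sigma> u b"
      have "b = 0"
      proof (rule ccontr)
        assume "b \<noteq> 0"
        then have u: "0 < b" "0 < length \<sigma>" using b by linarith+
        then have "\<sigma> ! 0 > \<sigma> ! b" using ne[OF u(2)] min by (auto simp: below_def)
        then have "0 \<in> nbrs \<sigma> b" using nbr[OF u(2)] u(1) by blast
        then show False using near'[of 0] NW u \<open>\<sigma> ! 0 > \<sigma> ! b\<close> by linarith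
      qed
      then show ?thesis using b by (simp add: extremal_positions_def)
    next
      assume max: "\<forall>u<length \<sigma>. \<not> below \<sigma> b u"
      have "hi = b"
      proof (rule ccontr)
        assume "hi \<noteq> b"
        then have "\<sigma> ! hi > \<sigma> ! b" using ne[OF hi(1)] range[OF b] hi(2) by simp
        then have "hi \<in> nbrs \<sigma> b" "hi < b" using max hi(1) nbr[OF hi(1)] \<open>hi \<noteq> b\<close> by (auto simp: below_def)
        then show False using near'[of hi] NW \<open>\<sigma> ! hi > \<sigma> ! b\<close> by linarith
      qed
      then show ?thesis using hi b by (simp add: extremal_positions_def)
    qed
  qed
qed

text \<open>
  If \<open>j\<close> is the only neighbour of \<open>i\<close>, everything except \<open>j\<close> is comparable to \<open>i\<close>. By
  \<open>1324\<close>-avoidance \<open>j\<close> has nothing below it or nothing above it, so it is extremal, and its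
  deletion isolates \<open>i\<close>, contrary to the assumption that the permutation is not almost decomposable.
\<close>
lemma residual_degree_ge_2:
  assumes R: "\<pi> \<in> \<R> \<delta> n" and n: "n \<ge> 3" and i: "i < n"
  shows "card (nbrs \<pi> i) \<ge> 2"
proof (rule ccontr)
  assume "\<not> ?thesis"
  then have le1: "card (nbrs \<pi> i) \<le> 1" by simp
  from R n have perm: "is_perm \<pi>" and len: "length \<pi> = n" and av: "avoids_1324 \<pi>"
    and conn: "connected_on (nbrs \<pi>) {..<length \<pi>}"
    and ext: "\<And>i. i \<in> extremal_positions \<pi> \<Longrightarrow> connected_on (nbrs \<pi>) ({..<length \<pi>} - {i})"
    using \<R>_iff[of n \<pi> \<delta>] by auto
  have dist: "distinct \<pi>" using perm by (simp add: is_perm_def)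
  have fin: "finite (nbrs \<pi> i)" by (rule finite_nbrs)
  have "{i} \<noteq> {..<length \<pi>}"
  proof
    assume "{i} = {..<length \<pi>}"
    then have "card {i} = card {..<length \<pi>}" by simp
    then show False using n len by simp
  qed
  then have "{i} \<subset> {..<length \<pi>}" using i len by auto
  then obtain i' j where "i' \<in> {i}" "j \<in> {..<length \<pi>} - {i}" and ij: "j \<in> nbrs \<pi> i'"
    by (rule connected_onD[OF conn]) auto
  then have j: "j \<in> nbrs \<pi> i" "j < length \<pi>" by auto
  then have single: "nbrs \<pi> i = {j}" using le1 fin by (metis card_le_Suc0_iff_eq One_nat_def singletonI
        insertI1 subsetI subset_singletonD empty_iff subset_antisym)
  have i_j: "i \<in> nbrs \<pi> j" using j nbrs_sym by blast
  have cmp: "u = i \<or> below \<pi> u i \<or> below \<pi> i u" if "u < length \<pi>" "u \<noteq> j" for u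
    using that single nbrs_iff[OF dist, of i u] i len by auto
  have ij_incomp: "i \<noteq> j" "\<not> below \<pi> i j" "\<not> below \<pi> j i" using nbrs_iff[OF dist, of i j] j i len by auto
  have "(\<forall>u<length \<pi>. \<not> below \<pi> u j) \<or> (\<forall>u<length \<pi>. \<not> below \<pi> j u)"
  proof (rule ccontr)
    assume "\<not> ?thesis"
    then obtain a c where ac: "a < length \<pi>" "below \<pi> a j" "c < length \<pi>" "below \<pi> j c" by blast
    have "a \<noteq> j" "c \<noteq> j" using ac below_irrefl by auto
    have "below \<pi> a i"
      using cmp[OF ac(1) \<open>a \<noteq> j\<close>] ac ij_incomp below_trans[of \<pi> i a j] by auto
    moreover have "below \<pi> i c"
      using cmp[OF ac(3) \<open>c \<noteq> j\<close>] ac ij_incomp below_trans[of \<pi> j c i] by auto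
    ultimately show False
      using avoids_interval_chain[OF dist av, of i j c a] ac ij_incomp i len j by auto
  qed
  then have "j \<in> extremal_positions \<pi>"
    using i_j j(2) cmp nbrs_less[of _ \<pi> j]
    by (intro extremal_position[OF perm, of j i i]) auto
  then have conn': "connected_on (nbrs \<pi>) ({..<length \<pi>} - {j})" by (rule ext)
  have "{i} \<noteq> {..<length \<pi>} - {j}"
  proof
    assume "{i} = {..<length \<pi>} - {j}"
    then have "card {i} = card ({..<length \<pi>} - {j})" by simp
    then show False using n len j(2) by simp
  qed
  then have "{i} \<subset> {..<length \<pi>} - {j}" using i len ij_incomp by auto
  then obtain i' k where "i' \<in> {i}" "k \<in> {..<length \<pi>} - {j} - {i}" "k \<in> nbrs \<pi> i'"
    by (rule connected_onD[OF conn']) auto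
  then show False using single by auto
qed

section \<open>Inflations\<close>

text \<open>
  Replacing each vertex of a connected graph with at least two vertices by a nonempty independent set
  keeps it connected: a set closed under adjacency contains with \<open>u\<close> a vertex \<open>w\<close> over a neighbour,
  and with \<open>w\<close> everything in the same class as \<open>u\<close>.
\<close>
lemma connected_on_blow_up:
  assumes conn: "connected_on M (f ` P)" and two: "\<exists>x\<in>f ` P. \<exists>y\<in>f ` P. x \<noteq> y"
    and f: "\<And>u v. u \<in> P \<Longrightarrow> v \<in> P \<Longrightarrow> v \<in> N u \<longleftrightarrow> f v \<in> M (f u)"
    and sym: "\<And>x y. y \<in> M x \<Longrightarrow> x \<in> M y"
  shows "connected_on N P"
  unfolding connected_on_def
proof (intro allI impI, rule ccontr)
  fix S assume S: "S \<subset> P" "S \<noteq> {}" and "\<not> (\<exists>u\<in>S. \<exists>v\<in>P - S. v \<in> N u)"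
  then have none: "v \<in> S" if "u \<in> S" "v \<in> P" "f v \<in> M (f u)" for u v
    using that f[of u v] by blast
  have sat: "v \<in> S" if u: "u \<in> S" and v: "v \<in> P" and eq: "f v = f u" for u v
  proof -
    have fu: "f u \<in> f ` P" using u S by blast
    have "f ` P \<noteq> {f u}" using two by (metis singletonD)
    then have "{f u} \<subset> f ` P" using fu by (metis empty_subsetI insert_subset psubsetI)
    then obtain x y where "x \<in> {f u}" "y \<in> f ` P - {f u}" and xy: "y \<in> M x"
      by (rule connected_onD[OF conn]) simp
    then obtain w where w: "w \<in> P" "f w \<in> M (f u)" by blast
    then have "w \<in> S" using none[of u w] u by blast
    moreover have "f v \<in> M (f w)" using sym w(2) eq by simp
    ultimately show "v \<in> S" using none[of w v] v by blast
  qed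
  have "f ` S \<subset> f ` P"
  proof -
    obtain v where "v \<in> P" "v \<notin> S" using S by blast
    then have "f v \<notin> f ` S" using sat by (metis imageE)
    then show ?thesis using S \<open>v \<in> P\<close> by blast
  qed
  moreover have "f ` S \<noteq> {}" using S by simp
  ultimately obtain x y where "x \<in> f ` S" "y \<in> f ` P - f ` S" "y \<in> M x"
    by (rule connected_onD[OF conn])
  then show False using none by blast
qed

text \<open>
  The \<open>k\<close>-th entry of the run that replaces entry \<open>i\<close> is labelled \<open>(i, k)\<close>. In the inflation the
  labels increase lexicographically, which determines the relative order of any two entries.
\<close>
definition run_entries :: "nat list \<Rightarrow> (nat \<Rightarrow> nat) \<Rightarrow> (nat \<times> nat) list" where
  "run_entries \<sigma> b = concat (map (\<lambda>i. map (Pair i) [1..<Suc (b i)]) [0..<length \<sigma>])"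

definition offset :: "nat list \<Rightarrow> (nat \<Rightarrow> nat) \<Rightarrow> nat \<Rightarrow> nat" where
  "offset \<sigma> b i = (\<Sum>j | j < length \<sigma> \<and> \<sigma> ! j < \<sigma> ! i. b j)"

definition block :: "nat list \<Rightarrow> (nat \<Rightarrow> nat) \<Rightarrow> nat \<Rightarrow> nat" where
  "block \<sigma> b p = fst (run_entries \<sigma> b ! p)"

lemma inflate_run_entries: "inflate \<sigma> b = map (\<lambda>(i, k). offset \<sigma> b i + k) (run_entries \<sigma> b)"
  by (simp add: inflate_def run_entries_def offset_def map_concat comp_def)

lemma set_run_entries: "set (run_entries \<sigma> b) = {(i, k). i < length \<sigma> \<and> 1 \<le> k \<and> k \<le> b i}"
proof -
  have "set (run_entries \<sigma> b) = (\<Union>i\<in>{..<length \<sigma>}. Pair i ` {1..b i})"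
    by (simp add: run_entries_def atLeastLessThanSuc_atLeastAtMost atLeast0LessThan del: upt_Suc)
  then show ?thesis by auto
qed

lemma length_run_entries: "length (run_entries \<sigma> b) = sum b {..<length \<sigma>}"
proof -
  have "length (run_entries \<sigma> b) = sum_list (map b [0..<length \<sigma>])"
    by (simp add: run_entries_def length_concat comp_def del: upt_Suc)
  also have "\<dots> = sum b (set [0..<length \<sigma>])" by (rule sum_list_distinct_conv_sum_set) simp
  finally show ?thesis by (simp add: atLeast0LessThan)
qed

text \<open>
  The induction is on the number of runs; inserting one more run appends labels with a larger first
  component.
\<close>
lemma sorted_run_entries:
  "sorted_wrt (\<lambda>(i, k) (j, l). i < j \<or> i = j \<and> k < l) (run_entries \<sigma> b)"
proof -
  have "sorted_wrt (\<lambda>(i, k) (j, l). i < j \<or> i = j \<and> k < l)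
      (concat (map (\<lambda>i. map (Pair i) [1..<Suc (b i)]) [0..<n]))" for n
  proof (induction n)
    case (Suc n)
    have "sorted_wrt (\<lambda>(i, k) (j, l). i < j \<or> i = j \<and> k < l) (map (Pair n) [1..<Suc (b n)])"
      using sorted_wrt_upt[of 1 "Suc (b n)"] by (simp add: sorted_wrt_map del: upt_Suc)
    moreover have "[0..<Suc n] = [0..<n] @ [n]" by simp
    ultimately show ?case using Suc by (auto simp: sorted_wrt_append simp del: upt_Suc)
  qed simp
  then show ?thesis by (simp add: run_entries_def)
qed

locale inflation =
  fixes \<sigma> :: "nat list" and b :: "nat \<Rightarrow> nat"
  assumes perm: "is_perm \<sigma>" and b_pos: "\<And>i. i < length \<sigma> \<Longrightarrow> b i \<ge> 1"
begin

abbreviation \<pi> :: "nat list" where "\<pi> \<equiv> inflate \<sigma> b"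
abbreviation blk :: "nat \<Rightarrow> nat" where "blk \<equiv> block \<sigma> b"

lemma dist: "distinct \<sigma>" and set_\<sigma>: "set \<sigma> = {1..length \<sigma>}"
  using perm by (auto simp: is_perm_def)

lemma length_\<pi>: "length \<pi> = sum b {..<length \<sigma>}"
  by (simp add: inflate_run_entries length_run_entries)

lemma entry:
  assumes "p < length \<pi>"
  obtains k where "run_entries \<sigma> b ! p = (blk p, k)" "blk p < length \<sigma>" "1 \<le> k" "k \<le> b (blk p)"
    "\<pi> ! p = offset \<sigma> b (blk p) + k"
proof -
  have p: "p < length (run_entries \<sigma> b)" using assms by (simp add: inflate_run_entries)
  obtain i k where ik: "run_entries \<sigma> b ! p = (i, k)" by fastforce
  then have "(i, k) \<in> set (run_entries \<sigma> b)" using p nth_mem by metis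
  then have "i < length \<sigma>" "1 \<le> k" "k \<le> b i" by (auto simp: set_run_entries)
  moreover have "blk p = i" by (simp add: block_def ik)
  ultimately show ?thesis using that ik p by (simp add: inflate_run_entries)
qed

lemma blk_less: "p < length \<pi> \<Longrightarrow> blk p < length \<sigma>"
  using entry by metis

lemma \<sigma>_eq_iff: "i < length \<sigma> \<Longrightarrow> j < length \<sigma> \<Longrightarrow> \<sigma> ! i = \<sigma> ! j \<longleftrightarrow> i = j"
  using dist by (simp add: nth_eq_iff_index_eq)

lemma offset_less:
  assumes "i < length \<sigma>" "\<sigma> ! i < \<sigma> ! j"
  shows "offset \<sigma> b i + b i \<le> offset \<sigma> b j"
proof -
  have "sum b (insert i {l. l < length \<sigma> \<and> \<sigma> ! l < \<sigma> ! i}) \<le> sum b {l. l < length \<sigma> \<and> \<sigma> ! l < \<sigma> ! j}"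
    by (rule sum_mono2) (use assms in auto)
  then show ?thesis by (simp add: offset_def)
qed

lemma \<pi>_less:
  assumes "p < length \<pi>" "q < length \<pi>" "\<sigma> ! blk p < \<sigma> ! blk q"
  shows "\<pi> ! p < \<pi> ! q"
proof -
  obtain k where k: "blk p < length \<sigma>" "k \<le> b (blk p)" "\<pi> ! p = offset \<sigma> b (blk p) + k"
    using entry[OF assms(1)] by metis
  obtain l where l: "1 \<le> l" "\<pi> ! q = offset \<sigma> b (blk q) + l" using entry[OF assms(2)] by metis
  show ?thesis using offset_less[OF k(1) assms(3)] k l by simp
qed

lemma run_order:
  assumes "p < q" "q < length \<pi>"
  shows "blk p \<le> blk q" and "blk p = blk q \<Longrightarrow> \<pi> ! p < \<pi> ! q"
proof -
  obtain k where k: "run_entries \<sigma> b ! p = (blk p, k)" "\<pi> ! p = offset \<sigma> b (blk p) + k"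
    using entry[of p] assms less_trans by metis
  obtain l where l: "run_entries \<sigma> b ! q = (blk q, l)" "\<pi> ! q = offset \<sigma> b (blk q) + l"
    using entry[of q] assms by metis
  have "q < length (run_entries \<sigma> b)" using assms by (simp add: inflate_run_entries)
  from sorted_wrt_nth_less[OF sorted_run_entries assms(1) this]
  have *: "blk p < blk q \<or> blk p = blk q \<and> k < l" unfolding k l by simp
  then show "blk p \<le> blk q" by auto
  show "\<pi> ! p < \<pi> ! q" if "blk p = blk q" using * that k l by simp
qed

lemma \<pi>_greater_iff:
  assumes "p < q" "q < length \<pi>"
  shows "\<pi> ! q < \<pi> ! p \<longleftrightarrow> \<sigma> ! blk q < \<sigma> ! blk p"
proof (cases "blk p = blk q")
  case True
  then show ?thesis using run_order(2)[OF assms] by simp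
next
  case False
  have lt: "p < length \<pi>" using assms by simp
  have "\<sigma> ! blk p \<noteq> \<sigma> ! blk q" using False \<sigma>_eq_iff blk_less lt assms by metis
  then show ?thesis using \<pi>_less[OF lt assms(2)] \<pi>_less[OF assms(2) lt] by linarith
qed

lemma perm_\<pi>: "is_perm \<pi>"
proof -
  have ne: "\<pi> ! p \<noteq> \<pi> ! q" if "p < q" "q < length \<pi>" for p q
  proof (cases "blk p = blk q")
    case True
    then show ?thesis using run_order(2)[OF that] by simp
  next
    case False
    have lt: "p < length \<pi>" using that by simp
    have "\<sigma> ! blk p \<noteq> \<sigma> ! blk q" using False \<sigma>_eq_iff blk_less lt that by metis
    then show ?thesis using \<pi>_less[OF lt that(2)] \<pi>_less[OF that(2) lt] by linarith
  qed
  then have d: "distinct \<pi>" unfolding distinct_conv_nth by (metis linorder_neqE_nat)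
  have "set \<pi> \<subseteq> {1..length \<pi>}"
  proof
    fix x assume "x \<in> set \<pi>"
    then obtain p where p: "p < length \<pi>" "x = \<pi> ! p" by (auto simp: in_set_conv_nth)
    obtain k where k: "blk p < length \<sigma>" "1 \<le> k" "k \<le> b (blk p)" "\<pi> ! p = offset \<sigma> b (blk p) + k"
      using entry[OF p(1)] by metis
    have "sum b (insert (blk p) {l. l < length \<sigma> \<and> \<sigma> ! l < \<sigma> ! blk p}) \<le> sum b {..<length \<sigma>}"
      by (rule sum_mono2) (use k in auto)
    then have "offset \<sigma> b (blk p) + b (blk p) \<le> length \<pi>" by (simp add: offset_def length_\<pi>)
    then show "x \<in> {1..length \<pi>}" using k p by simp
  qed
  then have "set \<pi> = {1..length \<pi>}" using d by (intro card_subset_eq) (auto simp: distinct_card)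
  then show ?thesis using d by (simp add: is_perm_def)
qed

lemma card_block:
  assumes "i < length \<sigma>"
  shows "card {p. p < length \<pi> \<and> blk p = i} = b i"
proof -
  let ?z = "run_entries \<sigma> b"
  have dz: "distinct ?z" unfolding distinct_conv_nth
  proof (intro allI impI)
    fix p q assume pq: "p < length ?z" "q < length ?z" "p \<noteq> q"
    show "?z ! p \<noteq> ?z ! q"
      using sorted_wrt_nth_less[OF sorted_run_entries, of p q \<sigma> b]
        sorted_wrt_nth_less[OF sorted_run_entries, of q p \<sigma> b] pq
      by (cases p q rule: linorder_cases) (auto split: prod.splits)
  qed
  have "bij_betw ((!) ?z) {p. p < length \<pi> \<and> blk p = i} ({i} \<times> {1..b i})"
    unfolding bij_betw_def
  proof
    show "inj_on ((!) ?z) {p. p < length \<pi> \<and> blk p = i}"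
      by (rule inj_on_nth[OF dz]) (simp add: inflate_run_entries)
    show "(!) ?z ` {p. p < length \<pi> \<and> blk p = i} = {i} \<times> {1..b i}"
    proof
      show "(!) ?z ` {p. p < length \<pi> \<and> blk p = i} \<subseteq> {i} \<times> {1..b i}"
      proof
        fix z assume "z \<in> (!) ?z ` {p. p < length \<pi> \<and> blk p = i}"
        then obtain p where p: "p < length \<pi>" "blk p = i" "z = ?z ! p" by auto
        then show "z \<in> {i} \<times> {1..b i}" using entry[OF p(1)] by force
      qed
      show "{i} \<times> {1..b i} \<subseteq> (!) ?z ` {p. p < length \<pi> \<and> blk p = i}"
      proof
        fix z assume z: "z \<in> {i} \<times> {1..b i}"
        then have "z \<in> set ?z" using assms by (auto simp: set_run_entries)
        then obtain p where "p < length ?z" "?z ! p = z" by (auto simp: in_set_conv_nth)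
        then show "z \<in> (!) ?z ` {p. p < length \<pi> \<and> blk p = i}"
          using z by (intro image_eqI[of _ _ p]) (auto simp: block_def inflate_run_entries)
      qed
    qed
  qed
  then show ?thesis using bij_betw_same_card by fastforce
qed

lemma rep:
  assumes "i < length \<sigma>"
  obtains p where "p < length \<pi>" "blk p = i"
proof -
  have "{p. p < length \<pi> \<and> blk p = i} \<noteq> {}" using card_block[OF assms] b_pos[OF assms] by fastforce
  then show ?thesis using that by blast
qed

lemma blk_image: "blk ` {..<length \<pi>} = {..<length \<sigma>}"
  using blk_less rep by (auto simp: image_iff) (metis lessThan_iff)

lemma blk_less_imp: "p < length \<pi> \<Longrightarrow> q < length \<pi> \<Longrightarrow> blk p < blk q \<Longrightarrow> p < q"
  using run_order(1)[of q p] by (cases p q rule: linorder_cases) auto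

lemma Inv_\<pi>: "(p, q) \<in> Inv \<pi> \<longleftrightarrow> p < length \<pi> \<and> q < length \<pi> \<and> (blk p, blk q) \<in> Inv \<sigma>"
proof
  assume "(p, q) \<in> Inv \<pi>"
  then have pq: "p < q" "q < length \<pi>" "\<pi> ! q < \<pi> ! p" by (auto simp: Inv_def)
  then have "\<sigma> ! blk q < \<sigma> ! blk p" using \<pi>_greater_iff by blast
  moreover from this have "blk p < blk q" using run_order(1)[OF pq(1,2)] by (metis le_neq_implies_less less_irrefl)
  ultimately show "p < length \<pi> \<and> q < length \<pi> \<and> (blk p, blk q) \<in> Inv \<sigma>"
    using pq blk_less by (auto simp: Inv_def)
next
  assume *: "p < length \<pi> \<and> q < length \<pi> \<and> (blk p, blk q) \<in> Inv \<sigma>"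
  then have "p < q" using blk_less_imp[of p q] by (auto simp: Inv_def)
  then show "(p, q) \<in> Inv \<pi>" using * \<pi>_greater_iff[of p q] by (auto simp: Inv_def)
qed

lemma nbrs_\<pi>:
  assumes "p < length \<pi>"
  shows "q \<in> nbrs \<pi> p \<longleftrightarrow> q < length \<pi> \<and> blk q \<in> nbrs \<sigma> (blk p)"
  using assms by (auto simp: nbrs_def Inv_\<pi>)

lemma inv_count_\<pi>: "inv_count \<pi> = (\<Sum>(i, j)\<in>Inv \<sigma>. b i * b j)"
proof -
  let ?K = "\<lambda>i. {p. p < length \<pi> \<and> blk p = i}"
  have "Inv \<pi> = (\<Union>(i, j)\<in>Inv \<sigma>. ?K i \<times> ?K j)" by (auto simp: Inv_\<pi>)
  then have "inv_count \<pi> = card (\<Union>(i, j)\<in>Inv \<sigma>. ?K i \<times> ?K j)" by (simp add: inv_count_def)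
  also have "\<dots> = (\<Sum>(i, j)\<in>Inv \<sigma>. card (?K i \<times> ?K j))"
    by (subst card_UN_disjoint) (auto simp: finite_Inv case_prod_unfold)
  also have "\<dots> = (\<Sum>(i, j)\<in>Inv \<sigma>. b i * b j)"
    by (rule sum.cong) (auto simp: card_cartesian_product card_block Inv_def)
  finally show ?thesis .
qed

lemma card_nbrs_\<pi>:
  assumes p: "p < length \<pi>"
  shows "card (nbrs \<pi> p) = sum b (nbrs \<sigma> (blk p))"
proof -
  let ?K = "\<lambda>i. {p. p < length \<pi> \<and> blk p = i}"
  have "nbrs \<pi> p = (\<Union>j\<in>nbrs \<sigma> (blk p). ?K j)" using nbrs_\<pi>[OF p] by auto
  moreover have "finite (nbrs \<sigma> (blk p))" by (rule finite_nbrs)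
  ultimately have "card (nbrs \<pi> p) = (\<Sum>j\<in>nbrs \<sigma> (blk p). card (?K j))"
    by (simp add: card_UN_disjoint disjoint_iff)
  also have "\<dots> = sum b (nbrs \<sigma> (blk p))" by (rule sum.cong) (use card_block nbrs_less in auto)
  finally show ?thesis .
qed

lemma avoids_\<pi>:
  assumes "avoids_1324 \<sigma>"
  shows "avoids_1324 \<pi>"
  unfolding avoids_1324_def
proof
  assume "\<exists>i1 i2 i3 i4. i1 < i2 \<and> i2 < i3 \<and> i3 < i4 \<and> i4 < length \<pi> \<and>
     \<pi> ! i1 < \<pi> ! i3 \<and> \<pi> ! i3 < \<pi> ! i2 \<and> \<pi> ! i2 < \<pi> ! i4"
  then obtain i1 i2 i3 i4 where i: "i1 < i2" "i2 < i3" "i3 < i4" "i4 < length \<pi>"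
    "\<pi> ! i1 < \<pi> ! i3" "\<pi> ! i3 < \<pi> ! i2" "\<pi> ! i2 < \<pi> ! i4" by blast
  have lt: "i1 < length \<pi>" "i2 < length \<pi>" "i3 < length \<pi>" using i by auto
  let ?j1 = "blk i1" and ?j2 = "blk i2" and ?j3 = "blk i3" and ?j4 = "blk i4"
  have j: "?j1 \<le> ?j2" "?j2 \<le> ?j3" "?j3 \<le> ?j4" using run_order(1) i lt by blast+
  have bl: "?j1 < length \<sigma>" "?j2 < length \<sigma>" "?j3 < length \<sigma>" "?j4 < length \<sigma>"
    using blk_less i lt by blast+
  have v32: "\<sigma> ! ?j3 < \<sigma> ! ?j2" using \<pi>_greater_iff[of i2 i3] i lt by blast
  have "\<not> \<sigma> ! ?j3 < \<sigma> ! ?j1" using \<pi>_greater_iff[of i1 i3] i lt by linarith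
  moreover have "?j1 \<noteq> ?j3" using j v32 by (metis le_antisym less_irrefl)
  ultimately have v13: "\<sigma> ! ?j1 < \<sigma> ! ?j3" using \<sigma>_eq_iff bl by (metis linorder_neqE_nat)
  have "\<not> \<sigma> ! ?j4 < \<sigma> ! ?j2" using \<pi>_greater_iff[of i2 i4] i lt by linarith
  moreover have "?j2 \<noteq> ?j4" using j v32 by (metis le_antisym less_irrefl)
  ultimately have v24: "\<sigma> ! ?j2 < \<sigma> ! ?j4" using \<sigma>_eq_iff bl by (metis linorder_neqE_nat)
  have "?j1 \<noteq> ?j2" "?j2 \<noteq> ?j3" "?j3 \<noteq> ?j4" using v13 v32 v24 by (auto dest: less_trans less_not_sym)
  then have "?j1 < ?j2" "?j2 < ?j3" "?j3 < ?j4" using j by auto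
  then show False using assms bl v13 v32 v24 unfolding avoids_1324_def by blast
qed

lemma avoids_\<sigma>:
  assumes "avoids_1324 \<pi>"
  shows "avoids_1324 \<sigma>"
  unfolding avoids_1324_def
proof
  assume "\<exists>i1 i2 i3 i4. i1 < i2 \<and> i2 < i3 \<and> i3 < i4 \<and> i4 < length \<sigma> \<and>
     \<sigma> ! i1 < \<sigma> ! i3 \<and> \<sigma> ! i3 < \<sigma> ! i2 \<and> \<sigma> ! i2 < \<sigma> ! i4"
  then obtain i1 i2 i3 i4 where i: "i1 < i2" "i2 < i3" "i3 < i4" "i4 < length \<sigma>"
    "\<sigma> ! i1 < \<sigma> ! i3" "\<sigma> ! i3 < \<sigma> ! i2" "\<sigma> ! i2 < \<sigma> ! i4" by blast
  obtain p1 where p1: "p1 < length \<pi>" "blk p1 = i1" using rep[of i1] i by auto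
  obtain p2 where p2: "p2 < length \<pi>" "blk p2 = i2" using rep[of i2] i by auto
  obtain p3 where p3: "p3 < length \<pi>" "blk p3 = i3" using rep[of i3] i by auto
  obtain p4 where p4: "p4 < length \<pi>" "blk p4 = i4" using rep[of i4] i by auto
  have "p1 < p2" "p2 < p3" "p3 < p4" using blk_less_imp i p1 p2 p3 p4 by auto
  moreover have "\<pi> ! p1 < \<pi> ! p3" "\<pi> ! p3 < \<pi> ! p2" "\<pi> ! p2 < \<pi> ! p4"
    using \<pi>_less i p1 p2 p3 p4 by auto
  ultimately show False using assms p4 unfolding avoids_1324_def by blast
qed

lemma connected_\<sigma>:
  assumes "connected_on (nbrs \<pi>) {..<length \<pi>}"
  shows "connected_on (nbrs \<sigma>) {..<length \<sigma>}"
  unfolding blk_image[symmetric]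
  by (rule connected_on_image[OF assms]) (use nbrs_\<pi> in auto)

lemma extremal_blk:
  assumes p: "p \<in> extremal_positions \<pi>"
  shows "blk p \<in> extremal_positions \<sigma>"
proof -
  have lt: "p < length \<pi>" using p by (simp add: extremal_positions_def)
  note bp = blk_less[OF lt]
  have range: "1 \<le> \<pi> ! q \<and> \<pi> ! q \<le> length \<pi>" if "q < length \<pi>" for q
    using perm_\<pi> that nth_mem[OF that] by (simp add: is_perm_def)
  have "1 \<in> set \<sigma>" "length \<sigma> \<in> set \<sigma>" using set_\<sigma> bp by auto
  then obtain lo hi where lo: "lo < length \<sigma>" "\<sigma> ! lo = 1" and hi: "hi < length \<sigma>" "\<sigma> ! hi = length \<sigma>"
    by (metis in_set_conv_nth)
  have range_\<sigma>: "1 \<le> \<sigma> ! i \<and> \<sigma> ! i \<le> length \<sigma>" if "i < length \<sigma>" for i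
    using set_\<sigma> nth_mem[OF that] by simp
  consider "p = 0" | "p = length \<pi> - 1" | "\<pi> ! p = 1" | "\<pi> ! p = length \<pi>"
    using p by (auto simp: extremal_positions_def)
  then show ?thesis
  proof cases
    case 1
    have "0 < length \<sigma>" using bp by linarith
    then obtain q where "q < length \<pi>" "blk q = 0" by (rule rep)
    then have "blk p = 0" using 1 run_order(1)[of p q] by (cases "p = q") auto
    then show ?thesis using bp by (simp add: extremal_positions_def)
  next
    case 2
    have "length \<sigma> - 1 < length \<sigma>" using bp by linarith
    then obtain q where q: "q < length \<pi>" "blk q = length \<sigma> - 1" by (rule rep)
    then have "blk q \<le> blk p" using 2 run_order(1)[of q p] lt by (cases "p = q") auto
    then have "blk p = length \<sigma> - 1" using q bp by simp
    then show ?thesis using bp by (simp add: extremal_positions_def)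
  next
    case 3
    obtain q where q: "q < length \<pi>" "blk q = lo" using rep[OF lo(1)] .
    have "\<not> \<sigma> ! lo < \<sigma> ! blk p" using \<pi>_less[of q p] q lt range[OF q(1)] 3 by auto
    then have "\<sigma> ! blk p = 1" using range_\<sigma>[OF bp] lo by simp
    then show ?thesis using bp by (simp add: extremal_positions_def)
  next
    case 4
    obtain q where q: "q < length \<pi>" "blk q = hi" using rep[OF hi(1)] .
    have "\<not> \<sigma> ! blk p < \<sigma> ! hi" using \<pi>_less[of p q] q lt range[OF q(1)] 4 by auto
    then have "\<sigma> ! blk p = length \<sigma>" using range_\<sigma>[OF bp] hi by simp
    then show ?thesis using bp by (simp add: extremal_positions_def)
  qed
qed

lemma connected_\<pi>:
  assumes P: "P \<subseteq> {..<length \<pi>}" and conn: "connected_on (nbrs \<sigma>) (blk ` P)" and two: "card (blk ` P) \<ge> 2"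
  shows "connected_on (nbrs \<pi>) P"
proof (rule connected_on_blow_up[OF conn])
  show "\<exists>x\<in>blk ` P. \<exists>y\<in>blk ` P. x \<noteq> y"
  proof (rule ccontr)
    assume *: "\<not> ?thesis"
    have "finite (blk ` P)" using finite_subset[OF P] by simp
    moreover have "\<forall>x\<in>blk ` P. \<forall>y\<in>blk ` P. x = y" using * by blast
    ultimately have "card (blk ` P) \<le> Suc 0" by (simp only: card_le_Suc0_iff_eq)
    then show False using two by simp
  qed
  show "v \<in> nbrs \<pi> u \<longleftrightarrow> blk v \<in> nbrs \<sigma> (blk u)" if "u \<in> P" "v \<in> P" for u v
    using that P nbrs_\<pi>[of u v] by blast
  show "x \<in> nbrs \<sigma> y" if "y \<in> nbrs \<sigma> x" for x y using that nbrs_sym by blast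
qed

text \<open>
  Deleting an extremal entry of \<open>\<pi>\<close> either only shortens a run or removes an extremal entry of \<open>\<sigma>\<close>.
\<close>
lemma inflate_residual:
  assumes av: "avoids_1324 \<sigma>" and conn: "connected_on (nbrs \<sigma>) {..<length \<sigma>}"
    and ext: "\<And>i. i \<in> extremal_positions \<sigma> \<Longrightarrow> connected_on (nbrs \<sigma>) ({..<length \<sigma>} - {i})"
    and len: "length \<sigma> \<ge> 3"
    and weight: "int (\<Sum>(i, j)\<in>Inv \<sigma>. b i * b j) = 2 * int (sum b {..<length \<sigma>}) - 7 + int \<delta>"
  shows "\<pi> \<in> \<R> \<delta> (sum b {..<length \<sigma>})"
proof -
  have n: "sum b {..<length \<sigma>} \<ge> 3"
    using sum_mono[of "{..<length \<sigma>}" "\<lambda>_. 1" b] b_pos len by simp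
  have "connected_on (nbrs \<pi>) {..<length \<pi>}"
    by (rule connected_\<pi>) (use conn len in \<open>simp_all add: blk_image\<close>)
  moreover have "connected_on (nbrs \<pi>) ({..<length \<pi>} - {p})" if p: "p \<in> extremal_positions \<pi>" for p
  proof (rule connected_\<pi>)
    have lt: "p < length \<pi>" using p by (simp add: extremal_positions_def)
    let ?P = "{..<length \<pi>} - {p}"
    have image: "blk ` ?P = {..<length \<sigma>} \<or> blk ` ?P = {..<length \<sigma>} - {blk p}"
    proof -
      have "{..<length \<pi>} = insert p ?P" using lt by auto
      then have "{..<length \<sigma>} = insert (blk p) (blk ` ?P)" using blk_image by (metis image_insert)
      then show ?thesis by (metis Diff_insert_absorb insert_absorb)
    qed
    note image
    moreover have "card ({..<length \<sigma>} - {blk p}) = length \<sigma> - 1"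
      using blk_less[OF lt] by (simp add: card_Diff_singleton)
    ultimately have card: "2 \<le> card (blk ` ?P)"
      using len by (elim disjE) simp_all
    show "2 \<le> card (blk ` ?P)" by (rule card)
    show "connected_on (nbrs \<sigma>) (blk ` ?P)"
      using image conn ext[OF extremal_blk[OF p]] by (elim disjE) simp_all
  qed simp
  ultimately show ?thesis
    using \<R>_iff[of "sum b {..<length \<sigma>}" \<pi> \<delta>] n perm_\<pi> length_\<pi> avoids_\<pi>[OF av] weight inv_count_\<pi>
    by auto
qed

end

text \<open>
  The vector \<open>b\<close> of the last claim is the one of the inflation in \<open>\<R>\<close>: degrees and inversions of the
  inflation are sums of entries of \<open>b\<close>.
\<close>
lemma \<Sigma>_memberD:
  assumes "\<sigma> \<in> \<Sigma> \<delta>"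
  shows "is_perm \<sigma>" "reduced \<sigma>" "avoids_1324 \<sigma>" "connected_on (nbrs \<sigma>) {..<length \<sigma>}"
    and "\<exists>b. (\<forall>i<length \<sigma>. b i \<ge> 1 \<and> sum b (nbrs \<sigma> i) \<ge> 2) \<and>
      int (\<Sum>(i, j)\<in>Inv \<sigma>. b i * b j) = 2 * int (sum b {..<length \<sigma>}) - 7 + int \<delta>"
proof -
  obtain b n s where \<sigma>: "\<sigma> \<in> permutations_of_set {1..s}" "reduced \<sigma>"
    and b: "\<forall>i<length \<sigma>. b i \<ge> 1" "n \<ge> 3" "inflate \<sigma> b \<in> \<R> \<delta> n"
    using assms unfolding \<Sigma>_def by blast
  show perm: "is_perm \<sigma>" using \<sigma>(1) unfolding is_perm_iff by blast
  show "reduced \<sigma>" by (rule \<sigma>(2))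
  interpret inflation \<sigma> b using perm b by unfold_locales auto
  have R: "length \<pi> = n" "avoids_1324 \<pi>" "int (inv_count \<pi>) = 2 * int n - 7 + int \<delta>"
    "connected_on (nbrs \<pi>) {..<length \<pi>}"
    using b \<R>_iff[of n \<pi> \<delta>] by auto
  show "avoids_1324 \<sigma>" by (rule avoids_\<sigma>[OF R(2)])
  show "connected_on (nbrs \<sigma>) {..<length \<sigma>}" by (rule connected_\<sigma>[OF R(4)])
  have "sum b (nbrs \<sigma> i) \<ge> 2" if i: "i < length \<sigma>" for i
  proof -
    obtain p where p: "p < length \<pi>" "blk p = i" using rep[OF i] .
    show ?thesis using residual_degree_ge_2[OF b(3,2), of p] p R(1) card_nbrs_\<pi>[OF p(1)] by simp
  qed
  moreover have "int (\<Sum>(i, j)\<in>Inv \<sigma>. b i * b j) = 2 * int (sum b {..<length \<sigma>}) - 7 + int \<delta>"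
    using R inv_count_\<pi> length_\<pi> by simp
  ultimately show "\<exists>b. (\<forall>i<length \<sigma>. b i \<ge> 1 \<and> sum b (nbrs \<sigma> i) \<ge> 2) \<and>
      int (\<Sum>(i, j)\<in>Inv \<sigma>. b i * b j) = 2 * int (sum b {..<length \<sigma>}) - 7 + int \<delta>"
    using b(1) by blast
qed

section \<open>Finiteness of the set of reduced permutations\<close>

definition inversion_weight :: "nat list \<Rightarrow> (nat \<Rightarrow> nat) \<Rightarrow> nat" where
  "inversion_weight \<sigma> b = (\<Sum>(i, j)\<in>Inv \<sigma>. b i * b j)"

lemma Sigma_nbrs: "Sigma {..<length \<sigma>} (nbrs \<sigma>) = Inv \<sigma> \<union> (Inv \<sigma>)\<inverse>"
  by (auto simp: nbrs_def Inv_def)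

lemma Inv_disjoint: "Inv \<sigma> \<inter> (Inv \<sigma>)\<inverse> = {}"
  by (auto simp: Inv_def)

lemma sum_nbrs:
  fixes g :: "nat \<Rightarrow> nat \<Rightarrow> nat"
  shows "(\<Sum>i<length \<sigma>. \<Sum>j\<in>nbrs \<sigma> i. g i j) = (\<Sum>(i, j)\<in>Inv \<sigma>. g i j + g j i)"
proof -
  have "(\<Sum>i<length \<sigma>. \<Sum>j\<in>nbrs \<sigma> i. g i j) = (\<Sum>(i, j)\<in>Sigma {..<length \<sigma>} (nbrs \<sigma>). g i j)"
    by (rule sum.Sigma) (auto simp: finite_nbrs)
  also have "\<dots> = (\<Sum>(i, j)\<in>Inv \<sigma>. g i j) + (\<Sum>(i, j)\<in>(Inv \<sigma>)\<inverse>. g i j)"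
    unfolding Sigma_nbrs by (rule sum.union_disjoint) (simp_all add: finite_Inv Inv_disjoint)
  also have "(\<Sum>(i, j)\<in>(Inv \<sigma>)\<inverse>. g i j) = (\<Sum>(i, j)\<in>Inv \<sigma>. g j i)"
    by (rule sum.reindex_bij_witness[of _ prod.swap prod.swap]) auto
  finally show ?thesis by (simp add: sum.distrib case_prod_unfold)
qed

lemma inversion_weight_add:
  "inversion_weight \<sigma> (\<lambda>i. l i + x i) =
    inversion_weight \<sigma> l + (\<Sum>i<length \<sigma>. x i * sum l (nbrs \<sigma> i)) + inversion_weight \<sigma> x"
proof -
  have "(\<Sum>i<length \<sigma>. x i * sum l (nbrs \<sigma> i)) = (\<Sum>(i, j)\<in>Inv \<sigma>. x i * l j + x j * l i)"
    unfolding sum_distrib_left by (rule sum_nbrs)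
  then show ?thesis
    by (simp add: inversion_weight_def sum.distrib[symmetric] case_prod_unfold algebra_simps)
qed

text \<open>
  Let \<open>U\<close> be the set of all neighbours of \<open>i\<close> and \<open>j\<close>. For \<open>p\<close> in \<open>{i..<j}\<close> with \<open>p\<close> and \<open>p + 1\<close>
  outside \<open>U\<close>, the entries at these positions increase, by \<open>1324\<close>-avoidance, and some value lies
  strictly between them, by reducedness. The position \<open>w\<close> of the value that follows the entry at
  \<open>p\<close> belongs to \<open>U\<close>, since otherwise it would complete a \<open>1324\<close>. So \<open>p\<close>, \<open>p + 1\<close> or \<open>w\<close>
  is in \<open>U\<close>, and each of the three determines \<open>p\<close>.
\<close>
lemma position_gap:
  assumes perm: "is_perm \<sigma>" and av: "avoids_1324 \<sigma>" and red: "reduced \<sigma>"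
    and ij: "below \<sigma> i j" "j < length \<sigma>"
  shows "j - i \<le> 3 * (card (nbrs \<sigma> i) + card (nbrs \<sigma> j))"
proof -
  have dist: "distinct \<sigma>" and set: "set \<sigma> = {1..length \<sigma>}" using perm by (auto simp: is_perm_def)
  have ij': "i < j" "\<sigma> ! i < \<sigma> ! j" using ij by (auto simp: below_def)
  define U where "U = nbrs \<sigma> i \<union> nbrs \<sigma> j"
  have finU: "finite U" unfolding U_def by (simp add: finite_nbrs)
  have no1324: False if "a < b" "b < c" "c < d" "d < length \<sigma>" "\<sigma> ! a < \<sigma> ! c" "\<sigma> ! c < \<sigma> ! b" "\<sigma> ! b < \<sigma> ! d"
    for a b c d using av that unfolding avoids_1324_def by blast
  have ne: "\<sigma> ! p \<noteq> \<sigma> ! q" if "p \<noteq> q" "p < length \<sigma>" "q < length \<sigma>" for p q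
    using that dist by (simp add: nth_eq_iff_index_eq)
  have inU: "u \<in> U \<longleftrightarrow> (u < i \<and> \<sigma> ! i < \<sigma> ! u) \<or> (i < u \<and> \<sigma> ! u < \<sigma> ! i)
      \<or> (u < j \<and> \<sigma> ! j < \<sigma> ! u) \<or> (j < u \<and> \<sigma> ! u < \<sigma> ! j)" if "u < length \<sigma>" for u
    using that ij' ij(2) by (auto simp: U_def nbrs_def Inv_def)
  let ?pred = "\<lambda>w. inv_into {..<length \<sigma>} ((!) \<sigma>) (\<sigma> ! w - 1)"
  have "p \<in> U \<union> (\<lambda>w. w - 1) ` U \<union> ?pred ` U" if p: "p \<in> {i..<j}" for p
  proof (cases "p \<in> U \<or> Suc p \<in> U")
    case True
    then show ?thesis
    proof
      assume "Suc p \<in> U"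
      then have "p \<in> (\<lambda>w. w - 1) ` U" by (intro image_eqI[of _ _ "Suc p"]) auto
      then show ?thesis by blast
    qed blast
  next
    case False
    have lt: "p < length \<sigma>" "Suc p < length \<sigma>" using p ij(2) by auto
    have pi: "p = i \<or> i < p \<and> \<sigma> ! i < \<sigma> ! p" and pj: "\<sigma> ! p < \<sigma> ! j"
      using False inU[OF lt(1)] p ne[of p i] ne[of p j] lt ij' ij(2) by (auto simp: nat_neq_iff)
    have qi: "\<sigma> ! i < \<sigma> ! Suc p" and qj: "Suc p = j \<or> Suc p < j \<and> \<sigma> ! Suc p < \<sigma> ! j"
      using False inU[OF lt(2)] p ne[of "Suc p" i] ne[of "Suc p" j] lt ij' ij(2) by (auto simp: nat_neq_iff)
    have up: "\<sigma> ! p < \<sigma> ! Suc p"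
    proof (rule ccontr)
      assume "\<not> ?thesis"
      then have "\<sigma> ! Suc p < \<sigma> ! p" using ne[of p "Suc p"] lt by auto
      moreover from this have "i < p" "Suc p < j" using pi qj qi pj by auto
      ultimately show False using no1324[of i p "Suc p" j] qi pj ij(2) by auto
    qed
    have gap: "\<sigma> ! p + 1 < \<sigma> ! Suc p"
      using up red lt unfolding reduced_def by (metis Suc_eq_plus1 Suc_lessI)
    have "\<sigma> ! p + 1 \<in> set \<sigma>" using set gap nth_mem[OF lt(2)] by auto
    then obtain w where w: "w < length \<sigma>" "\<sigma> ! w = \<sigma> ! p + 1" by (auto simp: in_set_conv_nth)
    have wp: "w \<noteq> p" "w \<noteq> Suc p" using w gap by auto
    have vals: "\<sigma> ! i < \<sigma> ! w" "\<sigma> ! w < \<sigma> ! j" using w pi gap qj by auto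
    have "w \<in> U"
    proof (cases "w < p")
      case True
      have "\<not> i < w" using no1324[of i w p "Suc p"] pi True w gap lt by auto
      moreover have "w \<noteq> i" using vals by auto
      ultimately show ?thesis using inU[OF w(1)] vals by auto
    next
      case False
      then have "Suc p < w" using wp by simp
      then have "\<not> w < j" using no1324[of p "Suc p" w j] qj w gap ij(2) by auto
      moreover have "w \<noteq> j" using vals by auto
      ultimately show ?thesis using inU[OF w(1)] vals by auto
    qed
    moreover have "?pred w = p"
    proof -
      have "?pred w = inv_into {..<length \<sigma>} ((!) \<sigma>) (\<sigma> ! p)" using w by simp
      also have "\<dots> = p" by (rule inv_into_f_f) (use dist lt in \<open>auto intro: inj_on_nth\<close>)
      finally show ?thesis .
    qed
    ultimately show ?thesis by (metis UnI2 image_eqI)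
  qed
  then have "{i..<j} \<subseteq> U \<union> (\<lambda>w. w - 1) ` U \<union> ?pred ` U" by blast
  then have "card {i..<j} \<le> card (U \<union> (\<lambda>w. w - 1) ` U \<union> ?pred ` U)" by (rule card_mono[rotated]) (use finU in simp)
  also have "\<dots> \<le> card U + card ((\<lambda>w. w - 1) ` U) + card (?pred ` U)"
    using card_Un_le[of "U \<union> (\<lambda>w. w - 1) ` U" "?pred ` U"] card_Un_le[of U "(\<lambda>w. w - 1) ` U"] by linarith
  also have "\<dots> \<le> 3 * card U" using card_image_le[OF finU, of "\<lambda>w. w - 1"] card_image_le[OF finU, of ?pred] by linarith
  also have "\<dots> \<le> 3 * (card (nbrs \<sigma> i) + card (nbrs \<sigma> j))" unfolding U_def by (intro mult_le_mono2 card_Un_le)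
  finally show ?thesis by simp
qed

text \<open>
  Sum \<open>position_gap\<close> over all pairs \<open>i < j\<close>, estimating the gap of an inverted pair by the length
  \<open>s\<close>. The left side is \<open>(s\<^sup>3 - s) / 6\<close> and the right side is at most
  \<open>13 s\<close> times the number of inversions, because the degrees sum to twice that number.
\<close>
lemma inversions_quadratic:
  assumes perm: "is_perm \<sigma>" and av: "avoids_1324 \<sigma>" and red: "reduced \<sigma>" and s: "length \<sigma> \<ge> 1"
  shows "length \<sigma> * length \<sigma> \<le> 78 * inv_count \<sigma> + 1"
proof -
  let ?s = "length \<sigma>" and ?d = "\<lambda>i. card (nbrs \<sigma> i)"
  define m where "m = inv_count \<sigma>"
  have dist: "distinct \<sigma>" using perm by (simp add: is_perm_def)
  have deg: "(\<Sum>i<?s. ?d i) = 2 * m"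
    using sum_nbrs[of "\<lambda>_ _. 1" \<sigma>] by (simp add: m_def inv_count_def case_prod_unfold)
  have tri: "2 * (\<Sum>i<j. j - i) = j * (j + 1)" for j :: nat
  proof (induction j)
    case (Suc j)
    have "(\<Sum>i<Suc j. Suc j - i) = (\<Sum>i<j. (j - i) + 1) + 1"
      by (simp add: Suc_diff_le)
    then show ?case using Suc by (simp add: sum_Suc)
  qed simp
  have cube: "3 * (\<Sum>j<n. j * (j + 1)) + n = n * n * n" for n :: nat
    by (induction n) (auto simp: algebra_simps)
  have gap: "j - i \<le> 3 * (?d i + ?d j) + (if (i, j) \<in> Inv \<sigma> then ?s else 0)" if "i < j" "j < ?s" for i j
  proof (cases "(i, j) \<in> Inv \<sigma>")
    case True
    then show ?thesis using that by simp
  next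
    case False
    have "\<sigma> ! i \<noteq> \<sigma> ! j" using that dist by (simp add: nth_eq_iff_index_eq)
    then have "below \<sigma> i j" using False that by (auto simp: Inv_def below_def)
    then show ?thesis using position_gap[OF perm av red] that False by simp
  qed
  have inv: "(\<Sum>j<?s. \<Sum>i<j. if (i, j) \<in> Inv \<sigma> then ?s else 0) = m * ?s"
  proof -
    have "(\<Sum>j<?s. \<Sum>i<j. if (i, j) \<in> Inv \<sigma> then ?s else 0)
        = (\<Sum>(j, i)\<in>Sigma {..<?s} (\<lambda>j. {..<j}). if (i, j) \<in> Inv \<sigma> then ?s else 0)"
      by (rule sum.Sigma) auto
    also have "\<dots> = (\<Sum>(j, i)\<in>(Inv \<sigma>)\<inverse>. ?s)"
      by (rule sum.mono_neutral_cong_right) (auto simp: Inv_def split: if_splits)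
    also have "\<dots> = m * ?s" by (simp add: m_def inv_count_def case_prod_unfold)
    finally show ?thesis .
  qed
  have dd: "(\<Sum>j<?s. \<Sum>i<j. ?d i + ?d j) \<le> ?s * (4 * m)"
  proof -
    have "(\<Sum>j<?s. \<Sum>i<j. ?d i + ?d j) \<le> (\<Sum>j<?s. \<Sum>i<?s. ?d i + ?d j)"
      by (intro sum_mono sum_mono2) auto
    also have "\<dots> = ?s * (\<Sum>i<?s. ?d i) + ?s * (\<Sum>i<?s. ?d i)" by (simp add: sum.distrib sum_distrib_left)
    finally show ?thesis unfolding deg by (simp add: algebra_simps)
  qed
  have "?s * ?s * ?s = 6 * (\<Sum>j<?s. \<Sum>i<j. j - i) + ?s"
  proof -
    have "2 * (\<Sum>j<?s. \<Sum>i<j. j - i) = (\<Sum>j<?s. j * (j + 1))"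
      unfolding tri[symmetric] by (simp only: sum_distrib_left)
    then show ?thesis using cube[of ?s] by linarith
  qed
  also have "(\<Sum>j<?s. \<Sum>i<j. j - i)
      \<le> (\<Sum>j<?s. \<Sum>i<j. 3 * (?d i + ?d j) + (if (i, j) \<in> Inv \<sigma> then ?s else 0))"
    by (intro sum_mono gap) auto
  also have "\<dots> = 3 * (\<Sum>j<?s. \<Sum>i<j. ?d i + ?d j) + m * ?s"
  proof -
    have "3 * (\<Sum>j<?s. \<Sum>i<j. ?d i + ?d j) = (\<Sum>j<?s. \<Sum>i<j. 3 * (?d i + ?d j))"
      by (simp only: sum_distrib_left)
    then show ?thesis unfolding inv[symmetric] by (simp only: sum.distrib)
  qed
  finally have "?s * ?s * ?s \<le> 6 * (3 * (\<Sum>j<?s. \<Sum>i<j. ?d i + ?d j) + m * ?s) + ?s" by simp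
  then have "?s * (?s * ?s) \<le> ?s * (78 * m + 1)" using dd by (simp add: algebra_simps)
  then show ?thesis using s unfolding m_def by (simp only: mult_le_cancel1)
qed

text \<open>
  Truncate \<open>b\<close> at \<open>2\<close>. All weighted degrees stay at least \<open>2\<close>, so each unit removed costs at least
  \<open>2\<close> in weight, and the truncated vector has sum at most twice the length.
\<close>
lemma inversion_weight_lower:
  assumes b: "\<And>i. i < length \<sigma> \<Longrightarrow> b i \<ge> 1 \<and> sum b (nbrs \<sigma> i) \<ge> 2"
  shows "inv_count \<sigma> + 2 * sum b {..<length \<sigma>} \<le> inversion_weight \<sigma> b + 4 * length \<sigma>"
proof -
  define l where "l i = min (b i) 2" for i
  define x where "x i = b i - l i" for i
  have bx: "b = (\<lambda>i. l i + x i)" unfolding x_def l_def by auto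
  have l2: "sum l (nbrs \<sigma> i) \<ge> 2" if "i < length \<sigma>" for i
  proof (cases "\<exists>j\<in>nbrs \<sigma> i. b j \<ge> 2")
    case True
    then obtain j where "j \<in> nbrs \<sigma> i" "l j = 2" unfolding l_def by force
    then show ?thesis using member_le_sum[of j "nbrs \<sigma> i" l] finite_nbrs by simp
  next
    case False
    then have "sum l (nbrs \<sigma> i) = sum b (nbrs \<sigma> i)" by (intro sum.cong) (auto simp: l_def min_def)
    then show ?thesis using b[OF that] by simp
  qed
  have "2 * sum x {..<length \<sigma>} \<le> (\<Sum>i<length \<sigma>. x i * sum l (nbrs \<sigma> i))"
    by (subst sum_distrib_left, rule sum_mono) (use l2 in \<open>simp add: mult.commute\<close>)
  moreover have "inv_count \<sigma> \<le> inversion_weight \<sigma> l"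
  proof -
    have "(\<Sum>p\<in>Inv \<sigma>. 1) \<le> inversion_weight \<sigma> l"
      unfolding inversion_weight_def
    proof (rule sum_mono)
      fix p assume "p \<in> Inv \<sigma>"
      moreover obtain i j where p: "p = (i, j)" by fastforce
      ultimately have "i < length \<sigma>" "j < length \<sigma>" by (auto simp: Inv_def)
      then have "1 \<le> l i" "1 \<le> l j" using b by (auto simp: l_def)
      then show "1 \<le> (case p of (i, j) \<Rightarrow> l i * l j)" using p by simp
    qed
    then show ?thesis by (simp add: inv_count_def)
  qed
  moreover have "sum l {..<length \<sigma>} \<le> 2 * length \<sigma>"
    using sum_mono[of "{..<length \<sigma>}" l "\<lambda>_. 2"] by (simp add: l_def)
  moreover have "sum b {..<length \<sigma>} = sum l {..<length \<sigma>} + sum x {..<length \<sigma>}"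
    by (subst bx) (simp add: sum.distrib)
  moreover have "inversion_weight \<sigma> b = inversion_weight \<sigma> l
      + (\<Sum>i<length \<sigma>. x i * sum l (nbrs \<sigma> i)) + inversion_weight \<sigma> x"
    by (subst bx) (rule inversion_weight_add)
  ultimately show ?thesis by linarith
qed

lemma finite_\<Sigma>: "finite (\<Sigma> \<delta>)"
proof -
  let ?K = "313 + 78 * \<delta>"
  have "length \<sigma> \<le> ?K" if \<sigma>: "\<sigma> \<in> \<Sigma> \<delta>" for \<sigma>
  proof (cases "length \<sigma> = 0")
    case False
    then have s: "length \<sigma> \<ge> 1" by linarith
    obtain b where b: "\<forall>i<length \<sigma>. b i \<ge> 1 \<and> sum b (nbrs \<sigma> i) \<ge> 2"
      "int (inversion_weight \<sigma> b) = 2 * int (sum b {..<length \<sigma>}) - 7 + int \<delta>"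
      using \<Sigma>_memberD(5)[OF \<sigma>] unfolding inversion_weight_def by blast
    have "inv_count \<sigma> + 2 * sum b {..<length \<sigma>} \<le> inversion_weight \<sigma> b + 4 * length \<sigma>"
      by (rule inversion_weight_lower) (use b in blast)
    then have "inv_count \<sigma> \<le> 4 * length \<sigma> + \<delta>" using b(2) by linarith
    moreover have "length \<sigma> * length \<sigma> \<le> 78 * inv_count \<sigma> + 1"
      by (rule inversions_quadratic[OF \<Sigma>_memberD(1)[OF \<sigma>] \<Sigma>_memberD(3)[OF \<sigma>] \<Sigma>_memberD(2)[OF \<sigma>] s])
    ultimately have sq: "length \<sigma> * length \<sigma> \<le> 312 * length \<sigma> + 78 * \<delta> + 1" by linarith
    show ?thesis
    proof (rule ccontr)
      assume "\<not> ?thesis"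
      then have "length \<sigma> * (314 + 78 * \<delta>) \<le> length \<sigma> * length \<sigma>" by (intro mult_le_mono2) simp
      moreover have "78 * \<delta> * 1 \<le> 78 * \<delta> * length \<sigma>" using s by (intro mult_le_mono2) simp
      ultimately show False using sq False by (simp add: algebra_simps)
    qed
  qed simp
  then have "\<Sigma> \<delta> \<subseteq> (\<Union>s\<in>{..?K}. permutations_of_set {1..s})"
    using \<Sigma>_memberD(1) is_perm_iff by blast
  then show ?thesis by (rule finite_subset) auto
qed

section \<open>The size of rank-three cells\<close>

lemma card_3_sorted: "card F = 3 \<Longrightarrow> \<exists>a b c. F = {a, b, c} \<and> a < b \<and> b < (c::nat)"
proof -
  assume "card F = 3"
  then obtain x y z where "F = {x, y, z}" "x \<noteq> y" "y \<noteq> z" "x \<noteq> z" by (auto simp: card_3_iff)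
  then show ?thesis
    by (cases x y rule: linorder_cases; cases y z rule: linorder_cases; cases x z rule: linorder_cases)
      (auto 4 4)
qed

text \<open>
  The equation \<open>Q(x) = h\<close> of a cell, solved for the number of inversions of \<open>\<sigma>[\<ell> + x]\<close>.
\<close>
lemma inversion_weight_cell:
  assumes perm: "is_perm \<sigma>" and cell: "(T, x, F) \<in> canonical_cells \<delta> \<sigma>"
  shows "int (inversion_weight \<sigma> (\<lambda>i. ell \<sigma> i + x i)) =
    2 * int (sum (\<lambda>i. ell \<sigma> i + x i) {..<length \<sigma>}) - 7 + int \<delta>"
proof -
  interpret inflation \<sigma> "ell \<sigma>" by unfold_locales (use perm in \<open>auto simp: ell_def\<close>)
  have d0: "\<delta>0 \<sigma> = int (inversion_weight \<sigma> (ell \<sigma>)) - 2 * int (sum (ell \<sigma>) {..<length \<sigma>}) + 7"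
    unfolding \<delta>0_def inv_count_\<pi> ell_total_def inversion_weight_def ..
  have Q: "Qform \<sigma> x = int \<delta> - \<delta>0 \<sigma>" using cell by (simp add: canonical_cells_def)
  have W: "(\<Sum>(i, j)\<in>Inv \<sigma>. int (x i) * int (x j)) = int (inversion_weight \<sigma> x)"
    by (simp add: inversion_weight_def case_prod_unfold)
  have a: "(\<Sum>i<length \<sigma>. acoef \<sigma> i * int (x i))
      = int (\<Sum>i<length \<sigma>. x i * sum (ell \<sigma>) (nbrs \<sigma> i)) - 2 * int (sum x {..<length \<sigma>})"
    by (simp add: acoef_def sum_subtractf[symmetric] sum_distrib_left algebra_simps)
  have "int (inversion_weight \<sigma> (\<lambda>i. ell \<sigma> i + x i)) = int (inversion_weight \<sigma> (ell \<sigma>))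
      + int (\<Sum>i<length \<sigma>. x i * sum (ell \<sigma>) (nbrs \<sigma> i)) + int (inversion_weight \<sigma> x)"
    unfolding inversion_weight_add by simp
  moreover have "sum (\<lambda>i. ell \<sigma> i + x i) {..<length \<sigma>} = sum (ell \<sigma>) {..<length \<sigma>} + sum x {..<length \<sigma>}"
    by (rule sum.distrib)
  ultimately show ?thesis using Q d0 W a unfolding Qform_def by simp
qed

lemma edge_weight_incomparable:
  assumes dist: "distinct \<sigma>"
  shows "edge_weight (incomparable {..<length \<sigma>} (below \<sigma>)) y {..<length \<sigma>} = 2 * inversion_weight \<sigma> y"
proof -
  have "adj_pairs (incomparable {..<length \<sigma>} (below \<sigma>)) {..<length \<sigma>} = Sigma {..<length \<sigma>} (nbrs \<sigma>)"
    using nbrs_iff[OF dist] by (auto simp: adj_pairs_def incomparable_def)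
  then have "edge_weight (incomparable {..<length \<sigma>} (below \<sigma>)) y {..<length \<sigma>}
      = (\<Sum>(i, j)\<in>Sigma {..<length \<sigma>} (nbrs \<sigma>). y i * y j)" by (simp add: edge_weight_def)
  also have "\<dots> = (\<Sum>i<length \<sigma>. \<Sum>j\<in>nbrs \<sigma> i. y i * y j)"
    by (rule sum.Sigma[symmetric]) (auto simp: finite_nbrs)
  also have "\<dots> = 2 * inversion_weight \<sigma> y"
    unfolding sum_nbrs inversion_weight_def
    by (subst sum_distrib_left, rule sum.cong) (auto simp: mult.commute)
  finally show ?thesis .
qed

text \<open>
  It remains to check the hypotheses of \<open>weight_bound\<close> for \<open>y = \<ell> + x\<close>. The seven named positions are
  in \<open>F\<close> or adjacent to it, so \<open>x\<close> vanishes there. The neighbours of \<open>F\<close> have \<open>\<ell> = 1\<close> by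
  \<open>chain_nbrs\<close>; \<open>f1\<close> and \<open>f3\<close> have it because their neighbours are adjacent to each other, whence
  they are not cut vertices; \<open>f2\<close> has it because it is not extremal. Finally \<open>be\<close> and \<open>ep\<close> are
  extremal with \<open>\<ell> = 1\<close>, so they are not cut vertices either.
\<close>
lemma rank_three_size:
  assumes \<sigma>: "\<sigma> \<in> \<Sigma> \<delta>" and cell: "(T, x, F) \<in> canonical_cells \<delta> \<sigma>" and F3: "card F = 3"
    and \<delta>: "\<delta> \<ge> 3"
  shows "ell_total \<sigma> + (\<Sum>i\<in>T. x i) \<le> (if \<delta> = 3 then 9 else if \<delta> = 4 then 11 else \<delta> + 8)"
proof -
  let ?V = "{..<length \<sigma>}"
  note perm = \<Sigma>_memberD(1)[OF \<sigma>] and conn = \<Sigma>_memberD(4)[OF \<sigma>]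
  have dist: "distinct \<sigma>" using perm by (simp add: is_perm_def)
  from cell have T: "T \<subseteq> ?V" "\<And>i. i \<notin> T \<Longrightarrow> x i = 0" and F: "F \<subseteq> ?V - T"
    and free: "\<And>i. i \<in> F \<Longrightarrow> acoef \<sigma> i = 0 \<and> nbrs \<sigma> i \<inter> (T \<union> F) = {}"
    by (auto simp: canonical_cells_def)
  interpret thin_order ?V "below \<sigma>"
    by (rule reduced_thin_order[OF perm \<Sigma>_memberD(3)[OF \<sigma>] \<Sigma>_memberD(2)[OF \<sigma>] conn])
  have N: "N i = nbrs \<sigma> i" if "i \<in> ?V" for i using nbrs_incomparable[OF dist] that by simp
  obtain f1 f2 f3 where f: "F = {f1, f2, f3}" "f1 < f2" "f2 < f3" using card_3_sorted[OF F3] by blast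
  have fV: "f1 \<in> ?V" "f2 \<in> ?V" "f3 \<in> ?V" using F f by auto
  have len: "length \<sigma> \<ge> 3" using f fV by auto
  have chain: "below \<sigma> f1 f2" "below \<sigma> f2 f3"
    using free[of f1] free[of f2] nbrs_iff[OF dist, of f1 f2] nbrs_iff[OF dist, of f2 f3] f fV
    by (auto simp: below_def)
  have sum2: "sum (ell \<sigma>) (N i) = 2" if "i \<in> F" for i
  proof -
    have "int (sum (ell \<sigma>) (nbrs \<sigma> i)) = 2" using free[OF that] by (simp add: acoef_def)
    then have "sum (ell \<sigma>) (nbrs \<sigma> i) = 2" by linarith
    moreover have "N i = nbrs \<sigma> i" using N that F by blast
    ultimately show ?thesis by simp
  qed
  obtain al be ep ze where nb: "N f1 = {al, be}" "N f2 = {be, ep}" "N f3 = {ep, ze}"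
    "distinct [al, be, ep, ze]" and ell1: "ell \<sigma> al = 1" "ell \<sigma> be = 1" "ell \<sigma> ep = 1" "ell \<sigma> ze = 1"
    by (rule chain_nbrs[OF fV chain, of "ell \<sigma>"]) (use sum2 f in \<open>auto simp: ell_def\<close>)
  interpret path_config ?V "below \<sigma>" f1 f2 f3 al be ep ze
    by unfold_locales (use fV chain nb in auto)
  interpret conv: path_config ?V "\<lambda>u v. below \<sigma> v u" f3 f2 f1 ze ep be al by (rule converse)
  note cN = incomparable_converse[of ?V "below \<sigma>"]
  have connN: "connected_on N P \<longleftrightarrow> connected_on (nbrs \<sigma>) P" if "P \<subseteq> ?V" for P
    using connected_nbrs_iff[OF dist that] by simp
  have ell_1: "ell \<sigma> i = 1 \<longleftrightarrow> i \<notin> extremal_positions \<sigma> \<or> connected_on N (?V - {i})" if "i \<in> ?V" for i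
    using decomposable_delete_position_iff[OF perm, of i] that len connN[of "?V - {i}"]
    by (auto simp: ell_def dbl_positions_def)
  have conn_be: "connected_on N (?V - {be})"
  proof -
    have "be \<in> extremal_positions \<sigma>"
    proof (rule extremal_position[OF perm, of be f1 f2])
      show "f1 \<in> nbrs \<sigma> be" "f2 \<in> nbrs \<sigma> be"
        using nb N fV nbrs_sym by blast+
      show "(u = f2 \<or> below \<sigma> u f2) \<or> (u = f1 \<or> below \<sigma> f1 u)" if "u \<in> nbrs \<sigma> be" for u
        using be_nbrs that N nbrs_in(2) by blast
    qed (use chain nbrs_in be_minimal in auto)
    then show ?thesis using ell_1[OF nbrs_in(2)] ell1(2) by blast
  qed
  have conn_ep: "connected_on N (?V - {ep})"
  proof -
    have "ep \<in> extremal_positions \<sigma>"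
    proof (rule extremal_position[OF perm, of ep f2 f3])
      show "f2 \<in> nbrs \<sigma> ep" "f3 \<in> nbrs \<sigma> ep"
        using nb N fV nbrs_sym by blast+
      show "(u = f3 \<or> below \<sigma> u f3) \<or> (u = f2 \<or> below \<sigma> f2 u)" if "u \<in> nbrs \<sigma> ep" for u
        using conv.be_nbrs[of u] that N nbrs_in(3) unfolding cN by blast
    qed (use chain nbrs_in conv.be_minimal in auto)
    then show ?thesis using ell_1[OF nbrs_in(3)] ell1(3) by blast
  qed
  interpret path_config_conn ?V "below \<sigma>" f1 f2 f3 al be ep ze
    by unfold_locales (use conn_be conn_ep in auto)
  define y where "y i = ell \<sigma> i + x i" for i
  have y1: "y v = 1" if v: "v \<in> {f1, f2, f3, al, be, ep, ze}" for v
  proof -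
    have "v \<notin> T"
    proof
      assume "v \<in> T"
      moreover have "v \<in> F \<or> v \<in> nbrs \<sigma> f1 \<or> v \<in> nbrs \<sigma> f2 \<or> v \<in> nbrs \<sigma> f3"
        using v f(1) nb N fV by blast
      ultimately show False using F free f(1) by blast
    qed
    then have "x v = 0" by (rule T(2))
    moreover have "ell \<sigma> f1 = 1" using ell_1[OF fV(1)] f1_remove by blast
    moreover have "ell \<sigma> f3 = 1" using ell_1[OF fV(3)] conv.f1_remove unfolding cN by blast
    moreover have "ell \<sigma> f2 = 1"
    proof -
      have "\<sigma> ! f1 \<in> {1..length \<sigma>}" "\<sigma> ! f3 \<in> {1..length \<sigma>}"
        using perm fV nth_mem unfolding is_perm_def by blast+
      then have "f2 \<notin> extremal_positions \<sigma>" using chain fV by (auto simp: extremal_positions_def below_def)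
      then show ?thesis using ell_1[OF fV(2)] by blast
    qed
    ultimately show ?thesis using v ell1 unfolding y_def by auto
  qed
  have ypos: "y v \<ge> 1" for v by (simp add: y_def ell_def)
  define n where "n = sum y ?V"
  have n: "ell_total \<sigma> + (\<Sum>i\<in>T. x i) = n"
  proof -
    have "sum x T = sum x ?V" by (rule sum.mono_neutral_left) (use T in auto)
    then show ?thesis by (simp add: n_def y_def sum.distrib ell_total_def)
  qed
  have E: "int (inversion_weight \<sigma> y) = 2 * int n - 7 + int \<delta>"
    using inversion_weight_cell[OF perm cell] unfolding n_def y_def .
  have W: "edge_weight N y ?V = 2 * inversion_weight \<sigma> y" by (rule edge_weight_incomparable[OF dist])
  note bound = weight_bound[of y, OF ypos y1, folded n_def, unfolded W]
  have le: "n \<le> \<delta> + 8" using bound(1) E by linarith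
  have "n \<noteq> \<delta> + 8" if "\<delta> \<le> 4" using bound(2) E that by linarith
  moreover have "n \<noteq> \<delta> + 7" if "\<delta> = 3" using bound(3) E that by linarith
  ultimately show ?thesis unfolding n using le \<delta> by auto
qed

section \<open>Permutations attaining the bound\<close>

text \<open>
  An executable sufficient condition for connectedness of the inversion graph.
\<close>
definition no_split :: "nat list \<Rightarrow> bool" where
  "no_split xs \<longleftrightarrow> (\<forall>j\<in>set [1..<length xs]. \<exists>a\<in>set (take j xs). \<exists>c\<in>set (drop j xs). c < a)"

lemma no_split_connected:
  assumes "no_split xs" "distinct xs"
  shows "connected_on (nbrs xs) {..<length xs}"
  unfolding connected_iff_no_split[OF assms(2)]
proof
  assume "\<exists>j. splits_at xs j"
  then obtain j where j: "1 \<le> j" "j < length xs" "\<forall>p<j. \<forall>q. j \<le> q \<longrightarrow> q < length xs \<longrightarrow> xs ! p < xs ! q"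
    unfolding splits_at_def by blast
  then obtain a c where ac: "a \<in> set (take j xs)" "c \<in> set (drop j xs)" "c < a"
    using assms(1) unfolding no_split_def by (metis atLeastLessThan_iff set_upt)
  obtain p where "p < j" "a = xs ! p" using ac(1) j by (auto simp: in_set_conv_nth)
  moreover obtain q where "q < length xs - j" "c = xs ! (j + q)" using ac(2) j by (auto simp: in_set_conv_nth)
  ultimately have "a < c" using j(3) by simp
  then show False using ac(3) by simp
qed

text \<open>
  An executable form of the hypotheses on \<open>\<sigma>\<close> in \<open>inflate_residual\<close>, together with reducedness. For
  the avoidance it suffices to look for an inversion that plays the role of \<open>32\<close>.
\<close>
definition robust :: "nat list \<Rightarrow> bool" where
  "robust \<sigma> \<longleftrightarrow> distinct \<sigma> \<and> set \<sigma> = set [1..<Suc (length \<sigma>)] \<and> no_split \<sigma> \<and>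
     (\<forall>i\<in>set [0..<length \<sigma>]. (i = 0 \<or> i = length \<sigma> - 1 \<or> \<sigma> ! i = 1 \<or> \<sigma> ! i = length \<sigma>) \<longrightarrow>
        no_split (take i \<sigma> @ drop (Suc i) \<sigma>)) \<and>
     (\<forall>i\<in>set [0..<length \<sigma> - 1]. \<sigma> ! Suc i \<noteq> \<sigma> ! i + 1) \<and>
     (\<forall>j\<in>set [0..<length \<sigma>]. \<forall>k\<in>set [Suc j..<length \<sigma>]. \<sigma> ! k < \<sigma> ! j \<longrightarrow>
        (\<forall>a\<in>set (take j \<sigma>). \<not> a < \<sigma> ! k) \<or> (\<forall>c\<in>set (drop (Suc k) \<sigma>). \<not> \<sigma> ! j < c))"

lemma robustD:
  assumes "robust \<sigma>"
  shows "is_perm \<sigma>" "reduced \<sigma>" "avoids_1324 \<sigma>" "connected_on (nbrs \<sigma>) {..<length \<sigma>}"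
    and "i \<in> extremal_positions \<sigma> \<Longrightarrow> connected_on (nbrs \<sigma>) ({..<length \<sigma>} - {i})"
proof -
  have dist: "distinct \<sigma>" using assms by (simp add: robust_def)
  show perm: "is_perm \<sigma>"
    using assms by (simp add: robust_def is_perm_def atLeastLessThanSuc_atLeastAtMost del: upt_Suc)
  show "reduced \<sigma>" using assms unfolding robust_def reduced_def by auto
  show "connected_on (nbrs \<sigma>) {..<length \<sigma>}"
    using assms dist by (intro no_split_connected) (auto simp: robust_def)
  show "avoids_1324 \<sigma>"
    unfolding avoids_1324_def
  proof
    assume "\<exists>i1 i2 i3 i4. i1 < i2 \<and> i2 < i3 \<and> i3 < i4 \<and> i4 < length \<sigma> \<and>
       \<sigma> ! i1 < \<sigma> ! i3 \<and> \<sigma> ! i3 < \<sigma> ! i2 \<and> \<sigma> ! i2 < \<sigma> ! i4"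
    then obtain i j k l where o: "i < j" "j < k" "k < l" "l < length \<sigma>"
      "\<sigma> ! i < \<sigma> ! k" "\<sigma> ! k < \<sigma> ! j" "\<sigma> ! j < \<sigma> ! l" by blast
    have "\<sigma> ! i \<in> set (take j \<sigma>)" using o by (auto simp: in_set_conv_nth intro!: exI[of _ i])
    moreover have "\<sigma> ! l \<in> set (drop (Suc k) \<sigma>)"
      using o by (auto simp: in_set_conv_nth intro!: exI[of _ "l - Suc k"])
    moreover have "j \<in> set [0..<length \<sigma>]" "k \<in> set [Suc j..<length \<sigma>]" using o by auto
    ultimately show False using assms o unfolding robust_def by blast
  qed
  show "connected_on (nbrs \<sigma>) ({..<length \<sigma>} - {i})" if i: "i \<in> extremal_positions \<sigma>"
  proof -
    have lt: "i < length \<sigma>" using i by (simp add: extremal_positions_def)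
    let ?xs = "take i \<sigma> @ drop (Suc i) \<sigma>"
    have "distinct (take i \<sigma> @ \<sigma> ! i # drop (Suc i) \<sigma>)" using dist lt by (simp add: id_take_nth_drop[symmetric])
    then have d: "distinct ?xs" by simp
    have "i \<in> set [0..<length \<sigma>]" using lt by simp
    then have "no_split ?xs"
      using assms i unfolding robust_def extremal_positions_def mem_Collect_eq by blast
    then have "connected_on (nbrs ?xs) {..<length ?xs}" using d by (rule no_split_connected)
    then have "\<not> decomposable (delete_position i \<sigma>)"
      unfolding delete_position_def using decomposable_standardize_iff[OF d] by blast
    then show ?thesis using decomposable_delete_position_iff[OF perm lt] by blast
  qed
qed

text \<open>
  For a robust \<open>\<sigma>\<close> all \<open>\<ell>\<^sub>i\<close> are \<open>1\<close>, so an entry of degree \<open>d\<close> has \<open>a\<^sub>i = d - 2\<close>. Inflating an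
  entry \<open>k\<close> of degree \<open>3\<close> by \<open>m\<close> extra elements raises \<open>Q\<close> by exactly \<open>m\<close>.
\<close>
lemma robust_cell:
  assumes rob: "robust \<sigma>" and len: "length \<sigma> \<ge> 3" and F: "F \<subseteq> {..<length \<sigma>}"
    and free: "\<And>i. i \<in> F \<Longrightarrow> card (nbrs \<sigma> i) = 2 \<and> nbrs \<sigma> i \<inter> insert k F = {}"
    and k: "k < length \<sigma>" "k \<notin> F" "card (nbrs \<sigma> k) = 3"
    and \<delta>: "int \<delta> = int m + int (inv_count \<sigma>) - 2 * int (length \<sigma>) + 7"
  shows "\<sigma> \<in> \<Sigma> \<delta>"
    and "\<exists>T x. (T, x, F) \<in> canonical_cells \<delta> \<sigma> \<and> ell_total \<sigma> + (\<Sum>i\<in>T. x i) = length \<sigma> + m"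
proof -
  note perm = robustD(1)[OF rob]
  have ell: "ell \<sigma> i = 1" for i
  proof -
    have "\<not> decomposable (delete_position i \<sigma>)" if "i \<in> extremal_positions \<sigma>"
      using robustD(5)[OF rob that] decomposable_delete_position_iff[OF perm, of i] that
      by (auto simp: extremal_positions_def)
    then have "i \<notin> dbl_positions \<sigma>" using len by (auto simp: dbl_positions_def)
    then show ?thesis by (simp add: ell_def)
  qed
  define x where "x i = (if i = k then m else 0)" for i
  define T where "T = (if m = 0 then {} else {k})"
  have ac: "acoef \<sigma> i = int (card (nbrs \<sigma> i)) - 2" for i by (simp add: acoef_def ell)
  interpret ell: inflation \<sigma> "ell \<sigma>" by unfold_locales (use perm in \<open>auto simp: ell_def\<close>)
  have L: "ell_total \<sigma> = length \<sigma>" by (simp add: ell_total_def ell)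
  have "\<delta>0 \<sigma> = int (inv_count \<sigma>) - 2 * int (length \<sigma>) + 7"
    unfolding \<delta>0_def ell.inv_count_\<pi> L by (simp add: ell inv_count_def case_prod_unfold)
  moreover have "Qform \<sigma> x = int m"
  proof -
    have "(\<Sum>i<length \<sigma>. acoef \<sigma> i * int (x i)) = (\<Sum>i\<in>{k}. acoef \<sigma> i * int (x i))"
      by (rule sum.mono_neutral_right) (use k in \<open>auto simp: x_def\<close>)
    moreover have "(\<Sum>(i, j)\<in>Inv \<sigma>. int (x i) * int (x j)) = 0"
      by (rule sum.neutral) (auto simp: x_def Inv_def)
    ultimately show ?thesis using k by (simp add: Qform_def ac x_def)
  qed
  ultimately have Q: "Qform \<sigma> x = int \<delta> - \<delta>0 \<sigma>" using \<delta> by simp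
  have T: "T \<subseteq> {k}" "\<And>i. i \<in> T \<Longrightarrow> x i \<ge> 1" "\<And>i. i \<notin> T \<Longrightarrow> x i = 0" "\<And>i. i \<in> T \<Longrightarrow> acoef \<sigma> i \<ge> 1"
    using k by (auto simp: T_def x_def ac split: if_splits)
  have fr: "acoef \<sigma> i = 0 \<and> nbrs \<sigma> i \<inter> (T \<union> F) = {}" if "i \<in> F" for i
    using free[OF that] T(1) by (auto simp: ac)
  have cell: "(T, x, F) \<in> canonical_cells \<delta> \<sigma>"
    unfolding canonical_cells_def using T Q F fr k by auto
  moreover have "ell_total \<sigma> + (\<Sum>i\<in>T. x i) = length \<sigma> + m" by (simp add: L T_def x_def)
  ultimately show "\<exists>T x. (T, x, F) \<in> canonical_cells \<delta> \<sigma> \<and> ell_total \<sigma> + (\<Sum>i\<in>T. x i) = length \<sigma> + m"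
    by blast
  let ?y = "\<lambda>i. ell \<sigma> i + x i"
  interpret y: inflation \<sigma> ?y by unfold_locales (use perm in \<open>auto simp: ell_def\<close>)
  let ?n = "sum ?y {..<length \<sigma>}"
  have R: "inflate \<sigma> ?y \<in> \<R> \<delta> ?n"
    by (rule y.inflate_residual[OF robustD(3,4)[OF rob] robustD(5)[OF rob] len
          inversion_weight_cell[OF perm cell, unfolded inversion_weight_def]])
  have n: "?n \<ge> 3"
    using sum_mono[of "{..<length \<sigma>}" "\<lambda>_. 1" ?y] len by (simp add: ell)
  have "\<sigma> \<in> permutations_of_set {1..length \<sigma>}" using perm is_perm_iff by blast
  moreover have "\<forall>i<length \<sigma>. ?y i \<ge> 1" by (simp add: ell)
  ultimately show "\<sigma> \<in> \<Sigma> \<delta>"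
    unfolding \<Sigma>_def mem_Collect_eq
    by (intro conjI exI[of _ "length \<sigma>"] robustD(2)[OF rob] exI[of _ ?y] exI[of _ ?n] R n)
qed

lemma nbrs_filter:
  "i < length \<sigma> \<Longrightarrow> nbrs \<sigma> i = set (filter (\<lambda>j. (i < j \<and> \<sigma> ! j < \<sigma> ! i) \<or> (j < i \<and> \<sigma> ! i < \<sigma> ! j)) [0..<length \<sigma>])"
  by (auto simp: nbrs_def Inv_def)

lemma inv_count_filter:
  "inv_count \<sigma> = length (concat (map (\<lambda>i. filter (\<lambda>j. i < j \<and> \<sigma> ! j < \<sigma> ! i) [0..<length \<sigma>]) [0..<length \<sigma>]))"
proof -
  have "Inv \<sigma> = Sigma {..<length \<sigma>} (\<lambda>i. {j. j < length \<sigma> \<and> i < j \<and> \<sigma> ! j < \<sigma> ! i})"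
    by (auto simp: Inv_def)
  then have "inv_count \<sigma> = (\<Sum>i<length \<sigma>. card {j. j < length \<sigma> \<and> i < j \<and> \<sigma> ! j < \<sigma> ! i})"
    by (simp add: inv_count_def)
  also have "\<dots> = (\<Sum>i<length \<sigma>. length (filter (\<lambda>j. i < j \<and> \<sigma> ! j < \<sigma> ! i) [0..<length \<sigma>]))"
  proof (rule sum.cong[OF refl])
    fix i
    let ?f = "filter (\<lambda>j. i < j \<and> \<sigma> ! j < \<sigma> ! i) [0..<length \<sigma>]"
    have "card (set ?f) = length ?f" by (rule distinct_card) simp
    then show "card {j. j < length \<sigma> \<and> i < j \<and> \<sigma> ! j < \<sigma> ! i} = length ?f" by simp
  qed
  also have "\<dots> = sum_list (map (\<lambda>i. length (filter (\<lambda>j. i < j \<and> \<sigma> ! j < \<sigma> ! i) [0..<length \<sigma>])) [0..<length \<sigma>])"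
    by (simp add: sum_list_distinct_conv_sum_set atLeast0LessThan)
  finally show ?thesis by (simp add: length_concat comp_def)
qed

text \<open>
  The extremal configurations of \<open>weight_bound\<close>: in \<open>\<sigma>9\<close> the sets \<open>A\<close> and \<open>C\<close> are empty, in \<open>\<sigma>11\<close>
  only \<open>C\<close> is empty, and in \<open>\<sigma>13\<close> both are inversions \<open>21\<close>. The set \<open>F\<close> consists of the positions
  with two neighbours in the lists of neighbourhoods below, and in each of the three permutations there
  is one element between \<open>f1\<close> and \<open>f2\<close> and one between \<open>f2\<close> and \<open>f3\<close>.
\<close>
definition \<sigma>9 :: "nat list" where "\<sigma>9 = [6, 3, 1, 9, 2, 4, 8, 5, 7]"
definition \<sigma>11 :: "nat list" where "\<sigma>11 = [8, 5, 2, 1, 3, 11, 4, 6, 10, 7, 9]"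
definition \<sigma>13 :: "nat list" where "\<sigma>13 = [8, 5, 2, 1, 3, 13, 4, 6, 12, 7, 9, 11, 10]"

lemma robust_\<sigma>9: "robust \<sigma>9" unfolding \<sigma>9_def by code_simp
lemma robust_\<sigma>11: "robust \<sigma>11" unfolding \<sigma>11_def by code_simp
lemma robust_\<sigma>13: "robust \<sigma>13" unfolding \<sigma>13_def by code_simp

lemma nbrs_\<sigma>9: "nbrs \<sigma>9 2 = {0, 1}" "nbrs \<sigma>9 5 = {0, 3}" "nbrs \<sigma>9 8 = {3, 6}" "nbrs \<sigma>9 4 = {0, 1, 3}"
  unfolding \<sigma>9_def by (simp_all add: nbrs_filter upt_rec numeral_eq_Suc)

lemma nbrs_\<sigma>11: "nbrs \<sigma>11 4 = {0, 1}" "nbrs \<sigma>11 7 = {0, 5}" "nbrs \<sigma>11 10 = {5, 8}" "nbrs \<sigma>11 2 = {0, 1, 3}"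
  unfolding \<sigma>11_def by (simp_all add: nbrs_filter upt_rec numeral_eq_Suc)

lemma nbrs_\<sigma>13: "nbrs \<sigma>13 4 = {0, 1}" "nbrs \<sigma>13 7 = {0, 5}" "nbrs \<sigma>13 10 = {5, 8}" "nbrs \<sigma>13 2 = {0, 1, 3}"
  unfolding \<sigma>13_def by (simp_all add: nbrs_filter upt_rec numeral_eq_Suc)

lemma inv_count_witnesses: "inv_count \<sigma>9 = 14" "inv_count \<sigma>11 = 19" "inv_count \<sigma>13 = 24"
  unfolding inv_count_filter \<sigma>9_def \<sigma>11_def \<sigma>13_def by (simp_all add: upt_rec)

lemma length_witnesses: "length \<sigma>9 = 9" "length \<sigma>11 = 11" "length \<sigma>13 = 13"
  by (simp_all add: \<sigma>9_def \<sigma>11_def \<sigma>13_def)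

lemma rank_three_size_attained:
  assumes "\<delta> \<ge> 3"
  shows "\<exists>\<sigma>\<in>\<Sigma> \<delta>. \<exists>T x F. (T, x, F) \<in> canonical_cells \<delta> \<sigma> \<and> card F = 3 \<and>
    ell_total \<sigma> + (\<Sum>i\<in>T. x i) = (if \<delta> = 3 then 9 else if \<delta> = 4 then 11 else \<delta> + 8)"
proof -
  consider "\<delta> = 3" | "\<delta> = 4" | "\<delta> \<ge> 5" using assms by linarith
  then show ?thesis
  proof cases
    case 1
    note cell = robust_cell[OF robust_\<sigma>9, of "{2, 5, 8}" 4 \<delta> 0]
    have "\<sigma>9 \<in> \<Sigma> \<delta>" by (rule cell(1)) (use 1 in \<open>auto simp: nbrs_\<sigma>9 inv_count_witnesses length_witnesses\<close>)
    moreover have "\<exists>T x. (T, x, {2, 5, 8}) \<in> canonical_cells \<delta> \<sigma>9 \<and>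
        ell_total \<sigma>9 + (\<Sum>i\<in>T. x i) = length \<sigma>9 + 0"
      by (rule cell(2)) (use 1 in \<open>auto simp: nbrs_\<sigma>9 inv_count_witnesses length_witnesses\<close>)
    moreover have "card {2, 5, 8::nat} = 3" "length \<sigma>9 + 0 = 9" by (simp_all add: length_witnesses)
    ultimately show ?thesis unfolding if_P[OF 1] by metis
  next
    case 2
    note cell = robust_cell[OF robust_\<sigma>11, of "{4, 7, 10}" 2 \<delta> 0]
    have "\<sigma>11 \<in> \<Sigma> \<delta>" by (rule cell(1)) (use 2 in \<open>auto simp: nbrs_\<sigma>11 inv_count_witnesses length_witnesses\<close>)
    moreover have "\<exists>T x. (T, x, {4, 7, 10}) \<in> canonical_cells \<delta> \<sigma>11 \<and>
        ell_total \<sigma>11 + (\<Sum>i\<in>T. x i) = length \<sigma>11 + 0"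
      by (rule cell(2)) (use 2 in \<open>auto simp: nbrs_\<sigma>11 inv_count_witnesses length_witnesses\<close>)
    moreover have "card {4, 7, 10::nat} = 3" "length \<sigma>11 + 0 = 11" by (simp_all add: length_witnesses)
    moreover have "(if \<delta> = 3 then 9 else if \<delta> = 4 then 11 else \<delta> + 8) = 11" using 2 by simp
    ultimately show ?thesis by metis
  next
    case 3
    note cell = robust_cell[OF robust_\<sigma>13, of "{4, 7, 10}" 2 \<delta> "\<delta> - 5"]
    have "\<sigma>13 \<in> \<Sigma> \<delta>" by (rule cell(1)) (use 3 in \<open>auto simp: nbrs_\<sigma>13 inv_count_witnesses length_witnesses\<close>)
    moreover have "\<exists>T x. (T, x, {4, 7, 10}) \<in> canonical_cells \<delta> \<sigma>13 \<and>
        ell_total \<sigma>13 + (\<Sum>i\<in>T. x i) = length \<sigma>13 + (\<delta> - 5)"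
      by (rule cell(2)) (use 3 in \<open>auto simp: nbrs_\<sigma>13 inv_count_witnesses length_witnesses\<close>)
    moreover have "card {4, 7, 10::nat} = 3"
      "length \<sigma>13 + (\<delta> - 5) = (if \<delta> = 3 then 9 else if \<delta> = 4 then 11 else \<delta> + 8)" using 3 by (simp_all add: length_witnesses)
    ultimately show ?thesis by metis
  qed
qed

section \<open>The onset\<close>

definition cell_poly :: "nat \<Rightarrow> real poly" where
  "cell_poly m = [:(real m + 1) * (real m + 2) / 2, - (2 * real m + 3) / 2, 1 / 2:]"

lemma poly_cell_poly: "poly (cell_poly m) (real n) = (real n - real m - 1) * (real n - real m - 2) / 2"
  by (simp add: cell_poly_def field_simps)

lemma cell_count_eq_poly:
  assumes "n > m"
  shows "real (cell_count m n) = poly (cell_poly m) (real n)"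
proof -
  obtain k where k: "n = m + 1 + k" using assms less_imp_Suc_add[of m n] by auto
  have "even (k * (k - 1))" by (cases k) auto
  then have "2 * (k choose 2) = k * (k - 1)" by (simp add: choose_two)
  then have "2 * real (k choose 2) = real k * real (k - 1)" by (metis of_nat_mult of_nat_numeral)
  then have ck: "real (k choose 2) = real k * (real k - 1) / 2" by (cases k) auto
  have pk: "poly (cell_poly m) (real n) = real k * (real k - 1) / 2"
    unfolding poly_cell_poly by (simp add: k)
  show ?thesis
  proof (cases "n \<ge> m + 3")
    case True
    then have "cell_count m n = k choose 2" using k by (simp add: cell_count_def)
    then show ?thesis unfolding pk ck[symmetric] by simp
  next
    case False
    then have "k = 0 \<or> k = 1" using k by auto
    then show ?thesis unfolding pk using False by (auto simp: cell_count_def)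
  qed
qed

lemma cell_count_less_poly: "real (cell_count m m) < poly (cell_poly m) (real m)"
  by (simp add: cell_count_def poly_cell_poly)

text \<open>
  At \<open>n = m c\<close>, the maximum, no summand exceeds its polynomial and that of \<open>c\<close> is strictly smaller.
\<close>
lemma onset_sum_cell_count:
  assumes fin: "finite I" and c: "c \<in> I" and max: "\<And>c'. c' \<in> I \<Longrightarrow> m c' \<le> m c"
    and f: "\<And>n. f n = (\<Sum>c\<in>I. cell_count (m c) n)"
  shows "\<exists>p :: real poly. degree p = 2 \<and>
    (\<forall>\<^sub>F n in sequentially. real (f n) = poly p (real n)) \<and> onset f p = m c + 1"
proof (intro exI conjI)
  let ?p = "\<Sum>c\<in>I. cell_poly (m c)"
  have deg: "degree (cell_poly k) = 2" for k by (simp add: cell_poly_def)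
  have "degree ?p \<le> 2" by (rule degree_sum_le[OF fin]) (simp add: deg)
  moreover have "coeff ?p 2 \<noteq> 0"
  proof -
    have "coeff ?p 2 = (\<Sum>c\<in>I. 1 / 2)"
      unfolding coeff_sum by (simp add: cell_poly_def numeral_2_eq_2)
    also have "\<dots> = real (card I) / 2" by simp
    finally have "coeff ?p 2 = real (card I) / 2" .
    then show ?thesis using fin c by auto
  qed
  ultimately show "degree ?p = 2" by (meson le_antisym le_degree)
  have poly: "poly ?p x = (\<Sum>c\<in>I. poly (cell_poly (m c)) x)" for x by (rule poly_sum)
  have eq: "real (f n) = poly ?p (real n)" if "n \<ge> m c + 1" for n
    unfolding f poly of_nat_sum
  proof (rule sum.cong[OF refl])
    fix c' assume "c' \<in> I"
    then show "real (cell_count (m c') n) = poly (cell_poly (m c')) (real n)"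
      using max[of c'] that by (intro cell_count_eq_poly) simp
  qed
  then show "\<forall>\<^sub>F n in sequentially. real (f n) = poly ?p (real n)"
    unfolding eventually_sequentially by blast
  have ne: "real (f (m c)) \<noteq> poly ?p (real (m c))"
  proof -
    have "real (f (m c)) < poly ?p (real (m c))"
      unfolding f poly of_nat_sum
    proof (rule sum_strict_mono_ex1[OF fin])
      show "\<forall>c'\<in>I. real (cell_count (m c') (m c)) \<le> poly (cell_poly (m c')) (real (m c))"
      proof
        fix c' assume "c' \<in> I"
        then consider "m c' < m c" | "m c' = m c" using max[of c'] by linarith
        then show "real (cell_count (m c') (m c)) \<le> poly (cell_poly (m c')) (real (m c))"
          using cell_count_eq_poly[of "m c'" "m c"] cell_count_less_poly[of "m c"] by cases auto
      qed
      show "\<exists>c'\<in>I. real (cell_count (m c') (m c)) < poly (cell_poly (m c')) (real (m c))"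
        using c cell_count_less_poly by blast
    qed
    then show ?thesis by simp
  qed
  show "onset f ?p = m c + 1"
    unfolding onset_def
  proof (rule Least_equality)
    show "\<forall>n\<ge>m c + 1. real (f n) = poly ?p (real n)" using eq by blast
    fix N assume "\<forall>n\<ge>N. real (f n) = poly ?p (real n)"
    then have "\<not> N \<le> m c" using ne by blast
    then show "m c + 1 \<le> N" by simp
  qed
qed

definition rank_three_cells :: "nat \<Rightarrow> nat list \<Rightarrow> (nat set \<times> (nat \<Rightarrow> nat) \<times> nat set) set" where
  "rank_three_cells \<delta> \<sigma> = {(T, x, F). (T, x, F) \<in> canonical_cells \<delta> \<sigma> \<and> card F = 3}"

text \<open>
  The bound on \<open>L + t\<close> bounds all entries of \<open>x\<close>.
\<close>
lemma finite_rank_three_cells: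
  assumes \<sigma>: "\<sigma> \<in> \<Sigma> \<delta>" and \<delta>: "\<delta> \<ge> 3"
  shows "finite (rank_three_cells \<delta> \<sigma>)"
proof -
  let ?V = "{..<length \<sigma>}"
  let ?X = "{x :: nat \<Rightarrow> nat. \<forall>i. (i \<in> ?V \<longrightarrow> x i \<in> {..\<delta> + 8}) \<and> (i \<notin> ?V \<longrightarrow> x i = 0)}"
  have "rank_three_cells \<delta> \<sigma> \<subseteq> Pow ?V \<times> ?X \<times> Pow ?V"
  proof
    fix c assume "c \<in> rank_three_cells \<delta> \<sigma>"
    then obtain T x F where c: "c = (T, x, F)" and cell: "(T, x, F) \<in> canonical_cells \<delta> \<sigma>" and F3: "card F = 3"
      by (auto simp: rank_three_cells_def)
    have T: "T \<subseteq> ?V" "F \<subseteq> ?V" "\<And>i. i \<notin> T \<Longrightarrow> x i = 0"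
      using cell by (auto simp: canonical_cells_def)
    have bound: "(\<Sum>i\<in>T. x i) \<le> \<delta> + 8"
      using rank_three_size[OF \<sigma> cell F3 \<delta>] \<delta> by (auto split: if_splits)
    have "x i \<le> \<delta> + 8" for i
    proof (cases "i \<in> T")
      case True
      then have "x i \<le> (\<Sum>i\<in>T. x i)" using T(1) finite_subset by (intro member_le_sum) auto
      then show ?thesis using bound by simp
    next
      case False
      then show ?thesis using T(3) by simp
    qed
    then have "x \<in> ?X" using T by auto
    then show "c \<in> Pow ?V \<times> ?X \<times> Pow ?V" using c T by blast
  qed
  moreover have "finite ?X" by (rule finite_set_of_finite_funs) auto
  ultimately show ?thesis by (auto intro: finite_subset)
qed

theorem proposition7p3:
  fixes \<delta> :: nat
  assumes "\<delta> \<ge> 3"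
  shows "\<exists>p :: real poly. degree p = 2 \<and>
           (\<forall>\<^sub>F n in sequentially. real (H3 \<delta> n) = poly p (real n)) \<and>
           onset (H3 \<delta>) p = (if \<delta> = 3 then 10 else if \<delta> = 4 then 12 else \<delta> + 9)"
proof -
  define I where "I = Sigma (\<Sigma> \<delta>) (rank_three_cells \<delta>)"
  define m :: "nat list \<times> nat set \<times> (nat \<Rightarrow> nat) \<times> nat set \<Rightarrow> nat"
    where "m = (\<lambda>(\<sigma>, T, x, F). ell_total \<sigma> + (\<Sum>i\<in>T. x i))"
  define M where "M = (if \<delta> = 3 then 9 else if \<delta> = 4 then 11 else \<delta> + 8)"
  have fin: "finite I"
    unfolding I_def by (rule finite_SigmaI) (use finite_\<Sigma> finite_rank_three_cells assms in auto)
  have "H3 \<delta> n = (\<Sum>c\<in>I. cell_count (m c) n)" for n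
  proof -
    have "H3 \<delta> n = (\<Sum>\<sigma>\<in>\<Sigma> \<delta>. \<Sum>c\<in>rank_three_cells \<delta> \<sigma>. cell_count (m (\<sigma>, c)) n)"
      unfolding H3_def rank_three_cells_def m_def by (simp add: case_prod_unfold)
    also have "\<dots> = (\<Sum>(\<sigma>, c)\<in>I. cell_count (m (\<sigma>, c)) n)"
      unfolding I_def by (rule sum.Sigma) (use finite_\<Sigma> finite_rank_three_cells assms in auto)
    finally show ?thesis by (simp add: case_prod_unfold)
  qed
  moreover obtain c where c: "c \<in> I" "m c = M"
  proof -
    obtain \<sigma> T x F where "\<sigma> \<in> \<Sigma> \<delta>" "(T, x, F) \<in> canonical_cells \<delta> \<sigma>" "card F = 3"
      "ell_total \<sigma> + (\<Sum>i\<in>T. x i) = M"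
      using rank_three_size_attained[OF assms] unfolding M_def by blast
    then show ?thesis by (intro that[of "(\<sigma>, T, x, F)"]) (auto simp: I_def rank_three_cells_def m_def)
  qed
  moreover have "m c' \<le> m c" if "c' \<in> I" for c'
  proof -
    obtain \<sigma> T x F where c': "c' = (\<sigma>, T, x, F)" by (cases c')
    then have "\<sigma> \<in> \<Sigma> \<delta>" "(T, x, F) \<in> canonical_cells \<delta> \<sigma>" "card F = 3"
      using that by (auto simp: I_def rank_three_cells_def)
    from rank_three_size[OF this assms] have "m c' \<le> M" unfolding M_def by (simp add: c' m_def)
    then show ?thesis using c(2) by simp
  qed
  ultimately have "\<exists>p :: real poly. degree p = 2 \<and>
      (\<forall>\<^sub>F n in sequentially. real (H3 \<delta> n) = poly p (real n)) \<and> onset (H3 \<delta>) p = m c + 1"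
    using fin by (intro onset_sum_cell_count)
  moreover have "m c + 1 = (if \<delta> = 3 then 10 else if \<delta> = 4 then 12 else \<delta> + 9)"
    unfolding c(2) M_def by simp
  ultimately show ?thesis by simp
qed

end
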